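(* Let $(R,\mathfrak{m})$ be a commutative Noetherian local ring that is not Gorenstein, with $\mathfrak{m}^3=0\neq\mathfrak{m}^2$, and suppose that $R$ contains exact zero divisors. Let $M$ be an $R$-module that has an upper triangular presentation matrix. Then the non-zero entries on the main diagonal of that presentation matrix are exact zero divisors if and only if $M$ is totally reflexive.
   Context: Let $R$ be a commutative Noetherian local ring. Totally reflexive: a finitely generated $R$-module $M$ is totally reflexive if the biduality map $M\to \operatorname{Hom}_R(\operatorname{Hom}_R(M,R),R)$ is an isomorphism and $\operatorname{Ext}_R^i(M,R)=0=\operatorname{Ext}_R^i(\operatorname{Hom}_R(M,R),R)$ for all $i>0$. Exact zero divisor: a non-unit $a\in R$ is an exact zero divisor if there exists $b\in R$ with $(0:a)=(b)$ and $(0:b)=(a)$. Presentation matrix: presentation matrices are understood to be minimal, i.e. a presentation matrix of a finitely generated module $M$ with minimal number of generators $n$ is a matrix over $R$ with $n$ rows whose cokernel is isomorphic to $M$ and whose columns form a minimal generating set of the kernel of the corresponding surjection $R^n\to M$. Here an upper triangular matrix is a square matrix $(a_{ij})$ with $a_{ij}=0$ whenever $i>j$.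
   Formalization: The diagonal condition is that all main diagonal entries are non-zero and exact zero divisors; allowing zero entries makes the claim false, e.g. [[x,y],[0,0]] over k[x,y,z]/(x²,y²,z²,yz). "R contains exact zero divisors" means non-zero ones, since 0 fits the definition given. *)

theory Defs
  imports
    "Jordan_Normal_Form.Matrix_Kernel"
    "HOL-Algebra.Ring_Divisibility"
    "HOL-Algebra.Ideal_Product"
begin

text \<open>
  The base ring is a type \<open>'a :: comm_ring_1\<close>, viewed as the HOL-Algebra ring \<open>class_ring\<close>
  with carrier \<open>UNIV\<close>; its modules are arbitrary HOL-Algebra modules (with carriers) over
  \<open>class_ring\<close>. The free module of rank \<open>n\<close> is \<open>module_vec TYPE('a) n\<close>.
\<close>

abbreviation fspan :: "('a::comm_ring_1, 'm) module \<Rightarrow> 'm set \<Rightarrow> 'm set" where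
  "fspan M S \<equiv> LinearCombinations.module.span class_ring M S"

abbreviation mhom :: "('a::comm_ring_1, 'm) module \<Rightarrow> ('a, 'n) module \<Rightarrow> ('m \<Rightarrow> 'n) set" where
  "mhom M N \<equiv> LinearCombinations.module_hom class_ring M N"

definition finitely_generated :: "('a::comm_ring_1, 'm) module \<Rightarrow> bool" where
  "finitely_generated M \<longleftrightarrow> (\<exists>S \<subseteq> carrier M. finite S \<and> fspan M S = carrier M)"

definition min_number_of_generators :: "('a::comm_ring_1, 'm) module \<Rightarrow> nat" where
  "min_number_of_generators M =
    (LEAST k. \<exists>S \<subseteq> carrier M. finite S \<and> card S = k \<and> fspan M S = carrier M)"

definition hom_kernel :: "('a, 'm) module \<Rightarrow> ('a, 'n) module \<Rightarrow> ('m \<Rightarrow> 'n) \<Rightarrow> 'm set" where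
  "hom_kernel M N f = {x \<in> carrier M. f x = \<zero>\<^bsub>N\<^esub>}"

definition ring_module :: "('a::comm_ring_1, 'a) module" where
  "ring_module = \<lparr>carrier = UNIV, monoid.mult = (*), one = 1, zero = 0, add = (+), module.smult = (*)\<rparr>"

text \<open>Homomorphisms are represented by functions that are \<open>undefined\<close> off the carrier, so that
  each homomorphism has exactly one representative.\<close>

definition hom_module :: "('a::comm_ring_1, 'm) module \<Rightarrow> ('a, 'n) module \<Rightarrow> ('a, 'm \<Rightarrow> 'n) module" where
  "hom_module M N = \<lparr>
     carrier = mhom M N \<inter> extensional (carrier M),
     monoid.mult = undefined, one = undefined,
     zero = (\<lambda>x\<in>carrier M. \<zero>\<^bsub>N\<^esub>),
     add = (\<lambda>f g. \<lambda>x\<in>carrier M. f x \<oplus>\<^bsub>N\<^esub> g x),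
     module.smult = (\<lambda>r f. \<lambda>x\<in>carrier M. r \<odot>\<^bsub>N\<^esub> f x)\<rparr>"

abbreviation dual :: "('a::comm_ring_1, 'm) module \<Rightarrow> ('a, 'm \<Rightarrow> 'a) module" where
  "dual M \<equiv> hom_module M ring_module"

definition biduality :: "('a::comm_ring_1, 'm) module \<Rightarrow> 'm \<Rightarrow> ('m \<Rightarrow> 'a) \<Rightarrow> 'a" where
  "biduality M x = (\<lambda>f\<in>carrier (dual M). f x)"


section \<open>Ext\<close>

text \<open>A resolution of \<open>M\<close> by finite free modules: the \<open>i\<close>-th term is free of rank \<open>r i\<close>, the
  differential from term \<open>Suc i\<close> to term \<open>i\<close> is multiplication by the matrix \<open>D i\<close>, and \<open>p\<close> is
  the augmentation onto \<open>M\<close>.\<close>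

definition free_resolution ::
  "('a::comm_ring_1, 'm) module \<Rightarrow> (nat \<Rightarrow> nat) \<Rightarrow> (nat \<Rightarrow> 'a mat) \<Rightarrow> ('a vec \<Rightarrow> 'm) \<Rightarrow> bool" where
  "free_resolution M r D p \<longleftrightarrow>
     (\<forall>i. D i \<in> carrier_mat (r i) (r (Suc i))) \<and>
     p \<in> mhom (module_vec TYPE('a) (r 0)) M \<and>
     p ` carrier_vec (r 0) = carrier M \<and>
     hom_kernel (module_vec TYPE('a) (r 0)) M p = (\<lambda>v. D 0 *\<^sub>v v) ` carrier_vec (r 1) \<and>
     (\<forall>i. mat_kernel (D i) = (\<lambda>v. D (Suc i) *\<^sub>v v) ` carrier_vec (r (Suc (Suc i))))"

definition ext_cochains ::
  "(nat \<Rightarrow> nat) \<Rightarrow> ('a::comm_ring_1, 'n) module \<Rightarrow> nat \<Rightarrow> ('a, 'a vec \<Rightarrow> 'n) module" where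
  "ext_cochains r N i = hom_module (module_vec TYPE('a) (r i)) N"

definition ext_differential ::
  "(nat \<Rightarrow> nat) \<Rightarrow> (nat \<Rightarrow> 'a::comm_ring_1 mat) \<Rightarrow> nat \<Rightarrow> ('a vec \<Rightarrow> 'n) \<Rightarrow> 'a vec \<Rightarrow> 'n" where
  "ext_differential r D i f = (\<lambda>v\<in>carrier_vec (r (Suc i)). f (D i *\<^sub>v v))"

definition ext_cocycles ::
  "(nat \<Rightarrow> nat) \<Rightarrow> (nat \<Rightarrow> 'a::comm_ring_1 mat) \<Rightarrow> ('a, 'n) module \<Rightarrow> nat \<Rightarrow> ('a vec \<Rightarrow> 'n) set" where
  "ext_cocycles r D N i =
     hom_kernel (ext_cochains r N i) (ext_cochains r N (Suc i)) (ext_differential r D i)"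

definition ext_coboundaries ::
  "(nat \<Rightarrow> nat) \<Rightarrow> (nat \<Rightarrow> 'a::comm_ring_1 mat) \<Rightarrow> ('a, 'n) module \<Rightarrow> nat \<Rightarrow> ('a vec \<Rightarrow> 'n) set" where
  "ext_coboundaries r D N i =
     (case i of 0 \<Rightarrow> {\<zero>\<^bsub>ext_cochains r N 0\<^esub>}
      | Suc j \<Rightarrow> ext_differential r D j ` carrier (ext_cochains r N j))"

definition ext_group ::
  "(nat \<Rightarrow> nat) \<Rightarrow> (nat \<Rightarrow> 'a::comm_ring_1 mat) \<Rightarrow> ('a, 'n) module \<Rightarrow> nat \<Rightarrow> ('a vec \<Rightarrow> 'n) set monoid" where
  "ext_group r D N i =
     A_FactGroup ((ext_cochains r N i)\<lparr>carrier := ext_cocycles r D N i\<rparr>) (ext_coboundaries r D N i)"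

text \<open>\<open>Ext\<^sup>i(M, N) = 0\<close>. Up to isomorphism the group does not depend on the resolution, and over a
  Noetherian ring every finitely generated module has a resolution of this kind; the predicate is
  only intended for such modules \<open>M\<close>.\<close>

definition ext_vanishes :: "nat \<Rightarrow> ('a::comm_ring_1, 'm) module \<Rightarrow> ('a, 'n) module \<Rightarrow> bool" where
  "ext_vanishes i M N \<longleftrightarrow>
     (\<exists>r D p. free_resolution M r D p \<and> carrier (ext_group r D N i) = {\<one>\<^bsub>ext_group r D N i\<^esub>})"


section \<open>Totally reflexive modules and exact zero divisors\<close>

definition totally_reflexive :: "('a::comm_ring_1, 'm) module \<Rightarrow> bool" where
  "totally_reflexive M \<longleftrightarrow>
     Module.module class_ring M \<and> finitely_generated M \<and>
     biduality M \<in> mhom M (dual (dual M)) \<and>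
     bij_betw (biduality M) (carrier M) (carrier (dual (dual M))) \<and>
     (\<forall>i>0. ext_vanishes i M (ring_module :: ('a, 'a) module) \<and>
            ext_vanishes i (dual M) (ring_module :: ('a, 'a) module))"

definition ann :: "'a::comm_ring_1 \<Rightarrow> 'a set" where
  "ann a = {x. x * a = 0}"

text \<open>With this definition \<open>0\<close> qualifies (take \<open>b = 1\<close>), hence \<open>a \<noteq> 0\<close> has to be required
  separately where it is meant.\<close>

definition exact_zero_divisor :: "'a::comm_ring_1 \<Rightarrow> bool" where
  "exact_zero_divisor a \<longleftrightarrow>
     \<not> a dvd 1 \<and> (\<exists>b. ann a = PIdl\<^bsub>class_ring\<^esub> b \<and> ann b = PIdl\<^bsub>class_ring\<^esub> a)"


section \<open>Gorenstein rings\<close>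

text \<open>
  The two quantifications over modules below range over modules with carrier in \<open>'a vec\<close>, a type
  of cardinality \<open>max |R| \<aleph>\<^sub>0\<close>. Neither loses generality over a Noetherian ring. The extension
  property for all modules follows from that for the inclusions of ideals in \<open>R\<close> (Baer), and
  \<open>R\<close> is isomorphic to \<open>module_vec TYPE('a) 1\<close>. The terms of a minimal injective resolution of
  \<open>R\<close> are direct sums of finitely many copies of the hulls \<open>E(R/P)\<close> for each of the at most
  \<open>max |R| \<aleph>\<^sub>0\<close> many primes \<open>P\<close>, and \<open>E(R/P)\<close> has at most \<open>max |R| \<aleph>\<^sub>0\<close> elements.
\<close>

definition injective_module :: "('a::comm_ring_1, 'i) module \<Rightarrow> bool" where
  "injective_module I \<longleftrightarrow>
     Module.module class_ring I \<and>
     (\<forall>(B :: ('a, 'a vec) module) A f.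
        LinearCombinations.submodule class_ring A B \<and>
        f \<in> mhom (B\<lparr>carrier := A\<rparr>) I \<longrightarrow>
        (\<exists>g \<in> mhom B I. \<forall>x\<in>A. g x = f x))"

definition injective_resolution ::
  "('a::comm_ring_1, 'm) module \<Rightarrow> (nat \<Rightarrow> ('a, 'i) module) \<Rightarrow> ('m \<Rightarrow> 'i) \<Rightarrow> (nat \<Rightarrow> 'i \<Rightarrow> 'i) \<Rightarrow> bool" where
  "injective_resolution M I e d \<longleftrightarrow>
     (\<forall>i. injective_module (I i)) \<and>
     e \<in> mhom M (I 0) \<and> inj_on e (carrier M) \<and>
     (\<forall>i. d i \<in> mhom (I i) (I (Suc i))) \<and>
     hom_kernel (I 0) (I 1) (d 0) = e ` carrier M \<and>
     (\<forall>i. hom_kernel (I (Suc i)) (I (Suc (Suc i))) (d (Suc i)) = d i ` carrier (I i))"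

text \<open>Finite injective dimension over itself; to be used for Noetherian local rings.\<close>

definition gorenstein :: "'a::comm_ring_1 itself \<Rightarrow> bool" where
  "gorenstein ty \<longleftrightarrow>
     (\<exists>n (I :: nat \<Rightarrow> ('a, 'a vec) module) e d.
        injective_resolution (ring_module :: ('a, 'a) module) I e d \<and>
        (\<forall>i>n. carrier (I i) = {\<zero>\<^bsub>I i\<^esub>}))"


section \<open>Minimal presentation matrices\<close>

text \<open>The columns are a minimal generating set as a family: no proper subfamily generates. In
  particular, no column is zero or repeated.\<close>

definition presentation_matrix :: "('a::comm_ring_1, 'm) module \<Rightarrow> 'a mat \<Rightarrow> bool" where
  "presentation_matrix M A \<longleftrightarrow>
     (let n = dim_row A; F = module_vec TYPE('a) n in
       finitely_generated M \<and> n = min_number_of_generators M \<and>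
       (\<exists>p \<in> mhom F M.
          p ` carrier F = carrier M \<and>
          fspan F (col A ` {..<dim_col A}) = hom_kernel F M p \<and>
          (\<forall>J. J \<subset> {..<dim_col A} \<longrightarrow> fspan F (col A ` J) \<noteq> hom_kernel F M p)))"

end

theory Submission
  imports Defs
begin

text \<open>If every functional on \<open>\<mm>\<close> were multiplication by a scalar, then \<open>R\<close> would be self-injective
  (by Zorn, since \<open>\<mm>\<close> is nilpotent) and hence Gorenstein. So some functional on \<open>\<mm>\<close> is not scalar.
  Consequently an exact pair \<open>(a, b)\<close> satisfies \<open>a \<mm> = b \<mm> = \<mm>\<^sup>2\<close>, the square \<open>\<mm>\<^sup>2\<close> is the socle, and it is
  not principal.

  Let \<open>M\<close> be the cokernel of the upper triangular matrix \<open>A\<close>. If the diagonal entries of \<open>A\<close> are exact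
  zero divisors, then there are upper triangular matrices \<open>B\<close>, with the complementary divisors on the
  diagonal, such that \<open>A\<close> and \<open>B\<close>, and also their transposes, form exact periodic complexes. These
  complexes compute all Ext groups and the bidual of \<open>M\<close>.

  Conversely, put \<open>Z\<^sub>i = im A + \<langle>e\<^sub>0, \<dots>, e\<^sub>i\<^sub>-\<^sub>1\<rangle>\<close> in \<open>R\<^sup>n\<close>, so that \<open>a\<^sub>i\<^sub>i e\<^sub>i\<close> lies in \<open>Z\<^sub>i\<close>. For \<open>N = R\<^sup>n/Z\<^sub>i\<close> the
  three properties \<open>Ext\<^sup>1(N, R) = 0\<close>, \<open>N\<close> torsionless, \<open>Ext\<^sup>1(N\<^sup>*, R) = 0\<close> force \<open>a\<^sub>i\<^sub>i\<close> to be an exact zero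
  divisor, and they are then inherited by \<open>R\<^sup>n/Z\<^sub>i\<^sub>+\<^sub>1\<close>, so one can induct on \<open>i\<close>.\<close>

section \<open>Local rings with cube-zero maximal ideal\<close>

text \<open>The failure of Gorensteinness survives only as a non-scalar functional
  \<open>\<phi>\<close> on \<open>\<mm>\<close>. In the converse \<open>\<phi>\<close> is composed
  with a linear form that takes values in \<open>\<mm>\<close>, an Ext condition extends the result
  to a free module, and evaluating the extension would make \<open>\<phi>\<close> scalar. Dimension
  counts over the residue field are replaced by ascending chains and by ideals maximal among those
  missing one element, which act as hyperplanes. The matrices B come from back substitution. All
  entries lie in \<open>\<mm>\<close>, so each error term lies in \<open>\<mm>\<^sup>2\<close>,
  which is \<open>a \<mm>\<close> for every diagonal entry a and therefore absorbs it. In the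
  converse, let e be the class of \<open>e\<^sub>i\<close> in N and a the diagonal entry, so that a
  e = 0. A functional \<open>\<kappa>\<close> on N whose value at e is the complement of a shows
  that R e is a copy of R/(a) and that all its functionals extend to N as multiples of
  \<open>\<kappa>\<close>. This is why the properties descend to N/Re. Minimality of the
  presentation is used in two forms: the entries of A lie in \<open>\<mm>\<close>, and so do all
  coordinates of vectors in its kernel.\<close>

lemma ideal_class_ringI:
  assumes z: "0 \<in> I" and a: "\<And>x y. x \<in> I \<Longrightarrow> y \<in> I \<Longrightarrow> x + y \<in> I"
    and m: "\<And>r x. x \<in> I \<Longrightarrow> r * x \<in> I"
  shows "ideal I (class_ring :: 'a::comm_ring_1 ring)"
proof (rule idealI)
  show "ring (class_ring :: 'a ring)" by (rule class_ring.ring_axioms)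
  have neg: "- x \<in> I" if "x \<in> I" for x using m[OF that, of "-1"] by simp
  show "subgroup I (add_monoid (class_ring :: 'a ring))"
  proof (rule subgroup.intro)
    fix x assume x: "x \<in> I"
    have "inv\<^bsub>add_monoid (class_ring :: 'a ring)\<^esub> x = \<ominus>\<^bsub>class_ring\<^esub> x"
      by (simp only: a_inv_def)
    then show "inv\<^bsub>add_monoid (class_ring :: 'a ring)\<^esub> x \<in> I"
      using neg[OF x] by (simp only: class_ring_simps(8))
  qed (use z a in simp_all)
qed (use m in \<open>simp_all add: mult.commute\<close>)

lemma ideal_zero: "ideal I (class_ring :: 'a::comm_ring_1 ring) \<Longrightarrow> 0 \<in> I"
  using additive_subgroup.zero_closed[OF ideal.axioms(1)] by fastforce

lemma ideal_add: "ideal I (class_ring :: 'a::comm_ring_1 ring) \<Longrightarrow> x \<in> I \<Longrightarrow> y \<in> I \<Longrightarrow> x + y \<in> I"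
  using additive_subgroup.a_closed[OF ideal.axioms(1), of I class_ring x y] by simp

lemma ideal_mult: "ideal I (class_ring :: 'a::comm_ring_1 ring) \<Longrightarrow> x \<in> I \<Longrightarrow> r * x \<in> I"
  using ideal.I_l_closed[of I class_ring x r] by simp

lemma ideal_diff: "ideal I (class_ring :: 'a::comm_ring_1 ring) \<Longrightarrow> x \<in> I \<Longrightarrow> y \<in> I \<Longrightarrow> x - y \<in> I"
  using ideal_add[of I x "-1 * y"] ideal_mult[of I y "-1"] by simp

lemma ideal_sum:
  assumes "ideal I (class_ring :: 'a::comm_ring_1 ring)" "\<And>j. j \<in> J \<Longrightarrow> f j \<in> I"
  shows "sum f J \<in> I"
  using assms(2)
  by (induction J rule: infinite_finite_induct) (simp_all add: ideal_zero[OF assms(1)] ideal_add[OF assms(1)])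

text \<open>Zorn's lemma above a starting set, stated for an arbitrary predicate because it serves
  both ideals avoiding an element and graphs of partial functionals.\<close>

lemma exists_maximal_subset:
  assumes "P S" and chain: "\<And>C. C \<noteq> {} \<Longrightarrow> subset.chain {A. P A \<and> S \<subseteq> A} C \<Longrightarrow> P (\<Union>C)"
  shows "\<exists>T. P T \<and> S \<subseteq> T \<and> (\<forall>A. P A \<longrightarrow> T \<subseteq> A \<longrightarrow> A = T)"
proof -
  have "\<exists>T\<in>{A. P A \<and> S \<subseteq> A}. \<forall>A\<in>{A. P A \<and> S \<subseteq> A}. T \<subseteq> A \<longrightarrow> A = T"
  proof (rule subset_Zorn_nonempty)
    show "{A. P A \<and> S \<subseteq> A} \<noteq> {}" using assms(1) by blast
    fix C assume C: "C \<noteq> {}" "subset.chain {A. P A \<and> S \<subseteq> A} C"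
    then obtain A where "A \<in> C" "S \<subseteq> A" by (auto simp: subset_chain_def)
    then show "\<Union>C \<in> {A. P A \<and> S \<subseteq> A}" using chain[OF C] by auto
  qed
  then obtain T where T: "P T" "S \<subseteq> T" "\<forall>A\<in>{A. P A \<and> S \<subseteq> A}. T \<subseteq> A \<longrightarrow> A = T" by auto
  have "A = T" if "P A" "T \<subseteq> A" for A
    using T(3) subset_trans[OF T(2) that(2)] that by simp
  then show ?thesis using T(1,2) by metis
qed

text \<open>Symmetric in \<open>a\<close> and \<open>b\<close>, with both of them nonunits. This
  excludes \<open>a = 0\<close>, for which \<open>b\<close> would have to be a unit, so nonzeroness
  is built in.\<close>

definition exact_pair :: "'a::comm_ring_1 \<Rightarrow> 'a \<Rightarrow> bool" where
  "exact_pair a b \<longleftrightarrow> \<not> a dvd 1 \<and> \<not> b dvd 1 \<and>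
     (\<forall>x. a * x = 0 \<longleftrightarrow> b dvd x) \<and> (\<forall>x. b * x = 0 \<longleftrightarrow> a dvd x)"

lemma exact_pair_sym: "exact_pair a b \<Longrightarrow> exact_pair b a"
  by (simp add: exact_pair_def)

lemma exact_pair_mult_eq_0_iff: "exact_pair a b \<Longrightarrow> a * x = 0 \<longleftrightarrow> b dvd x"
  by (simp add: exact_pair_def)

lemma exact_pairE:
  assumes "exact_pair a b" "a * x = 0" obtains t where "x = b * t"
  using exact_pair_mult_eq_0_iff[OF assms(1)] assms(2) by (auto elim: dvdE)

lemma exact_pair_mult: "exact_pair a b \<Longrightarrow> a * b = 0"
  by (simp add: exact_pair_mult_eq_0_iff)

lemma cgenideal_class_ring: "PIdl\<^bsub>class_ring\<^esub> (b::'a::comm_ring_1) = {x. b dvd x}"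
proof -
  have "(\<exists>x. z = x * b) \<longleftrightarrow> b dvd z" for z by (simp only: dvd_def mult.commute)
  then show ?thesis unfolding cgenideal_def by simp
qed

text \<open>The complement of \<open>a\<close> is a unit exactly when 1 annihilates
  \<open>a\<close>, that is, when \<open>a = 0\<close>; so the nonzero condition turns into the
  nonunit condition on \<open>b\<close>.\<close>

lemma exact_zero_divisor_iff:
  "a \<noteq> 0 \<and> exact_zero_divisor a \<longleftrightarrow> (\<exists>b. exact_pair a b)" (is "?L \<longleftrightarrow> ?R")
proof
  assume L: ?L
  then obtain b where b: "ann a = {x. b dvd x}" "ann b = {x. a dvd x}" "\<not> a dvd 1"
    unfolding exact_zero_divisor_def cgenideal_class_ring by auto
  have "x * a = 0 \<longleftrightarrow> b dvd x" "x * b = 0 \<longleftrightarrow> a dvd x" for x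
    using b(1,2)[THEN eqset_imp_iff, of x] unfolding ann_def mem_Collect_eq by simp_all
  then have 1: "a * x = 0 \<longleftrightarrow> b dvd x" "b * x = 0 \<longleftrightarrow> a dvd x" for x
    by (metis mult.commute)+
  have "\<not> b dvd 1" using 1(1)[of 1] L by simp
  then show ?R using b(3) 1 unfolding exact_pair_def by auto
next
  assume ?R
  then obtain b where b: "exact_pair a b" ..
  have "a \<noteq> 0"
  proof
    assume "a = 0"
    then have "b dvd 1" using exact_pair_mult_eq_0_iff[OF b, of 1] by simp
    then show False using b by (simp add: exact_pair_def)
  qed
  moreover have "ann a = {x. b dvd x}" "ann b = {x. a dvd x}"
    using b unfolding exact_pair_def ann_def by (simp_all add: mult.commute)
  moreover have "\<not> a dvd 1" using b by (simp add: exact_pair_def)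
  ultimately show ?L unfolding exact_zero_divisor_def cgenideal_class_ring by auto
qed

text \<open>Only the position of \<open>W\<close> between the products of elements of
  \<open>\<mm>\<close> and the annihilator of \<open>\<mm>\<close> is recorded. In the end
  \<open>W\<close> is the square of \<open>\<mm>\<close>, and the product ideal has to be unfolded
  only there.\<close>

locale cube_zero_local_ring =
  fixes \<mm> W :: "'a::comm_ring_1 set"
  assumes ideal_m: "ideal \<mm> class_ring"
    and ideal_W: "ideal W class_ring"
    and m_iff: "x \<in> \<mm> \<longleftrightarrow> \<not> x dvd 1"
    and mult_in_W: "x \<in> \<mm> \<Longrightarrow> y \<in> \<mm> \<Longrightarrow> x * y \<in> W"
    and W_subset: "W \<subseteq> \<mm>"
    and m_mult_W: "x \<in> \<mm> \<Longrightarrow> w \<in> W \<Longrightarrow> x * w = 0"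
begin

text \<open>Surjectivity of the restriction from Hom(R,R) to Hom(\<open>\<mm>\<close>,R), i.e.
  Ext^1(R/\<open>\<mm>\<close>,R) = 0. The values of \<open>\<phi>\<close> outside
  \<open>\<mm>\<close> are arbitrary.\<close>

definition functionals_scalar :: bool where
  "functionals_scalar \<longleftrightarrow> (\<forall>\<phi>. (\<forall>x\<in>\<mm>. \<forall>y\<in>\<mm>. \<phi> (x + y) = \<phi> x + \<phi> y) \<longrightarrow>
     (\<forall>r. \<forall>x\<in>\<mm>. \<phi> (r * x) = r * \<phi> x) \<longrightarrow> (\<exists>c. \<forall>x\<in>\<mm>. \<phi> x = c * x))"

lemma unitE:
  assumes "x \<notin> \<mm>" obtains u where "u * x = 1"
proof -
  have "x dvd 1" using assms m_iff[of x] by simp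
  then obtain u where "1 = x * u" by (rule dvdE)
  then show ?thesis using that[of u] by (simp add: mult.commute)
qed

lemmas m_closed = ideal_zero[OF ideal_m] ideal_add[OF ideal_m] ideal_diff[OF ideal_m]
lemmas W_closed = ideal_zero[OF ideal_W] ideal_add[OF ideal_W] ideal_diff[OF ideal_W]

lemma m_mult: "x \<in> \<mm> \<Longrightarrow> r * x \<in> \<mm>" "x \<in> \<mm> \<Longrightarrow> x * r \<in> \<mm>"
  using ideal_mult[OF ideal_m, of x r] by (auto simp only: mult.commute)

lemma W_mult: "x \<in> W \<Longrightarrow> r * x \<in> W" "x \<in> W \<Longrightarrow> x * r \<in> W"
  using ideal_mult[OF ideal_W, of x r] by (auto simp only: mult.commute)

lemma unit_mult_in_W: "u \<notin> \<mm> \<Longrightarrow> u * x \<in> W \<Longrightarrow> x \<in> W"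
proof -
  assume "u \<notin> \<mm>" "u * x \<in> W"
  then obtain v where "v * u = 1" by (elim unitE)
  moreover have "v * (u * x) \<in> W" using W_mult(1) \<open>u * x \<in> W\<close> by metis
  ultimately show "x \<in> W" by (simp add: mult.assoc[symmetric])
qed

text \<open>By \<open>mU\<close> the quotient U/S is a vector space over the residue field, and
  \<open>H\<close> cuts out a hyperplane in it complementary to the line of \<open>w\<close>. It is
  an ideal that contains \<open>S\<close> and is maximal among those missing
  \<open>w\<close>.\<close>

lemma hyperplane_ideal:
  assumes S: "ideal S (class_ring :: 'a ring)" and U: "ideal U (class_ring :: 'a ring)" and "S \<subseteq> U"
    and mU: "\<And>x u. x \<in> \<mm> \<Longrightarrow> u \<in> U \<Longrightarrow> x * u \<in> S" and w: "w \<in> U" "w \<notin> S"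
  obtains H where "ideal H (class_ring :: 'a ring)" "S \<subseteq> H" "w \<notin> H"
    "\<And>x. x \<in> U \<Longrightarrow> \<exists>t. x - t * w \<in> H"
proof -
  define P where "P A \<longleftrightarrow> ideal A (class_ring :: 'a ring) \<and> w \<notin> A" for A
  have "\<exists>T. P T \<and> S \<subseteq> T \<and> (\<forall>A. P A \<longrightarrow> T \<subseteq> A \<longrightarrow> A = T)"
  proof (rule exists_maximal_subset)
    fix C assume C: "C \<noteq> {}" "subset.chain {A. P A \<and> S \<subseteq> A} C"
    then have "subset.chain {A. ideal A (class_ring :: 'a ring)} C"
      by (auto simp: subset_chain_def P_def)
    then have "ideal (\<Union>C) (class_ring :: 'a ring)"
      using ring.chain_Union_is_ideal[OF class_ring.ring_axioms, of C] C(1) by auto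
    moreover have "w \<notin> \<Union>C" using C(2) by (auto simp: subset_chain_def P_def)
    ultimately show "P (\<Union>C)" unfolding P_def by blast
  qed (use S w in \<open>simp add: P_def\<close>)
  then obtain H where H: "ideal H (class_ring :: 'a ring) \<and> w \<notin> H" and SH: "S \<subseteq> H"
    and max: "\<And>A. ideal A (class_ring :: 'a ring) \<and> w \<notin> A \<Longrightarrow> H \<subseteq> A \<Longrightarrow> A = H"
    unfolding P_def by auto
  note Hi = conjunct1[OF H]
  have "\<exists>t. x - t * w \<in> H" if x: "x \<in> U" for x
  proof (cases "x \<in> H")
    case True
    then have "x - 0 * w \<in> H" by simp
    then show ?thesis ..
  next
    case False
    \<comment> \<open>\<open>A\<close> is H + R x, which by maximality contains
      \<open>w\<close>.\<close>
    define A where "A = {z. \<exists>r. z - r * x \<in> H}"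
    have A_iff: "z \<in> A \<longleftrightarrow> (\<exists>r. z - r * x \<in> H)" for z by (simp only: A_def mem_Collect_eq)
    have "ideal A (class_ring :: 'a ring)"
    proof (rule ideal_class_ringI)
      have "0 - 0 * x \<in> H" using ideal_zero[OF Hi] by simp
      then show "0 \<in> A" unfolding A_iff by (rule exI)
    next
      fix p q assume "p \<in> A" "q \<in> A"
      then obtain r r' where "p - r * x \<in> H" "q - r' * x \<in> H" unfolding A_iff by (elim exE)
      then have "(p - r * x) + (q - r' * x) \<in> H" by (rule ideal_add[OF Hi])
      also have "(p - r * x) + (q - r' * x) = (p + q) - (r + r') * x" by (simp add: algebra_simps)
      finally show "p + q \<in> A" unfolding A_iff by (rule exI)
    next
      fix s p assume "p \<in> A"
      then obtain r where "p - r * x \<in> H" unfolding A_iff by (elim exE)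
      then have "s * (p - r * x) \<in> H" by (rule ideal_mult[OF Hi])
      also have "s * (p - r * x) = s * p - (s * r) * x" by (simp add: algebra_simps)
      finally show "s * p \<in> A" unfolding A_iff by (rule exI)
    qed
    moreover have "H \<subseteq> A"
    proof
      fix h assume "h \<in> H"
      then have "h - 0 * x \<in> H" by simp
      then show "h \<in> A" unfolding A_iff by (rule exI)
    qed
    moreover have "x \<in> A"
    proof -
      have "x - 1 * x \<in> H" using ideal_zero[OF Hi] by simp
      then show ?thesis unfolding A_iff by (rule exI)
    qed
    ultimately have "w \<in> A" using max[of A] False by metis
    then obtain r where h: "w - r * x \<in> H" unfolding A_iff by (elim exE)
    \<comment> \<open>Multiples of \<open>x\<close> by elements of \<open>\<mm>\<close> lie in
      \<open>S\<close>, so a nonunit \<open>r\<close> would put \<open>w\<close> into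
      \<open>H\<close>. For a unit \<open>r\<close> the relation can be solved for
      \<open>x\<close>.\<close>
    have r: "r \<notin> \<mm>"
    proof
      assume "r \<in> \<mm>"
      then have "r * x \<in> H" by (rule subsetD[OF SH mU[OF _ x]])
      then have "(w - r * x) + r * x \<in> H" by (rule ideal_add[OF Hi h])
      then show False using H by simp
    qed
    obtain u where u: "u * r = 1" by (rule unitE[OF r])
    have "(- u) * (w - r * x) = (u * r) * x - u * w" by (simp add: algebra_simps)
    also have "\<dots> = x - u * w" unfolding u by simp
    finally have "x - u * w \<in> H" using ideal_mult[OF Hi h, of "- u"] by (simp only:)
    then show ?thesis ..
  qed
  then show ?thesis by (rule that[OF conjunct1[OF H] SH conjunct2[OF H]])
qed

end

text \<open>\<open>nonscalar\<close> is what is kept of the ring not being Gorenstein.\<close>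

locale ezd_cube_zero_local_ring = cube_zero_local_ring \<mm> W
  for \<mm> W :: "'a::comm_ring_1 set" +
  assumes W_nonzero: "W \<noteq> {0}"
    and noetherian: "noetherian_ring (class_ring :: 'a ring)"
    and exact_pair_exists: "\<exists>a b::'a. exact_pair a b"
    and nonscalar: "\<not> functionals_scalar"
begin

section \<open>Consequences of one exact pair and one non-scalar functional\<close>

lemma nonscalar_functionalE:
  obtains \<phi> where "\<And>x y. x \<in> \<mm> \<Longrightarrow> y \<in> \<mm> \<Longrightarrow> \<phi> (x + y) = \<phi> x + \<phi> y"
    "\<And>r x. x \<in> \<mm> \<Longrightarrow> \<phi> (r * x) = r * \<phi> x"
    "\<And>c. \<exists>x\<in>\<mm>. \<phi> x \<noteq> c * x"
  using nonscalar unfolding functionals_scalar_def by metis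

lemma exact_pair_in_m: "exact_pair a b \<Longrightarrow> a \<in> \<mm>" "exact_pair a b \<Longrightarrow> b \<in> \<mm>"
  by (simp_all add: exact_pair_def m_iff)

lemma exact_pair_dvd_W: "exact_pair a b \<Longrightarrow> w \<in> W \<Longrightarrow> b dvd w"
  using m_mult_W[of a w] exact_pair_in_m(1)[of a b] exact_pair_mult_eq_0_iff[of a b w] by simp

text \<open>Otherwise \<open>\<mm>\<close> would be generated by \<open>b\<close>, and every functional on \<open>\<mm>\<close> would be scalar.\<close>

lemma exact_pair_notin_W:
  assumes ab: "exact_pair a b" shows "a \<notin> W"
proof
  assume a: "a \<in> W"
  obtain \<phi> where \<phi>: "\<And>x y. x \<in> \<mm> \<Longrightarrow> y \<in> \<mm> \<Longrightarrow> \<phi> (x + y) = \<phi> x + \<phi> y"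
    "\<And>r x. x \<in> \<mm> \<Longrightarrow> \<phi> (r * x) = r * \<phi> x"
    "\<And>c. \<exists>x\<in>\<mm>. \<phi> x \<noteq> c * x" by (rule nonscalar_functionalE) (rule that)
  have b: "b \<in> \<mm>" by (rule exact_pair_in_m[OF ab])
  \<comment> \<open>\<open>\<phi> b\<close> is annihilated by \<open>a\<close> because
    \<open>b\<close> is, so it is a multiple of \<open>b\<close>; this supplies the candidate
    scalar.\<close>
  have "a * \<phi> b = \<phi> (0 * b)" using \<phi>(2)[OF b, of a] exact_pair_mult[OF ab] by simp
  also have "\<dots> = 0" using \<phi>(2)[OF b, of 0] by simp
  finally obtain c where c: "\<phi> b = b * c" by (rule exact_pairE[OF ab])
  have "\<phi> x = c * x" if "x \<in> \<mm>" for x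
  proof -
    have "a * x = 0" using m_mult_W[OF that a] by (simp add: mult.commute)
    then obtain t where "x = b * t" by (rule exact_pairE[OF ab])
    then show ?thesis using \<phi>(2)[OF b, of t] c by (simp add: ac_simps)
  qed
  then show False using \<phi>(3) by metis
qed

text \<open>This is the hard half of W = a \<open>\<mm>\<close>: \<open>b\<close> kills
  \<open>w\<close>, so \<open>a\<close> divides it, and a unit cofactor would put \<open>a\<close>
  into \<open>W\<close>.\<close>

lemma exact_pair_W_subset:
  assumes ab: "exact_pair a b" and w: "w \<in> W" obtains x where "x \<in> \<mm>" "w = a * x"
proof -
  obtain x where x: "w = a * x" using exact_pair_dvd_W[OF exact_pair_sym[OF ab] w] by (rule dvdE)
  then have "x \<in> \<mm>" using unit_mult_in_W[of x a] w exact_pair_notin_W[OF ab] by (metis mult.commute)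
  then show ?thesis using x by (intro that)
qed

text \<open>A socle element is a multiple \<open>b * t\<close>. If \<open>t\<close> were a unit,
  \<open>b\<close> itself would kill \<open>\<mm>\<close>, but then \<open>W\<close>, being b
  \<open>\<mm>\<close>, would vanish.\<close>

lemma socle_subset_W:
  assumes s: "\<And>x. x \<in> \<mm> \<Longrightarrow> x * s = 0" shows "s \<in> W"
proof -
  obtain a b :: 'a where ab: "exact_pair a b" using exact_pair_exists by metis
  then have "a * s = 0" using s exact_pair_in_m by metis
  then obtain t where t: "s = b * t" by (rule exact_pairE[OF ab])
  show ?thesis
  proof (cases "t \<in> \<mm>")
    case True
    then show ?thesis using t mult_in_W[of b t] exact_pair_in_m(2)[OF ab] by simp
  next
    case False
    then obtain u where u: "u * t = 1" by (rule unitE)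
    have "w = 0" if "w \<in> W" for w
    proof -
      obtain x where x: "x \<in> \<mm>" "w = b * x"
        by (rule exact_pair_W_subset[OF exact_pair_sym[OF ab] \<open>w \<in> W\<close>])
      have "w = u * (x * s)" using u x t by (simp add: ac_simps) (metis mult.assoc mult_1_right)
      then show ?thesis using s x by simp
    qed
    then have "W = {0}" using W_closed(1) by auto
    then show ?thesis using W_nonzero by metis
  qed
qed

text \<open>If \<open>W\<close> were generated by \<open>\<sigma> = a y\<close>, then \<open>\<mm>\<close> would be generated by \<open>b\<close> and \<open>y\<close>, and a
  functional on \<open>\<mm>\<close> could be made to vanish on \<open>b\<close> and then on \<open>y\<close> by subtracting scalars.\<close>

lemma W_not_principal:
  assumes \<sigma>: "\<sigma> \<in> W" shows "\<exists>w\<in>W. \<not> \<sigma> dvd w"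
proof (rule ccontr)
  assume "\<not> ?thesis"
  then have dv: "\<sigma> dvd w" if "w \<in> W" for w using that by metis
  obtain a b :: 'a where ab: "exact_pair a b" using exact_pair_exists by metis
  have a: "a \<in> \<mm>" and b: "b \<in> \<mm>" by (rule exact_pair_in_m[OF ab])+
  obtain y where y: "y \<in> \<mm>" "\<sigma> = a * y" by (rule exact_pair_W_subset[OF ab \<sigma>])
  obtain \<phi> where \<phi>: "\<And>x y. x \<in> \<mm> \<Longrightarrow> y \<in> \<mm> \<Longrightarrow> \<phi> (x + y) = \<phi> x + \<phi> y"
    "\<And>r x. x \<in> \<mm> \<Longrightarrow> \<phi> (r * x) = r * \<phi> x"
    "\<And>c. \<exists>x\<in>\<mm>. \<phi> x \<noteq> c * x" by (rule nonscalar_functionalE) (rule that)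
  have \<phi>0: "\<phi> 0 = 0" using \<phi>(2)[OF b, of 0] by simp
  have "a * \<phi> b = 0" using \<phi>(2)[OF b, of a] exact_pair_mult[OF ab] \<phi>0 by simp
  then obtain c where c: "\<phi> b = b * c" by (rule exact_pairE[OF ab])
  \<comment> \<open>On multiples of \<open>b\<close> the functional already is multiplication by
    \<open>c\<close>, and \<open>s * y\<close> is such a multiple because it lies in
    \<open>W\<close>. So the defect at \<open>y\<close> is in the socle and hence a multiple of
    \<open>\<sigma>\<close>.\<close>
  have "s * (\<phi> y - c * y) = 0" if s: "s \<in> \<mm>" for s
  proof -
    obtain t where t: "s * y = b * t"
      by (rule exact_pair_W_subset[OF exact_pair_sym[OF ab] mult_in_W[OF s y(1)]])
    have "s * \<phi> y = \<phi> (t * b)" using \<phi>(2)[OF y(1), of s] t by (simp add: mult.commute)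
    also have "\<dots> = c * (s * y)" using \<phi>(2)[OF b, of t] c t by (simp add: ac_simps)
    finally show ?thesis by (simp add: algebra_simps)
  qed
  then have "\<phi> y - c * y \<in> W" by (rule socle_subset_W)
  then have "a * y dvd \<phi> y - c * y" unfolding y(2)[symmetric] by (rule dv)
  then obtain u where u: "\<phi> y - c * y = a * y * u" by (rule dvdE)
  \<comment> \<open>Adding \<open>u * a\<close> to \<open>c\<close> repairs the value at
    \<open>y\<close> and leaves the one at \<open>b\<close> unchanged because
    \<open>a * b = 0\<close>.\<close>
  have "\<phi> x = (c + u * a) * x" if x: "x \<in> \<mm>" for x
  proof -
    have "a * y dvd a * x" unfolding y(2)[symmetric] by (rule dv[OF mult_in_W[OF a x]])
    then obtain t where "a * x = a * y * t" by (rule dvdE)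
    then have "a * (x - t * y) = 0" by (simp add: algebra_simps)
    then obtain s where s: "x - t * y = b * s" by (rule exact_pairE[OF ab])
    then have x': "x = t * y + s * b" by (simp add: algebra_simps)
    have ba: "b * (a * z) = 0" for z
    proof -
      have "b * (a * z) = (a * b) * z" by (simp add: ac_simps)
      then show ?thesis using exact_pair_mult[OF ab] by simp
    qed
    have "\<phi> x = t * \<phi> y + s * \<phi> b"
      unfolding x' \<phi>(1)[OF m_mult(1)[OF y(1)] m_mult(1)[OF b]] \<phi>(2)[OF y(1)] \<phi>(2)[OF b] ..
    moreover have "\<phi> y = c * y + a * y * u" using u by (simp add: algebra_simps)
    moreover have "b * (a * (s * u)) = 0" by (rule ba)
    then have "u * a * (s * b) = 0" by (simp add: ac_simps)
    ultimately show ?thesis unfolding x' c by (simp add: algebra_simps)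
  qed
  then show False using \<phi>(3) by metis
qed

section \<open>Comparing dimensions by ascending chains\<close>

lemma ideal_chain_stabilizes:
  assumes id: "\<And>k::nat. ideal (J k) (class_ring :: 'a ring)" and asc: "\<And>k. J k \<subseteq> J (Suc k)"
  obtains k where "J (Suc k) = J k"
proof -
  interpret noetherian_ring "class_ring :: 'a ring" by (rule noetherian)
  have mono: "i \<le> j \<Longrightarrow> J i \<subseteq> J j" for i j by (rule lift_Suc_mono_le[of J, OF asc])
  have "\<Union>(range J) \<in> range J"
  proof (rule ideal_chain_is_trivial)
    show "subset.chain {I. ideal I class_ring} (range J)"
    proof (rule subset_chain_def[THEN iffD2], intro conjI ballI)
      show "range J \<subseteq> {I. ideal I class_ring}" using id by auto
      fix A B assume "A \<in> range J" "B \<in> range J"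
      then obtain i j where "A = J i" "B = J j" by auto
      then show "A \<subseteq> B \<or> B \<subseteq> A" using mono nat_le_linear[of i j] by auto
    qed
  qed auto
  then obtain k where "\<Union>(range J) = J k" by auto
  then have "J (Suc k) \<subseteq> J k" by (metis UN_upper UNIV_I)
  then show ?thesis using that asc by (metis subset_antisym)
qed

text \<open>A surjective endomorphism of a Noetherian module is injective; here for a partially
  defined endomorphism of \<open>\<mm>/W\<close> with graph \<open>\<Gamma>\<close>.\<close>

lemma surjective_relation_injective:
  assumes sub: "\<Gamma> \<subseteq> \<mm> \<times> \<mm>" and \<Gamma>W: "W \<times> W \<subseteq> \<Gamma>"
    and add: "\<And>x v x' v'. (x, v) \<in> \<Gamma> \<Longrightarrow> (x', v') \<in> \<Gamma> \<Longrightarrow> (x + x', v + v') \<in> \<Gamma>"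
    and scale: "\<And>r x v. (x, v) \<in> \<Gamma> \<Longrightarrow> (r * x, r * v) \<in> \<Gamma>"
    and surj: "\<And>v. v \<in> \<mm> \<Longrightarrow> \<exists>x. (x, v) \<in> \<Gamma>"
    and fun_like: "\<And>x v. (x, v) \<in> \<Gamma> \<Longrightarrow> x \<in> W \<Longrightarrow> v \<in> W"
    and x: "(x, v) \<in> \<Gamma>" "v \<in> W"
  shows "x \<in> W"
proof -
  have diff: "(x - x', v - v') \<in> \<Gamma>" if "(x, v) \<in> \<Gamma>" "(x', v') \<in> \<Gamma>" for x v x' v'
    using add[OF that(1) scale[OF that(2), of "-1"]] by simp
  \<comment> \<open>\<open>J k\<close> is the set of elements that reach \<open>W\<close> in k
    steps, i.e. the kernel of the k-th iterate on \<open>\<mm>\<close>/W.\<close>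
  define J where "J = rec_nat W (\<lambda>_ I. {x. \<exists>v\<in>I. (x, v) \<in> \<Gamma>})"
  have J0: "J 0 = W" and JS: "J (Suc k) = {x. \<exists>v\<in>J k. (x, v) \<in> \<Gamma>}" for k
    by (simp_all add: J_def)
  have id: "ideal (J k) (class_ring :: 'a ring)" for k
  proof (induction k)
    case (Suc k)
    show ?case unfolding JS
    proof (rule ideal_class_ringI)
      have "(0, 0) \<in> \<Gamma>" using \<Gamma>W W_closed(1) by auto
      then show "0 \<in> {x. \<exists>v\<in>J k. (x, v) \<in> \<Gamma>}" using ideal_zero[OF Suc] by auto
    next
      fix x y assume "x \<in> {x. \<exists>v\<in>J k. (x, v) \<in> \<Gamma>}" "y \<in> {x. \<exists>v\<in>J k. (x, v) \<in> \<Gamma>}"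
      then obtain v v' where v: "v \<in> J k" "(x, v) \<in> \<Gamma>" "v' \<in> J k" "(y, v') \<in> \<Gamma>" by auto
      show "x + y \<in> {x. \<exists>v\<in>J k. (x, v) \<in> \<Gamma>}"
        unfolding mem_Collect_eq using add[OF v(2,4)] ideal_add[OF Suc v(1,3)] by (rule bexI)
    next
      fix r x assume "x \<in> {x. \<exists>v\<in>J k. (x, v) \<in> \<Gamma>}"
      then obtain v where v: "v \<in> J k" "(x, v) \<in> \<Gamma>" by auto
      show "r * x \<in> {x. \<exists>v\<in>J k. (x, v) \<in> \<Gamma>}"
        unfolding mem_Collect_eq using scale[OF v(2)] ideal_mult[OF Suc v(1)] by (rule bexI)
    qed
  qed (simp add: J0 ideal_W)
  have asc: "J k \<subseteq> J (Suc k)" for k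
  proof (induction k)
    case 0 show ?case using \<Gamma>W W_closed(1) unfolding JS J0 by auto
  next
    case (Suc k)
    show ?case
    proof
      fix z assume "z \<in> J (Suc k)"
      then obtain v where v: "v \<in> J k" "(z, v) \<in> \<Gamma>" unfolding JS[of k] by auto
      show "z \<in> J (Suc (Suc k))"
        unfolding JS[of "Suc k"] mem_Collect_eq using v(2) subsetD[OF Suc v(1)] by (rule bexI)
    qed
  qed
  obtain k where k: "J (Suc k) = J k" by (rule ideal_chain_stabilizes[of J, OF id asc])
  \<comment> \<open>\<open>path j y z\<close> says that \<open>z\<close> reaches \<open>y\<close> in
    j steps; the end point comes first.\<close>
  define path where "path j y z \<longleftrightarrow> (z, y) \<in> \<Gamma> ^^ j" for j y z
  have path0: "path 0 y z \<longleftrightarrow> y = z" for y z by (auto simp: path_def)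
  have "\<Gamma> ^^ Suc j = \<Gamma> O \<Gamma> ^^ j" for j by (simp only: relpow.simps(2) relpow_commute)
  then have pathS: "path (Suc j) y z \<longleftrightarrow> (\<exists>z'. path j y z' \<and> (z, z') \<in> \<Gamma>)" for j y z
    by (auto simp: path_def simp del: relpow.simps)
  have J_path: "z \<in> J j \<longleftrightarrow> (\<exists>y\<in>W. path j y z)" for j z
  proof (induction j arbitrary: z)
    case (Suc j)
    have "z \<in> J (Suc j) \<longleftrightarrow> (\<exists>v. (\<exists>y\<in>W. path j y v) \<and> (z, v) \<in> \<Gamma>)"
      unfolding JS mem_Collect_eq Bex_def Suc.IH ..
    then show ?case unfolding pathS by metis
  qed (simp add: J0 path0)
  have path_ex: "\<exists>z\<in>\<mm>. path j y z" if "y \<in> \<mm>" for j y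
  proof (induction j)
    case (Suc j)
    then obtain z where "z \<in> \<mm>" "path j y z" by (elim bexE)
    obtain x' where "(x', z) \<in> \<Gamma>" using surj[OF \<open>z \<in> \<mm>\<close>] by metis
    moreover have "x' \<in> \<mm>" using subsetD[OF sub \<open>(x', z) \<in> \<Gamma>\<close>] by simp
    ultimately show ?case unfolding pathS using \<open>path j y z\<close> by metis
  qed (use that in \<open>simp add: path0\<close>)
  have path_W: "path j y z \<Longrightarrow> z \<in> W \<Longrightarrow> y \<in> W" for j y z
  proof (induction j arbitrary: z)
    case (Suc j)
    then show ?case unfolding pathS using fun_like by metis
  qed (simp add: path0)
  have path_diff: "path j y z \<Longrightarrow> path j y' z' \<Longrightarrow> path j (y - y') (z - z')" for j y y' z z'
  proof (induction j arbitrary: z z')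
    case (Suc j)
    then obtain p p' where p: "path j y p" "(z, p) \<in> \<Gamma>" "path j y' p'" "(z', p') \<in> \<Gamma>"
      unfolding pathS by metis
    show ?case unfolding pathS using Suc.IH[OF p(1,3)] diff[OF p(2,4)] by metis
  qed (simp add: path0)
  \<comment> \<open>Choose \<open>z\<close> reaching \<open>x\<close> in k steps. One more step
    leads to \<open>v\<close> in \<open>W\<close>, so \<open>z\<close> lies in
    \<open>J (Suc k) = J k\<close>. Hence its k-th iterate is in \<open>W\<close>, and
    \<open>x\<close> agrees with it modulo \<open>W\<close>.\<close>
  have "x \<in> \<mm>" using subsetD[OF sub x(1)] by simp
  then obtain z where z: "path k x z" using path_ex by metis
  have "path (Suc k) v z" unfolding path_def by (rule relpow_Suc_I[OF z[unfolded path_def] x(1)])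
  then have "\<exists>y\<in>W. path (Suc k) y z" using x(2) by metis
  then have "z \<in> J (Suc k)" by (rule iffD2[OF J_path])
  then have "z \<in> J k" unfolding k .
  then obtain w where w: "w \<in> W" "path k w z" using J_path[of z k] by metis
  have "z - z \<in> W" using W_closed(1) by simp
  then have "x - w \<in> W" by (rule path_W[OF path_diff[OF z w(2)]])
  then show ?thesis using W_closed(2)[OF _ w(1)] by (metis diff_add_cancel)
qed

text \<open>As \<open>W = a \<mm> = a\<^sub>0 \<mm>\<close> for an exact pair \<open>(a\<^sub>0, b\<^sub>0)\<close>, the spaces \<open>\<mm>/W\<close> and \<open>W\<close> have dimensions
  differing by one. The dimension count is replaced by two applications of
  \<open>surjective_relation_injective\<close>: first to \<open>x \<mapsto> a\<inverse> (a\<^sub>0 x)\<close>, then to a lift of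
  \<open>x \<mapsto> a\<^sub>0\<inverse> (a x)\<close> whose component along \<open>b\<^sub>0\<close> is the component of \<open>x\<close> along \<open>y\<close>.\<close>

lemma annihilator_of_surjective_multiplication:
  assumes a: "a \<in> \<mm>" and aW: "\<And>w. w \<in> W \<Longrightarrow> \<exists>x\<in>\<mm>. w = a * x"
  obtains y where "y \<in> \<mm>" "y \<notin> W" "a * y = 0"
    "\<And>x. x \<in> \<mm> \<Longrightarrow> a * x = 0 \<Longrightarrow> \<exists>t. x - t * y \<in> W"
proof -
  obtain c d :: 'a where cd: "exact_pair c d" using exact_pair_exists by metis
  have c: "c \<in> \<mm>" and d: "d \<in> \<mm>" by (rule exact_pair_in_m[OF cd])+
  have dW: "d \<notin> W" by (rule exact_pair_notin_W[OF exact_pair_sym[OF cd]])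
  have cd0: "c * d = 0" by (rule exact_pair_mult[OF cd])
  have "\<exists>y\<in>\<mm>. y \<notin> W \<and> a * y = 0"
  proof (rule ccontr)
    assume no: "\<not> ?thesis"
    \<comment> \<open>If \<open>a\<close> is injective modulo \<open>W\<close>, this relation is a
      function modulo \<open>W\<close>, and it is onto since a \<open>\<mm>\<close> lies in c
      \<open>\<mm>\<close>. It must then be injective, although it sends \<open>d\<close> to
      0.\<close>
    define \<Gamma> where "\<Gamma> = {(x, v). x \<in> \<mm> \<and> v \<in> \<mm> \<and> c * x = a * v}"
    have mem: "(x, v) \<in> \<Gamma> \<longleftrightarrow> x \<in> \<mm> \<and> v \<in> \<mm> \<and> c * x = a * v" for x v
      by (simp add: \<Gamma>_def)
    have "d \<in> W"
    proof (rule surjective_relation_injective[of \<Gamma>])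
      show "\<Gamma> \<subseteq> \<mm> \<times> \<mm>" by (auto simp: \<Gamma>_def)
      show "W \<times> W \<subseteq> \<Gamma>" using W_subset m_mult_W[OF c] m_mult_W[OF a] by (auto simp: \<Gamma>_def)
      show "(x + x', v + v') \<in> \<Gamma>" if "(x, v) \<in> \<Gamma>" "(x', v') \<in> \<Gamma>" for x v x' v'
        using that m_closed(2) unfolding mem by (simp add: distrib_left)
      show "(r * x, r * v) \<in> \<Gamma>" if "(x, v) \<in> \<Gamma>" for r x v
        using that m_mult(1) unfolding mem by (metis mult.left_commute)
      show "\<exists>x. (x, v) \<in> \<Gamma>" if v: "v \<in> \<mm>" for v
      proof -
        obtain x where "x \<in> \<mm>" "a * v = c * x" by (rule exact_pair_W_subset[OF cd mult_in_W[OF a v]])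
        then have "(x, v) \<in> \<Gamma>" using v unfolding mem by simp
        then show ?thesis ..
      qed
      show "v \<in> W" if "(x, v) \<in> \<Gamma>" "x \<in> W" for x v
        using that no m_mult_W[OF c] unfolding mem by metis
      have "c * d = a * 0" using cd0 by simp
      then show "(d, 0) \<in> \<Gamma>" using d m_closed(1) unfolding mem by metis
      show "0 \<in> W" by (rule W_closed(1))
    qed
    with dW show False ..
  qed
  then obtain y where y: "y \<in> \<mm>" "y \<notin> W" "a * y = 0" by metis
  have mm: "x * u \<in> W" if "x \<in> \<mm>" "u \<in> \<mm>" for x u by (rule mult_in_W[OF that])
  \<comment> \<open>\<open>H\<close> and \<open>L\<close> are hyperplanes complementary to
    \<open>y\<close> and \<open>d\<close>; they define the \<open>y\<close>-component of
    \<open>x\<close> and the \<open>d\<close>-component of \<open>v\<close>, each unique modulo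
    \<open>\<mm>\<close>.\<close>
  obtain H where H: "ideal H (class_ring :: 'a ring)" "W \<subseteq> H" "y \<notin> H"
    "\<And>x. x \<in> \<mm> \<Longrightarrow> \<exists>t. x - t * y \<in> H"
    by (rule hyperplane_ideal[OF ideal_W ideal_m W_subset mm y(1,2)]) (assumption | rule that)+
  obtain L where L: "ideal L (class_ring :: 'a ring)" "W \<subseteq> L" "d \<notin> L"
    "\<And>x. x \<in> \<mm> \<Longrightarrow> \<exists>t. x - t * d \<in> L"
    by (rule hyperplane_ideal[OF ideal_W ideal_m W_subset mm d dW]) (assumption | rule that)+
  \<comment> \<open>The equation determines \<open>v\<close> only up to a multiple of
    \<open>d\<close>; the shared \<open>t\<close> removes this freedom modulo
    \<open>W\<close>.\<close>
  define \<Gamma> where "\<Gamma> = {(x, v). x \<in> \<mm> \<and> v \<in> \<mm> \<and> a * x = c * v \<and> (\<exists>t. x - t * y \<in> H \<and> v - t * d \<in> L)}"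
  have mem: "(x, v) \<in> \<Gamma> \<longleftrightarrow> x \<in> \<mm> \<and> v \<in> \<mm> \<and> a * x = c * v \<and> (\<exists>t. x - t * y \<in> H \<and> v - t * d \<in> L)" for x v
    by (simp add: \<Gamma>_def)
  have inj: "x \<in> W" if x: "(x, 0) \<in> \<Gamma>" for x
  proof (rule surjective_relation_injective[of \<Gamma>, OF _ _ _ _ _ _ x W_closed(1)])
    show "\<Gamma> \<subseteq> \<mm> \<times> \<mm>" by (auto simp: \<Gamma>_def)
    show "W \<times> W \<subseteq> \<Gamma>"
    proof
      fix p assume "p \<in> W \<times> W"
      then obtain x v where p: "p = (x, v)" "x \<in> W" "v \<in> W" by auto
      have "a * x = c * v" using m_mult_W[OF c p(3)] m_mult_W[OF a p(2)] by simp
      moreover have "x - 0 * y \<in> H" "v - 0 * d \<in> L" using p(2,3) H(2) L(2) by auto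
      ultimately show "p \<in> \<Gamma>" using p W_subset unfolding p(1) mem by blast
    qed
    show "(x + x', v + v') \<in> \<Gamma>" if "(x, v) \<in> \<Gamma>" "(x', v') \<in> \<Gamma>" for x v x' v'
    proof -
      from that obtain t t' where t: "x - t * y \<in> H" "v - t * d \<in> L" "x' - t' * y \<in> H" "v' - t' * d \<in> L"
        unfolding mem by metis
      have "(x + x') - (t + t') * y = (x - t * y) + (x' - t' * y)"
        "(v + v') - (t + t') * d = (v - t * d) + (v' - t' * d)" by (simp_all add: algebra_simps)
      then have "(x + x') - (t + t') * y \<in> H \<and> (v + v') - (t + t') * d \<in> L"
        using ideal_add[OF H(1) t(1,3)] ideal_add[OF L(1) t(2,4)] by (simp only:)
      moreover have "a * (x + x') = c * (v + v')" using that unfolding mem by (simp add: distrib_left)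
      moreover have "x + x' \<in> \<mm>" "v + v' \<in> \<mm>" using that m_closed(2) unfolding mem by metis+
      ultimately show ?thesis unfolding mem by metis
    qed
    show "(r * x, r * v) \<in> \<Gamma>" if "(x, v) \<in> \<Gamma>" for r x v
    proof -
      from that obtain t where t: "x - t * y \<in> H" "v - t * d \<in> L" unfolding mem by metis
      have "r * x - (r * t) * y = r * (x - t * y)" "r * v - (r * t) * d = r * (v - t * d)"
        by (simp_all add: algebra_simps)
      then have "r * x - (r * t) * y \<in> H \<and> r * v - (r * t) * d \<in> L"
        using ideal_mult[OF H(1) t(1), of r] ideal_mult[OF L(1) t(2), of r] by (simp only:)
      moreover have "a * (r * x) = c * (r * v)" using that unfolding mem by (metis mult.left_commute)
      moreover have "r * x \<in> \<mm>" "r * v \<in> \<mm>" using that m_mult(1) unfolding mem by metis+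
      ultimately show ?thesis unfolding mem by metis
    qed
    show "\<exists>x. (x, v) \<in> \<Gamma>" if v: "v \<in> \<mm>" for v
    proof -
      obtain x where x: "x \<in> \<mm>" "c * v = a * x" using aW[OF mult_in_W[OF c v]] by metis
      obtain s where s: "v - s * d \<in> L" using L(4)[OF v] by metis
      obtain t where t: "x - t * y \<in> H" using H(4)[OF x(1)] by metis
      \<comment> \<open>Changing \<open>x\<close> by a multiple of \<open>y\<close> moves its
        component from \<open>t\<close> to \<open>s\<close> without affecting
        \<open>a * x\<close>.\<close>
      let ?x = "x + (s - t) * y"
      have "?x - s * y \<in> H" using t by (simp add: algebra_simps)
      moreover have "a * ?x = a * x + (s - t) * (a * y)" by (simp add: algebra_simps)
      then have "a * ?x = c * v" using x(2) y(3) by simp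
      moreover have "?x \<in> \<mm>" by (rule m_closed(2)[OF x(1) m_mult(1)[OF y(1)]])
      ultimately have "(?x, v) \<in> \<Gamma>" using v s unfolding mem by metis
      then show ?thesis ..
    qed
    show "v \<in> W" if "(x, v) \<in> \<Gamma>" "x \<in> W" for x v
    proof -
      from that obtain t where t: "v \<in> \<mm>" "a * x = c * v" "x - t * y \<in> H" "v - t * d \<in> L" unfolding mem by metis
      have "t * y \<in> H" using ideal_diff[OF H(1) subsetD[OF H(2) that(2)] t(3)] by simp
      \<comment> \<open>For \<open>x\<close> in \<open>W\<close> the component \<open>t\<close> must
        lie in \<open>\<mm>\<close>, so \<open>v\<close> lies in \<open>L\<close>. A multiple of
        \<open>d\<close> inside \<open>L\<close> has its coefficient in
        \<open>\<mm>\<close>.\<close>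
      have "t \<in> \<mm>"
      proof (rule ccontr)
        assume "t \<notin> \<mm>"
        then obtain u where u: "u * t = 1" by (rule unitE)
        have "u * (t * y) \<in> H" by (rule ideal_mult[OF H(1) \<open>t * y \<in> H\<close>])
        then have "y \<in> H" using u by (simp add: mult.assoc[symmetric])
        with H(3) show False ..
      qed
      have "c * v = 0" using t(2) m_mult_W[OF a that(2)] by simp
      then obtain s where s: "v = d * s" by (rule exact_pairE[OF cd])
      have "t * d \<in> L" using mult_in_W[OF \<open>t \<in> \<mm>\<close> d] L(2) by (rule subsetD[rotated])
      then have "v \<in> L" using ideal_add[OF L(1) t(4)] by fastforce
      have "s \<in> \<mm>"
      proof (rule ccontr)
        assume "s \<notin> \<mm>"
        then obtain u where u: "u * s = 1" by (rule unitE)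
        have "u * v \<in> L" by (rule ideal_mult[OF L(1) \<open>v \<in> L\<close>])
        moreover have "u * v = (u * s) * d" unfolding s by (simp add: ac_simps)
        ultimately show False using L(3) u by simp
      qed
      then show "v \<in> W" unfolding s by (rule mult_in_W[OF d])
    qed
  qed
  \<comment> \<open>Once its \<open>y\<close>-component is removed, an element killed by
    \<open>a\<close> is related to 0, hence lies in \<open>W\<close>.\<close>
  have "\<exists>t. x - t * y \<in> W" if x: "x \<in> \<mm>" "a * x = 0" for x
  proof -
    obtain t where t: "x - t * y \<in> H" using H(4)[OF x(1)] by metis
    have "(x - t * y, 0) \<in> \<Gamma>" unfolding mem
    proof (intro conjI exI)
      show "x - t * y \<in> \<mm>" by (rule m_closed(3)[OF x(1) m_mult(1)[OF y(1)]])
      have "a * (x - t * y) = a * x - t * (a * y)" by (simp add: algebra_simps)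
      then show "a * (x - t * y) = c * 0" using x(2) y(3) by simp
      show "x - t * y - 0 * y \<in> H" using t by simp
      show "0 - 0 * d \<in> L" using ideal_zero[OF L(1)] by simp
    qed (rule m_closed(1))
    then show ?thesis using inj by metis
  qed
  then show ?thesis by (rule that[OF y])
qed

text \<open>The annihilator of one factor is spanned by a single \<open>z\<close> modulo
  \<open>W\<close>. The other factor belongs to it but not to \<open>W\<close>, so it is a unit
  multiple of \<open>z\<close> modulo \<open>W\<close>; as it also divides all of \<open>W\<close>,
  it generates the annihilator.\<close>

lemma exact_pairI:
  assumes a: "a \<in> \<mm>" and y: "y \<in> \<mm>" and ay: "a * y = 0"
    and aW: "\<And>w. w \<in> W \<Longrightarrow> \<exists>x\<in>\<mm>. w = a * x" and yW: "\<And>w. w \<in> W \<Longrightarrow> \<exists>x\<in>\<mm>. w = y * x"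
  shows "exact_pair a y"
proof -
  have key: "v dvd x"
    if u: "u \<in> \<mm>" and v: "v \<in> \<mm>" and uv: "u * v = 0" and uW: "\<And>w. w \<in> W \<Longrightarrow> \<exists>x\<in>\<mm>. w = u * x"
      and vW: "\<And>w. w \<in> W \<Longrightarrow> \<exists>x\<in>\<mm>. w = v * x" and x: "u * x = 0" for u v x
  proof -
    obtain z where z: "z \<in> \<mm>" "z \<notin> W" "u * z = 0"
      "\<And>x. x \<in> \<mm> \<Longrightarrow> u * x = 0 \<Longrightarrow> \<exists>t. x - t * z \<in> W"
      by (rule annihilator_of_surjective_multiplication[OF u uW]) (assumption | rule that)+
    have vdvd: "v dvd w" if "w \<in> W" for w using vW[OF that] by auto
    have nz: "\<not> (\<forall>w\<in>W. w = 0)" using W_nonzero W_closed(1) by auto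
    have vW': "v \<notin> W"
    proof
      assume v': "v \<in> W"
      have "w = 0" if w: "w \<in> W" for w
      proof -
        obtain p where "p \<in> \<mm>" "w = v * p" using vW[OF w] by metis
        then show ?thesis using m_mult_W[of p v] v' by (simp add: mult.commute)
      qed
      then show False using nz by metis
    qed
    obtain t where t: "v - t * z \<in> W" using z(4)[OF v uv] by metis
    have "t \<notin> \<mm>"
    proof
      assume "t \<in> \<mm>"
      then have "t * z \<in> W" by (rule mult_in_W[OF _ z(1)])
      then have "(v - t * z) + t * z \<in> W" by (rule W_closed(2)[OF t])
      then show False using vW' by simp
    qed
    then obtain s where s: "s * t = 1" by (rule unitE)
    have "z = s * v - s * (v - t * z)" using s by (simp add: algebra_simps mult.assoc[symmetric])
    moreover have "v dvd s * (v - t * z)" by (rule vdvd[OF W_mult(1)[OF t]])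
    ultimately have vz: "v dvd z" by (metis dvd_diff dvd_triv_right)
    have "x \<in> \<mm>"
    proof (rule ccontr)
      assume "x \<notin> \<mm>"
      then obtain r where "r * x = 1" by (rule unitE)
      then have "u = r * (u * x)" by (metis mult.left_commute mult_1_right)
      then have "u = 0" using x by simp
      then show False using uW nz by (metis mult_zero_left)
    qed
    then obtain r where r: "x - r * z \<in> W" using z(4) x by metis
    have "v dvd (x - r * z) + r * z" using vdvd[OF r] vz by (intro dvd_add dvd_mult)
    then show ?thesis by simp
  qed
  have ya: "y * a = 0" using ay by (simp add: mult.commute)
  have "a * x = 0 \<longleftrightarrow> y dvd x" for x
    using key[OF a y ay aW yW, of x] ay by (auto simp: mult.assoc[symmetric] elim!: dvdE)
  moreover have "y * x = 0 \<longleftrightarrow> a dvd x" for x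
    using key[OF y a ya yW aW, of x] ya by (auto simp: mult.assoc[symmetric] elim!: dvdE)
  ultimately show ?thesis using a y unfolding exact_pair_def m_iff by metis
qed

end

section \<open>Self-injectivity\<close>

lemma module_vec_module: "Module.module class_ring (module_vec TYPE('a::comm_ring_1) n)"
proof -
  interpret vec_module "TYPE('a)" n .
  show ?thesis by unfold_locales
qed

lemma mhomI:
  assumes "\<And>x. x \<in> carrier M \<Longrightarrow> f x \<in> carrier N"
    and "\<And>x y. x \<in> carrier M \<Longrightarrow> y \<in> carrier M \<Longrightarrow> f (x \<oplus>\<^bsub>M\<^esub> y) = f x \<oplus>\<^bsub>N\<^esub> f y"
    and "\<And>r x. x \<in> carrier M \<Longrightarrow> f (r \<odot>\<^bsub>M\<^esub> x) = r \<odot>\<^bsub>N\<^esub> f x"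
  shows "f \<in> mhom M N"
  unfolding LinearCombinations.module_hom_def using assms by simp

lemma mhomD:
  assumes "f \<in> mhom M N" "x \<in> carrier M"
  shows "f x \<in> carrier N" "y \<in> carrier M \<Longrightarrow> f (x \<oplus>\<^bsub>M\<^esub> y) = f x \<oplus>\<^bsub>N\<^esub> f y"
    "f (r \<odot>\<^bsub>M\<^esub> x) = r \<odot>\<^bsub>N\<^esub> f x"
  using assms unfolding LinearCombinations.module_hom_def by auto

lemma class_module_arith:
  assumes "Module.module (class_ring :: 'a::comm_ring_1 ring) B"
  shows "x \<in> carrier B \<Longrightarrow> r \<odot>\<^bsub>B\<^esub> x \<in> carrier B"
    "x \<in> carrier B \<Longrightarrow> (r + s) \<odot>\<^bsub>B\<^esub> x = r \<odot>\<^bsub>B\<^esub> x \<oplus>\<^bsub>B\<^esub> s \<odot>\<^bsub>B\<^esub> x"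
    "x \<in> carrier B \<Longrightarrow> y \<in> carrier B \<Longrightarrow> r \<odot>\<^bsub>B\<^esub> (x \<oplus>\<^bsub>B\<^esub> y) = r \<odot>\<^bsub>B\<^esub> x \<oplus>\<^bsub>B\<^esub> r \<odot>\<^bsub>B\<^esub> y"
    "x \<in> carrier B \<Longrightarrow> (r * s) \<odot>\<^bsub>B\<^esub> x = r \<odot>\<^bsub>B\<^esub> (s \<odot>\<^bsub>B\<^esub> x)"
    "x \<in> carrier B \<Longrightarrow> 1 \<odot>\<^bsub>B\<^esub> x = x"
    "x \<in> carrier B \<Longrightarrow> 0 \<odot>\<^bsub>B\<^esub> x = \<zero>\<^bsub>B\<^esub>"
    "x \<in> carrier B \<Longrightarrow> (- r) \<odot>\<^bsub>B\<^esub> x = \<ominus>\<^bsub>B\<^esub> (r \<odot>\<^bsub>B\<^esub> x)"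
    "r \<odot>\<^bsub>B\<^esub> \<zero>\<^bsub>B\<^esub> = \<zero>\<^bsub>B\<^esub>"
    "x \<in> carrier B \<Longrightarrow> y \<in> carrier B \<Longrightarrow> x \<oplus>\<^bsub>B\<^esub> y \<in> carrier B"
    "\<zero>\<^bsub>B\<^esub> \<in> carrier B"
proof -
  interpret B: Module.module "class_ring :: 'a ring" B by fact
  show "x \<in> carrier B \<Longrightarrow> r \<odot>\<^bsub>B\<^esub> x \<in> carrier B" using B.smult_closed[of r x] by simp
  show "x \<in> carrier B \<Longrightarrow> (r + s) \<odot>\<^bsub>B\<^esub> x = r \<odot>\<^bsub>B\<^esub> x \<oplus>\<^bsub>B\<^esub> s \<odot>\<^bsub>B\<^esub> x"
    using B.smult_l_distr[of r s x] by simp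
  show "x \<in> carrier B \<Longrightarrow> y \<in> carrier B \<Longrightarrow> r \<odot>\<^bsub>B\<^esub> (x \<oplus>\<^bsub>B\<^esub> y) = r \<odot>\<^bsub>B\<^esub> x \<oplus>\<^bsub>B\<^esub> r \<odot>\<^bsub>B\<^esub> y"
    using B.smult_r_distr[of r x y] by simp
  show "x \<in> carrier B \<Longrightarrow> (r * s) \<odot>\<^bsub>B\<^esub> x = r \<odot>\<^bsub>B\<^esub> (s \<odot>\<^bsub>B\<^esub> x)"
    using B.smult_assoc1[of r s x] by simp
  show one: "x \<in> carrier B \<Longrightarrow> 1 \<odot>\<^bsub>B\<^esub> x = x" using B.smult_one[of x] by simp
  show "x \<in> carrier B \<Longrightarrow> 0 \<odot>\<^bsub>B\<^esub> x = \<zero>\<^bsub>B\<^esub>" using B.smult_l_null[of x] by simp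
  show "x \<in> carrier B \<Longrightarrow> (- r) \<odot>\<^bsub>B\<^esub> x = \<ominus>\<^bsub>B\<^esub> (r \<odot>\<^bsub>B\<^esub> x)"
    using B.smult_l_minus[of r x] by (simp add: class_ring_simps(8))
  show "r \<odot>\<^bsub>B\<^esub> \<zero>\<^bsub>B\<^esub> = \<zero>\<^bsub>B\<^esub>" using B.smult_r_null[of r] by simp
  show "x \<in> carrier B \<Longrightarrow> y \<in> carrier B \<Longrightarrow> x \<oplus>\<^bsub>B\<^esub> y \<in> carrier B" by (rule B.a_closed)
  show "\<zero>\<^bsub>B\<^esub> \<in> carrier B" by (rule B.zero_closed)
qed

text \<open>A partial functional is represented by its graph, so that extension becomes inclusion
  and the union of a chain is again such a graph.\<close>

definition linear_graph :: "('a::comm_ring_1, 'm) module \<Rightarrow> ('m \<times> 'a) set \<Rightarrow> bool" where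
  "linear_graph B G \<longleftrightarrow> (\<forall>x s. (x, s) \<in> G \<longrightarrow> x \<in> carrier B) \<and>
     (\<forall>x s y t. (x, s) \<in> G \<longrightarrow> (y, t) \<in> G \<longrightarrow> (x \<oplus>\<^bsub>B\<^esub> y, s + t) \<in> G) \<and>
     (\<forall>r x s. (x, s) \<in> G \<longrightarrow> (r \<odot>\<^bsub>B\<^esub> x, r * s) \<in> G) \<and>
     (\<forall>x s t. (x, s) \<in> G \<longrightarrow> (x, t) \<in> G \<longrightarrow> s = t)"

lemma linear_graphD:
  assumes "linear_graph B G" "(x, s) \<in> G"
  shows "x \<in> carrier B" "(y, t) \<in> G \<Longrightarrow> (x \<oplus>\<^bsub>B\<^esub> y, s + t) \<in> G"
    "(r \<odot>\<^bsub>B\<^esub> x, r * s) \<in> G" "(x, t) \<in> G \<Longrightarrow> s = t"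
  using assms unfolding linear_graph_def by metis+

lemma linear_graphI:
  assumes "\<And>x s. (x, s) \<in> G \<Longrightarrow> x \<in> carrier B"
    and "\<And>x s y t. (x, s) \<in> G \<Longrightarrow> (y, t) \<in> G \<Longrightarrow> (x \<oplus>\<^bsub>B\<^esub> y, s + t) \<in> G"
    and "\<And>r x s. (x, s) \<in> G \<Longrightarrow> (r \<odot>\<^bsub>B\<^esub> x, r * s) \<in> G"
    and "\<And>x s t. (x, s) \<in> G \<Longrightarrow> (x, t) \<in> G \<Longrightarrow> s = t"
  shows "linear_graph B G"
  unfolding linear_graph_def
  by (intro conjI allI impI) (erule assms(1), erule (1) assms(2), erule assms(3), erule (1) assms(4))

lemma linear_graph_chain_Union:
  assumes chain: "subset.chain {G. linear_graph B G} C"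
  shows "linear_graph B (\<Union>C)"
proof (rule linear_graphI)
  have lin: "linear_graph B G" if "G \<in> C" for G using chain that by (auto simp: subset_chain_def)
  have common: "\<exists>G\<in>C. p \<in> G \<and> q \<in> G" if "p \<in> \<Union>C" "q \<in> \<Union>C" for p q
  proof -
    obtain G G' where G: "G \<in> C" "p \<in> G" "G' \<in> C" "q \<in> G'" using \<open>p \<in> \<Union>C\<close> \<open>q \<in> \<Union>C\<close> by auto
    have "G \<subseteq> G' \<or> G' \<subseteq> G" using chain G(1,3) by (simp add: subset_chain_def)
    then show ?thesis using G by auto
  qed
  show "x \<in> carrier B" if "(x, s) \<in> \<Union>C" for x s
    using common[OF that that] linear_graphD(1)[OF lin] by metis
  show "(x \<oplus>\<^bsub>B\<^esub> y, s + t) \<in> \<Union>C" if "(x, s) \<in> \<Union>C" "(y, t) \<in> \<Union>C" for x s y t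
    using common[OF that] linear_graphD(2)[OF lin] by (metis UnionI)
  show "(r \<odot>\<^bsub>B\<^esub> x, r * s) \<in> \<Union>C" if "(x, s) \<in> \<Union>C" for r x s
    using common[OF that that] linear_graphD(3)[OF lin] by (metis UnionI)
  show "s = t" if "(x, s) \<in> \<Union>C" "(x, t) \<in> \<Union>C" for x s t
    using common[OF that] linear_graphD(4)[OF lin] by metis
qed

context cube_zero_local_ring
begin

text \<open>The domain is enlarged by R x, with value \<open>c\<close> at \<open>x\<close>. This is
  consistent: a multiple r x already in the domain has r in \<open>\<mm>\<close>, as a unit r would
  put \<open>x\<close> there, and for such r the graph has the value r c by
  \<open>\<psi>\<close>.\<close>

lemma linear_graph_extend:
  assumes B: "Module.module (class_ring :: 'a ring) B" and G: "linear_graph B G"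
    and x: "x \<in> carrier B" "\<And>s. (x, s) \<notin> G"
    and \<psi>: "\<And>r. r \<in> \<mm> \<Longrightarrow> (r \<odot>\<^bsub>B\<^esub> x, r * c) \<in> G"
  shows "\<exists>G'. linear_graph B G' \<and> G \<subseteq> G' \<and> (x, c) \<in> G'"
proof -
  note ar = class_module_arith[OF B]
  interpret B: Module.module "class_ring :: 'a ring" B by fact
  define G' where "G' = {(y \<oplus>\<^bsub>B\<^esub> r \<odot>\<^bsub>B\<^esub> x, s + r * c) | y s r. (y, s) \<in> G}"
  have G'I: "(y \<oplus>\<^bsub>B\<^esub> r \<odot>\<^bsub>B\<^esub> x, s + r * c) \<in> G'" if "(y, s) \<in> G" for y s r
    unfolding G'_def using that by blast
  have G'E: "\<exists>y s r. p = y \<oplus>\<^bsub>B\<^esub> r \<odot>\<^bsub>B\<^esub> x \<and> q = s + r * c \<and> (y, s) \<in> G" if "(p, q) \<in> G'" for p q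
    using that unfolding G'_def by blast
  have zero: "(\<zero>\<^bsub>B\<^esub>, 0) \<in> G"
    using \<psi>[of 0] m_closed(1) ar(6)[OF x(1)] by simp
  have rx: "r \<odot>\<^bsub>B\<^esub> x \<in> carrier B" for r by (rule ar(1)[OF x(1)])
  have "linear_graph B G'"
  proof (rule linear_graphI)
    show "p \<in> carrier B" if "(p, q) \<in> G'" for p q
      using G'E[OF that] linear_graphD(1)[OF G] ar(9) rx by metis
  next
    fix p q p' q' assume "(p, q) \<in> G'" "(p', q') \<in> G'"
    then obtain y s r y' s' r' where
      e: "p = y \<oplus>\<^bsub>B\<^esub> r \<odot>\<^bsub>B\<^esub> x" "q = s + r * c" "p' = y' \<oplus>\<^bsub>B\<^esub> r' \<odot>\<^bsub>B\<^esub> x" "q' = s' + r' * c"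
      and y: "(y, s) \<in> G" "(y', s') \<in> G" using G'E by metis
    have yc: "y \<in> carrier B" "y' \<in> carrier B" using linear_graphD(1)[OF G] y by metis+
    have "p \<oplus>\<^bsub>B\<^esub> p' = (y \<oplus>\<^bsub>B\<^esub> y') \<oplus>\<^bsub>B\<^esub> (r + r') \<odot>\<^bsub>B\<^esub> x"
      unfolding e ar(2)[OF x(1)] using yc rx[of r] rx[of r'] by (simp add: B.a_ac)
    moreover have "q + q' = (s + s') + (r + r') * c" unfolding e by (simp add: algebra_simps)
    ultimately show "(p \<oplus>\<^bsub>B\<^esub> p', q + q') \<in> G'" using G'I[OF linear_graphD(2)[OF G y]] by (simp only:)
  next
    fix t p q assume "(p, q) \<in> G'"
    then obtain y s r where e: "p = y \<oplus>\<^bsub>B\<^esub> r \<odot>\<^bsub>B\<^esub> x" "q = s + r * c" and y: "(y, s) \<in> G"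
      using G'E by metis
    have yc: "y \<in> carrier B" using linear_graphD(1)[OF G y] .
    have "t \<odot>\<^bsub>B\<^esub> p = t \<odot>\<^bsub>B\<^esub> y \<oplus>\<^bsub>B\<^esub> (t * r) \<odot>\<^bsub>B\<^esub> x"
      unfolding e ar(4)[OF x(1)] by (rule ar(3)[OF yc rx])
    moreover have "t * q = t * s + (t * r) * c" unfolding e by (simp add: algebra_simps)
    ultimately show "(t \<odot>\<^bsub>B\<^esub> p, t * q) \<in> G'" using G'I[OF linear_graphD(3)[OF G y]] by (simp only:)
  next
    fix p q q' assume "(p, q) \<in> G'" "(p, q') \<in> G'"
    then obtain y s r y' s' r' where
      e: "p = y \<oplus>\<^bsub>B\<^esub> r \<odot>\<^bsub>B\<^esub> x" "q = s + r * c" "p = y' \<oplus>\<^bsub>B\<^esub> r' \<odot>\<^bsub>B\<^esub> x" "q' = s' + r' * c"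
      and y: "(y, s) \<in> G" "(y', s') \<in> G" using G'E by metis
    have yc: "y \<in> carrier B" "y' \<in> carrier B" using linear_graphD(1)[OF G] y by metis+
    \<comment> \<open>Two representations of one point differ by \<open>z\<close>, a multiple of
      \<open>x\<close> that lies in the old domain.\<close>
    define z where "z = (r - r') \<odot>\<^bsub>B\<^esub> x"
    have zc: "z \<in> carrier B" unfolding z_def by (rule rx)
    have "r \<odot>\<^bsub>B\<^esub> x = z \<oplus>\<^bsub>B\<^esub> r' \<odot>\<^bsub>B\<^esub> x" unfolding z_def ar(2)[OF x(1), symmetric] by simp
    then have "(y \<oplus>\<^bsub>B\<^esub> z) \<oplus>\<^bsub>B\<^esub> r' \<odot>\<^bsub>B\<^esub> x = y' \<oplus>\<^bsub>B\<^esub> r' \<odot>\<^bsub>B\<^esub> x"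
      using e(1,3) yc zc rx[of r'] by (simp add: B.a_assoc)
    then have "y \<oplus>\<^bsub>B\<^esub> z = y'" using yc zc rx[of r'] by (metis B.M.add.r_cancel ar(9))
    then have "z = y' \<oplus>\<^bsub>B\<^esub> (- 1) \<odot>\<^bsub>B\<^esub> y"
      unfolding ar(7)[OF yc(1)] ar(5)[OF yc(1)] using yc zc
      by (metis B.M.add.m_comm B.M.add.inv_closed B.M.add.inv_solve_right)
    then have z: "(z, s' - s) \<in> G"
      using linear_graphD(2)[OF G y(2) linear_graphD(3)[OF G y(1), of "- 1"]] by simp
    have "r - r' \<in> \<mm>"
    proof (rule ccontr)
      assume "r - r' \<notin> \<mm>"
      then obtain u where u: "u * (r - r') = 1" by (rule unitE)
      have "u \<odot>\<^bsub>B\<^esub> z = x" unfolding z_def ar(4)[OF x(1), symmetric] u by (rule ar(5)[OF x(1)])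
      then show False using linear_graphD(3)[OF G z, of u] x(2) by metis
    qed
    then have "(z, (r - r') * c) \<in> G" unfolding z_def by (rule \<psi>)
    then have "s' - s = (r - r') * c" using linear_graphD(4)[OF G z] by metis
    then show "q = q'" unfolding e by (simp add: algebra_simps)
  qed
  moreover have "G \<subseteq> G'"
  proof
    fix p assume p: "p \<in> G"
    obtain y s where ys: "p = (y, s)" by (cases p)
    have yc: "y \<in> carrier B" using linear_graphD(1)[OF G] p ys by metis
    have "(y \<oplus>\<^bsub>B\<^esub> 0 \<odot>\<^bsub>B\<^esub> x, s + 0 * c) \<in> G'" using G'I p ys by metis
    then show "p \<in> G'" unfolding ys ar(6)[OF x(1)] using yc by simp
  qed
  moreover have "(\<zero>\<^bsub>B\<^esub> \<oplus>\<^bsub>B\<^esub> 1 \<odot>\<^bsub>B\<^esub> x, 0 + 1 * c) \<in> G'" by (rule G'I[OF zero])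
  then have "(x, c) \<in> G'" unfolding ar(5)[OF x(1)] using x(1) by simp
  ultimately show ?thesis by metis
qed

text \<open>A maximal linear graph is total: if \<open>x\<close> is not in its domain, then some multiple of \<open>x\<close>
  by an element of \<open>R\<close>, \<open>\<mm>\<close> or \<open>\<mm>\<^sup>2\<close> is not in its domain either but is mapped into it by \<open>\<mm>\<close>.\<close>

lemma maximal_linear_graph_total:
  assumes scalar: functionals_scalar
    and B: "Module.module (class_ring :: 'a ring) B" and G: "linear_graph B G" and zero: "(\<zero>\<^bsub>B\<^esub>, 0) \<in> G"
    and max: "\<forall>G'. linear_graph B G' \<longrightarrow> G \<subseteq> G' \<longrightarrow> G' = G"
    and x: "x \<in> carrier B"
  shows "\<exists>s. (x, s) \<in> G"
proof (rule ccontr)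
  note ar = class_module_arith[OF B]
  assume "\<not> ?thesis"
  then have xG: "\<not> (\<exists>s. (x, s) \<in> G)" .
  have "\<exists>z\<in>carrier B. \<not> (\<exists>s. (z, s) \<in> G) \<and> (\<forall>r\<in>\<mm>. \<exists>s. (r \<odot>\<^bsub>B\<^esub> z, s) \<in> G)"
  proof (rule ccontr)
    assume "\<not> ?thesis"
    then have step: "\<exists>r\<in>\<mm>. \<not> (\<exists>s. (r \<odot>\<^bsub>B\<^esub> z, s) \<in> G)"
      if "z \<in> carrier B" "\<not> (\<exists>s. (z, s) \<in> G)" for z using that by metis
    obtain r where r: "r \<in> \<mm>" "\<not> (\<exists>s. (r \<odot>\<^bsub>B\<^esub> x, s) \<in> G)" using step[OF x xG] by metis
    have rx: "r \<odot>\<^bsub>B\<^esub> x \<in> carrier B" by (rule ar(1)[OF x])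
    obtain q where q: "q \<in> \<mm>" "\<not> (\<exists>s. (q \<odot>\<^bsub>B\<^esub> (r \<odot>\<^bsub>B\<^esub> x), s) \<in> G)" using step[OF rx r(2)] by metis
    obtain p where p: "p \<in> \<mm>" "\<not> (\<exists>s. (p \<odot>\<^bsub>B\<^esub> (q \<odot>\<^bsub>B\<^esub> (r \<odot>\<^bsub>B\<^esub> x)), s) \<in> G)"
      using step[OF ar(1)[OF rx] q(2)] by metis
    have "p * (q * r) = 0" by (rule m_mult_W[OF p(1) mult_in_W[OF q(1) r(1)]])
    then have "p \<odot>\<^bsub>B\<^esub> (q \<odot>\<^bsub>B\<^esub> (r \<odot>\<^bsub>B\<^esub> x)) = \<zero>\<^bsub>B\<^esub>" using ar(4,6) x rx by metis
    then show False using p(2) zero by metis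
  qed
  then obtain z where z: "z \<in> carrier B" "\<not> (\<exists>s. (z, s) \<in> G)" "\<And>r. r \<in> \<mm> \<Longrightarrow> \<exists>s. (r \<odot>\<^bsub>B\<^esub> z, s) \<in> G"
    by metis
  \<comment> \<open>The values at the multiples of \<open>z\<close> by elements of
    \<open>\<mm>\<close> form a functional of the multiplier; its scalar \<open>c\<close> is the
    value to assign to \<open>z\<close>.\<close>
  define \<psi> where "\<psi> r = (SOME s. (r \<odot>\<^bsub>B\<^esub> z, s) \<in> G)" for r
  have \<psi>: "(r \<odot>\<^bsub>B\<^esub> z, \<psi> r) \<in> G" if "r \<in> \<mm>" for r
    unfolding \<psi>_def by (rule someI_ex[OF z(3)[OF that]])
  have "\<exists>c. \<forall>r\<in>\<mm>. \<psi> r = c * r"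
  proof (rule scalar[unfolded functionals_scalar_def, rule_format])
    show "\<psi> (r + s) = \<psi> r + \<psi> s" if r: "r \<in> \<mm>" and s: "s \<in> \<mm>" for r s
    proof -
      have "((r + s) \<odot>\<^bsub>B\<^esub> z, \<psi> r + \<psi> s) \<in> G"
        unfolding ar(2)[OF z(1)] by (rule linear_graphD(2)[OF G \<psi>[OF r] \<psi>[OF s]])
      then show "\<psi> (r + s) = \<psi> r + \<psi> s" by (rule linear_graphD(4)[OF G \<psi>[OF m_closed(2)[OF r s]]])
    qed
    show "\<psi> (r * s) = r * \<psi> s" if s: "s \<in> \<mm>" for r s
    proof -
      have "((r * s) \<odot>\<^bsub>B\<^esub> z, r * \<psi> s) \<in> G"
        unfolding ar(4)[OF z(1)] by (rule linear_graphD(3)[OF G \<psi>[OF s]])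
      then show "\<psi> (r * s) = r * \<psi> s" by (rule linear_graphD(4)[OF G \<psi>[OF m_mult(1)[OF s]]])
    qed
  qed
  then obtain c where c: "\<And>r. r \<in> \<mm> \<Longrightarrow> \<psi> r = c * r" by metis
  have "(r \<odot>\<^bsub>B\<^esub> z, r * c) \<in> G" if "r \<in> \<mm>" for r
    using \<psi>[OF that] c[OF that] by (simp add: mult.commute)
  moreover have "\<And>s. (z, s) \<notin> G" using z(2) by metis
  ultimately obtain G' where "linear_graph B G'" "G \<subseteq> G'" "(z, c) \<in> G'"
    using linear_graph_extend[OF B G z(1)] by metis
  then show False using max z(2) by metis
qed

text \<open>The extension is read off from a maximal linear graph containing that of
  \<open>f\<close>. As the target is \<open>R\<^sup>1\<close>, graphs record coordinate 0.\<close>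

lemma injective_module_base_ring:
  assumes scalar: functionals_scalar
  shows "injective_module (module_vec TYPE('a) 1)"
  unfolding injective_module_def
proof (intro conjI allI impI)
  show "Module.module (class_ring :: 'a ring) (module_vec TYPE('a) 1)" by (rule module_vec_module)
  fix B :: "('a, 'a vec) module" and A f
  assume "LinearCombinations.submodule class_ring A B \<and> f \<in> mhom (B\<lparr>carrier := A\<rparr>) (module_vec TYPE('a) 1)"
  then have A: "LinearCombinations.submodule class_ring A B"
    and f: "f \<in> mhom (B\<lparr>carrier := A\<rparr>) (module_vec TYPE('a) 1)" by auto
  have B: "Module.module (class_ring :: 'a ring) B" by (rule LinearCombinations.submodule.module[OF A])
  note ar = class_module_arith[OF B]
  have fA: "f x \<in> carrier_vec 1" if "x \<in> A" for x
    using mhomD(1)[OF f, of x] that by (simp add: module_vec_simps)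
  have fadd: "f (x \<oplus>\<^bsub>B\<^esub> y) = f x + f y" if "x \<in> A" "y \<in> A" for x y
    using mhomD(2)[OF f, of x y] that by (simp add: module_vec_simps)
  have fsmult: "f (r \<odot>\<^bsub>B\<^esub> x) = r \<cdot>\<^sub>v f x" if "x \<in> A" for r x
    using mhomD(3)[OF f, of x r] that by (simp add: module_vec_simps)
  have Ac: "x \<in> carrier B" if "x \<in> A" for x using LinearCombinations.submodule.subset[OF A] that by auto
  have Aadd: "x \<oplus>\<^bsub>B\<^esub> y \<in> A" if "x \<in> A" "y \<in> A" for x y
    by (rule LinearCombinations.submodule.m_closed[OF A that])
  have Asmult: "r \<odot>\<^bsub>B\<^esub> x \<in> A" if "x \<in> A" for r x
    using LinearCombinations.submodule.smult_closed[OF A _ that, of r] by simp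
  have A0: "\<zero>\<^bsub>B\<^esub> \<in> A" by (rule LinearCombinations.submodule.zero_closed[OF A])
  define G0 where "G0 = {(x, f x $ 0) | x. x \<in> A}"
  have G0: "(x, s) \<in> G0 \<longleftrightarrow> x \<in> A \<and> s = f x $ 0" for x s unfolding G0_def by blast
  have "linear_graph B G0"
  proof (rule linear_graphI)
    show "x \<in> carrier B" if "(x, s) \<in> G0" for x s using that Ac G0 by metis
    show "(x \<oplus>\<^bsub>B\<^esub> y, s + t) \<in> G0" if "(x, s) \<in> G0" "(y, t) \<in> G0" for x s y t
    proof -
      have xy: "x \<in> A" "y \<in> A" "s = f x $ 0" "t = f y $ 0" using that G0 by metis+
      have "f (x \<oplus>\<^bsub>B\<^esub> y) $ 0 = s + t" unfolding fadd[OF xy(1,2)] xy(3,4) using fA[OF xy(1)] fA[OF xy(2)] by simp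
      then show ?thesis using Aadd[OF xy(1,2)] G0 by metis
    qed
    show "(r \<odot>\<^bsub>B\<^esub> x, r * s) \<in> G0" if "(x, s) \<in> G0" for r x s
    proof -
      have x: "x \<in> A" "s = f x $ 0" using that G0 by metis+
      have "f (r \<odot>\<^bsub>B\<^esub> x) $ 0 = r * s" unfolding fsmult[OF x(1)] x(2) using fA[OF x(1)] by simp
      then show ?thesis using Asmult[OF x(1)] G0 by metis
    qed
    show "s = t" if "(x, s) \<in> G0" "(x, t) \<in> G0" for x s t using that G0 by metis
  qed
  moreover have "linear_graph B (\<Union>C)" if "subset.chain {G. linear_graph B G \<and> G0 \<subseteq> G} C" for C
    by (rule linear_graph_chain_Union) (use that in \<open>auto simp: subset_chain_def\<close>)
  ultimately have "\<exists>G. linear_graph B G \<and> G0 \<subseteq> G \<and> (\<forall>G'. linear_graph B G' \<longrightarrow> G \<subseteq> G' \<longrightarrow> G' = G)"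
    using exists_maximal_subset[of "linear_graph B" G0] by metis
  then obtain G where G: "linear_graph B G" "G0 \<subseteq> G"
    "\<forall>G'. linear_graph B G' \<longrightarrow> G \<subseteq> G' \<longrightarrow> G' = G"
    by (elim exE conjE)
  have "f \<zero>\<^bsub>B\<^esub> $ 0 = 0"
  proof -
    have "f (0 \<odot>\<^bsub>B\<^esub> \<zero>\<^bsub>B\<^esub>) $ 0 = 0" unfolding fsmult[OF A0] using fA[OF A0] by simp
    then show ?thesis unfolding ar(8) .
  qed
  then have zero: "(\<zero>\<^bsub>B\<^esub>, 0) \<in> G" using A0 G0 G(2) by (metis subsetD)
  have total: "\<exists>s. (x, s) \<in> G" if "x \<in> carrier B" for x
    by (rule maximal_linear_graph_total[OF scalar B G(1) zero G(3) that])
  define h where "h x = (SOME s. (x, s) \<in> G)" for x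
  have h: "(x, h x) \<in> G" if "x \<in> carrier B" for x
    unfolding h_def by (rule someI_ex[OF total[OF that]])
  define g where "g x = vec 1 (\<lambda>_. h x)" for x
  have "g \<in> mhom B (module_vec TYPE('a) 1)"
  proof (rule mhomI)
    show "g x \<in> carrier (module_vec TYPE('a) 1)" for x by (simp add: g_def module_vec_simps)
    fix x assume x: "x \<in> carrier B"
    show "g (x \<oplus>\<^bsub>B\<^esub> y) = g x \<oplus>\<^bsub>module_vec TYPE('a) 1\<^esub> g y" if y: "y \<in> carrier B" for y
    proof -
      have "h (x \<oplus>\<^bsub>B\<^esub> y) = h x + h y"
        by (rule linear_graphD(4)[OF G(1) h[OF ar(9)[OF x y]] linear_graphD(2)[OF G(1) h[OF x] h[OF y]]])
      then show ?thesis by (auto simp: g_def module_vec_simps)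
    qed
    show "g (r \<odot>\<^bsub>B\<^esub> x) = r \<odot>\<^bsub>module_vec TYPE('a) 1\<^esub> g x" for r
    proof -
      have "h (r \<odot>\<^bsub>B\<^esub> x) = r * h x"
        by (rule linear_graphD(4)[OF G(1) h[OF ar(1)[OF x]] linear_graphD(3)[OF G(1) h[OF x]]])
      then show ?thesis by (auto simp: g_def module_vec_simps)
    qed
  qed
  moreover have "\<forall>x\<in>A. g x = f x"
  proof
    fix x assume x: "x \<in> A"
    have "(x, f x $ 0) \<in> G" using G(2) G0 x by (metis subsetD)
    then have "h x = f x $ 0" by (rule linear_graphD(4)[OF G(1) h[OF Ac[OF x]]])
    then show "g x = f x" using fA[OF x] by (auto simp: g_def)
  qed
  ultimately show "\<exists>g\<in>mhom B (module_vec TYPE('a) 1). \<forall>x\<in>A. g x = f x" by metis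
qed

text \<open>R is its own injective resolution: \<open>R\<^sup>1\<close> in degree 0 and the zero
  module \<open>R\<^sup>0\<close> afterwards, hence the bound 0.\<close>

lemma gorensteinI:
  assumes scalar: functionals_scalar
  shows "gorenstein TYPE('a)"
proof -
  define I :: "nat \<Rightarrow> ('a, 'a vec) module" where
    "I i = (if i = 0 then module_vec TYPE('a) 1 else module_vec TYPE('a) 0)" for i
  define e :: "'a \<Rightarrow> 'a vec" where "e x = vec 1 (\<lambda>_. x)" for x
  define d :: "nat \<Rightarrow> 'a vec \<Rightarrow> 'a vec" where "d i x = 0\<^sub>v 0" for i x
  have I0: "I 0 = module_vec TYPE('a) 1" and IS: "I (Suc i) = module_vec TYPE('a) 0" for i
    by (simp_all add: I_def)
  have vec0: "x = 0\<^sub>v 0" if "x \<in> carrier_vec 0" for x :: "'a vec" using that by auto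
  have "injective_module (module_vec TYPE('a) 0)"
    unfolding injective_module_def
  proof (intro conjI allI impI)
    show "Module.module (class_ring :: 'a ring) (module_vec TYPE('a) 0)" by (rule module_vec_module)
    fix B :: "('a, 'a vec) module" and A f
    assume "LinearCombinations.submodule class_ring A B \<and> f \<in> mhom (B\<lparr>carrier := A\<rparr>) (module_vec TYPE('a) 0)"
    then have f: "f \<in> mhom (B\<lparr>carrier := A\<rparr>) (module_vec TYPE('a) 0)" by (rule conjunct2)
    have "0\<^sub>v 0 = f x" if "x \<in> A" for x
    proof -
      have "f x \<in> carrier_vec 0" using mhomD(1)[OF f, of x] that by (simp add: module_vec_simps)
      then show ?thesis by (rule vec0[symmetric])
    qed
    then have "\<forall>x\<in>A. 0\<^sub>v 0 = f x" by (rule ballI)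
    moreover have "(\<lambda>_. 0\<^sub>v 0) \<in> mhom B (module_vec TYPE('a) 0)"
      by (rule mhomI) (simp_all add: module_vec_simps vec_eq_iff)
    ultimately show "\<exists>g\<in>mhom B (module_vec TYPE('a) 0). \<forall>x\<in>A. g x = f x"
      by (rule bexI[where x = "\<lambda>_. 0\<^sub>v 0"])
  qed
  then have "injective_module (I i)" for i
    using injective_module_base_ring[OF scalar] by (cases i) (simp_all only: I0 IS)
  then have "\<forall>i. injective_module (I i)" by (rule allI)
  moreover have "e \<in> mhom ring_module (I 0)"
    unfolding I0
  proof (rule mhomI)
    show "e (x \<oplus>\<^bsub>ring_module\<^esub> y) = e x \<oplus>\<^bsub>module_vec TYPE('a) 1\<^esub> e y" for x y
      by (rule eq_vecI) (simp_all add: e_def ring_module_def module_vec_simps)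
    show "e (r \<odot>\<^bsub>ring_module\<^esub> x) = r \<odot>\<^bsub>module_vec TYPE('a) 1\<^esub> e x" for r x
      by (rule eq_vecI) (simp_all add: e_def ring_module_def module_vec_simps)
  qed (simp add: e_def module_vec_simps)
  moreover have "inj_on e (carrier ring_module)"
  proof (rule inj_onI)
    fix x y assume "e x = e y"
    then have "e x $ 0 = e y $ 0" by simp
    then show "x = y" by (simp add: e_def)
  qed
  moreover have "\<forall>i. d i \<in> mhom (I i) (I (Suc i))"
  proof
    fix i show "d i \<in> mhom (I i) (I (Suc i))"
      unfolding IS d_def by (rule mhomI) (simp_all add: module_vec_simps vec_eq_iff)
  qed
  moreover have "hom_kernel (I 0) (I (Suc 0)) (d 0) = e ` carrier ring_module"
  proof -
    have "carrier_vec 1 = range e"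
    proof (intro equalityI subsetI)
      fix x :: "'a vec" assume "x \<in> carrier_vec 1"
      then have "x = e (x $ 0)" unfolding e_def by (intro eq_vecI) simp_all
      then show "x \<in> range e" by (rule image_eqI[of x e "x $ 0" UNIV]) simp
    next
      fix x assume "x \<in> range e"
      then obtain y where "x = e y" by (elim rangeE)
      then show "x \<in> carrier_vec 1" by (simp add: e_def)
    qed
    then show ?thesis by (simp add: hom_kernel_def I0 d_def module_vec_simps ring_module_def IS)
  qed
  moreover have "\<forall>i. hom_kernel (I (Suc i)) (I (Suc (Suc i))) (d (Suc i)) = d i ` carrier (I i)"
  proof
    fix i
    have "\<exists>x. x \<in> carrier (I i)"
      by (cases i) (auto simp: I0 IS module_vec_simps intro: zero_carrier_vec)
    then have "d i ` carrier (I i) = {0\<^sub>v 0}" unfolding d_def by auto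
    moreover have "hom_kernel (I (Suc i)) (I (Suc (Suc i))) (d (Suc i)) = {0\<^sub>v 0}"
      unfolding hom_kernel_def IS d_def by (auto simp: module_vec_simps)
    ultimately show "hom_kernel (I (Suc i)) (I (Suc (Suc i))) (d (Suc i)) = d i ` carrier (I i)" by simp
  qed
  ultimately have "injective_resolution ring_module I e d" unfolding injective_resolution_def by (simp only: One_nat_def) simp
  moreover have "\<forall>i>0. carrier (I i) = {\<zero>\<^bsub>I i\<^esub>}"
    by (auto simp: I_def module_vec_simps)
  ultimately show ?thesis unfolding gorenstein_def by (intro exI conjI)
qed

end

section \<open>Functionals on submodules of finite free modules\<close>

definition vec_submodule :: "nat \<Rightarrow> 'a::comm_ring_1 vec set \<Rightarrow> bool" where
  "vec_submodule n Z \<longleftrightarrow> Z \<subseteq> carrier_vec n \<and> 0\<^sub>v n \<in> Z \<and>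
     (\<forall>x\<in>Z. \<forall>y\<in>Z. x + y \<in> Z) \<and> (\<forall>r. \<forall>x\<in>Z. r \<cdot>\<^sub>v x \<in> Z)"

lemma vec_submoduleI:
  assumes "\<And>x. x \<in> Z \<Longrightarrow> x \<in> carrier_vec n" "0\<^sub>v n \<in> Z" "\<And>x y. x \<in> Z \<Longrightarrow> y \<in> Z \<Longrightarrow> x + y \<in> Z"
    "\<And>r x. x \<in> Z \<Longrightarrow> r \<cdot>\<^sub>v x \<in> Z"
  shows "vec_submodule n Z"
  unfolding vec_submodule_def using assms by auto

lemma vec_submoduleD:
  assumes "vec_submodule n Z"
  shows "x \<in> Z \<Longrightarrow> x \<in> carrier_vec n" "0\<^sub>v n \<in> Z" "x \<in> Z \<Longrightarrow> y \<in> Z \<Longrightarrow> x + y \<in> Z"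
    "x \<in> Z \<Longrightarrow> r \<cdot>\<^sub>v x \<in> Z"
  using assms unfolding vec_submodule_def by auto

lemma vec_submodule_diff:
  assumes Z: "vec_submodule n Z" and x: "x \<in> Z" and y: "y \<in> Z"
  shows "x - y \<in> Z"
proof -
  have "x + (- 1) \<cdot>\<^sub>v y \<in> Z" by (rule vec_submoduleD(3)[OF Z x vec_submoduleD(4)[OF Z y]])
  moreover have "x + (- 1) \<cdot>\<^sub>v y = x - y"
    using vec_submoduleD(1)[OF Z x] vec_submoduleD(1)[OF Z y] by (intro eq_vecI) auto
  ultimately show ?thesis by simp
qed

lemma vec_add_diff_add:
  fixes a b c d :: "'a::comm_ring_1 vec"
  assumes "a \<in> carrier_vec n" "b \<in> carrier_vec n" "c \<in> carrier_vec n" "d \<in> carrier_vec n"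
  shows "a + b - (c + d) = (a - c) + (b - d)"
  using assms by (intro eq_vecI) auto

lemma vec_smult_diff:
  fixes a b :: "'a::comm_ring_1 vec"
  assumes "a \<in> carrier_vec n" "b \<in> carrier_vec n"
  shows "r \<cdot>\<^sub>v a - r \<cdot>\<^sub>v b = r \<cdot>\<^sub>v (a - b)"
  using assms by (intro eq_vecI) (auto simp: algebra_simps)

lemma vec_add_diff_cancel:
  fixes a b :: "'a::comm_ring_1 vec"
  assumes "a \<in> carrier_vec n" "b \<in> carrier_vec n"
  shows "a + (b - a) = b"
  using assms by (intro eq_vecI) auto

definition linear_on :: "'a::comm_ring_1 vec set \<Rightarrow> ('a vec \<Rightarrow> 'a) \<Rightarrow> bool" where
  "linear_on Z g \<longleftrightarrow> (\<forall>x\<in>Z. \<forall>y\<in>Z. g (x + y) = g x + g y) \<and> (\<forall>r. \<forall>x\<in>Z. g (r \<cdot>\<^sub>v x) = r * g x)"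

lemma linear_onI:
  assumes "\<And>x y. x \<in> Z \<Longrightarrow> y \<in> Z \<Longrightarrow> g (x + y) = g x + g y" "\<And>r x. x \<in> Z \<Longrightarrow> g (r \<cdot>\<^sub>v x) = r * g x"
  shows "linear_on Z g"
  unfolding linear_on_def using assms by auto

lemma linear_onD:
  assumes "linear_on Z g"
  shows "x \<in> Z \<Longrightarrow> y \<in> Z \<Longrightarrow> g (x + y) = g x + g y" "x \<in> Z \<Longrightarrow> g (r \<cdot>\<^sub>v x) = r * g x"
  using assms unfolding linear_on_def by auto

lemma linear_on_subset: "linear_on Z g \<Longrightarrow> Y \<subseteq> Z \<Longrightarrow> linear_on Y g"
  unfolding linear_on_def by (meson subsetD)

lemma linear_on_zero:
  fixes g :: "'a::comm_ring_1 vec \<Rightarrow> 'a"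
  assumes "linear_on Z g" "vec_submodule n Z" shows "g (0\<^sub>v n) = 0"
proof -
  have "0 \<cdot>\<^sub>v 0\<^sub>v n = (0\<^sub>v n :: 'a vec)" by (intro eq_vecI) auto
  then show ?thesis using linear_onD(2)[OF assms(1) vec_submoduleD(2)[OF assms(2)], of 0] by simp
qed

lemma linear_functional_eq_scalar_prod:
  assumes g: "linear_on (carrier_vec n) g" and z: "z \<in> carrier_vec n"
  shows "g z = vec n (\<lambda>j. g (unit_vec n j)) \<bullet> z"
proof -
  have sub: "vec_submodule n (carrier_vec n :: 'a vec set)" by (rule vec_submoduleI) auto
  \<comment> \<open>Induction on the number \<open>k\<close> of leading coordinates that may be
    nonzero; one coordinate is split off at a time.\<close>
  have "(\<And>j. k \<le> j \<Longrightarrow> j < n \<Longrightarrow> z $ j = 0) \<Longrightarrow> g z = (\<Sum>j<k. g (unit_vec n j) * z $ j)"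
    if "k \<le> n" "z \<in> carrier_vec n" for k z
    using that
  proof (induction k arbitrary: z)
    case 0
    then have "z = 0\<^sub>v n" by (intro eq_vecI) auto
    then show ?case using linear_on_zero[OF g sub] by simp
  next
    case (Suc k)
    define z' where "z' = vec n (\<lambda>j. if j = k then 0 else z $ j)"
    have z': "z' \<in> carrier_vec n" by (simp add: z'_def)
    have "z = z' + z $ k \<cdot>\<^sub>v unit_vec n k"
      using Suc.prems by (intro eq_vecI) (auto simp: z'_def)
    then have "g z = g (z' + z $ k \<cdot>\<^sub>v unit_vec n k)" by simp
    also have "\<dots> = g z' + z $ k * g (unit_vec n k)"
      using linear_onD(1)[OF g z', of "z $ k \<cdot>\<^sub>v unit_vec n k"] linear_onD(2)[OF g, of "unit_vec n k" "z $ k"]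
      by simp
    also have "g z' = (\<Sum>j<k. g (unit_vec n j) * z' $ j)"
    proof (rule Suc.IH[OF _ _ z'])
      show "z' $ j = 0" if "k \<le> j" "j < n" for j
        using Suc.prems(1)[of j] that by (cases "j = k") (auto simp: z'_def)
    qed (use Suc.prems in simp)
    also have "\<dots> = (\<Sum>j<k. g (unit_vec n j) * z $ j)"
      using Suc.prems by (intro sum.cong) (auto simp: z'_def)
    finally show ?case by (simp add: mult.commute)
  qed
  from this[of n z] z have "g z = (\<Sum>j<n. g (unit_vec n j) * z $ j)" by simp
  then show ?thesis using z by (simp add: scalar_prod_def lessThan_atLeast0)
qed

text \<open>This expresses \<open>Ext\<^sup>1(R\<^sup>n/Z, R) = 0\<close>.\<close>

definition functionals_extend :: "nat \<Rightarrow> 'a::comm_ring_1 vec set \<Rightarrow> bool" where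
  "functionals_extend n Z \<longleftrightarrow>
     (\<forall>g. linear_on Z g \<longrightarrow> (\<exists>h\<in>carrier_vec n. \<forall>z\<in>Z. g z = h \<bullet> z))"

lemma functionals_extendE:
  assumes "functionals_extend n Z" "linear_on Z g"
  obtains h where "h \<in> carrier_vec n" "\<And>z. z \<in> Z \<Longrightarrow> g z = h \<bullet> z"
  using assms unfolding functionals_extend_def by metis

section \<open>Kernels and images of matrices, and comparison of presentations\<close>

lemma mult_mat_vec_add_smult:
  fixes A :: "'a::comm_ring_1 mat"
  assumes "A \<in> carrier_mat m n"
  shows "x \<in> carrier_vec n \<Longrightarrow> y \<in> carrier_vec n \<Longrightarrow> A *\<^sub>v (x + y) = A *\<^sub>v x + A *\<^sub>v y"
    "x \<in> carrier_vec n \<Longrightarrow> A *\<^sub>v (r \<cdot>\<^sub>v x) = r \<cdot>\<^sub>v (A *\<^sub>v x)"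
    "x \<in> carrier_vec n \<Longrightarrow> y \<in> carrier_vec n \<Longrightarrow> A *\<^sub>v (x - y) = A *\<^sub>v x - A *\<^sub>v y"
    "A *\<^sub>v 0\<^sub>v n = 0\<^sub>v m"
    "x \<in> carrier_vec n \<Longrightarrow> A *\<^sub>v x \<in> carrier_vec m"
proof -
  show "x \<in> carrier_vec n \<Longrightarrow> y \<in> carrier_vec n \<Longrightarrow> A *\<^sub>v (x + y) = A *\<^sub>v x + A *\<^sub>v y"
    by (rule mult_add_distrib_mat_vec[OF assms])
  show "x \<in> carrier_vec n \<Longrightarrow> A *\<^sub>v (r \<cdot>\<^sub>v x) = r \<cdot>\<^sub>v (A *\<^sub>v x)" using assms by (intro eq_vecI) auto
  show "x \<in> carrier_vec n \<Longrightarrow> y \<in> carrier_vec n \<Longrightarrow> A *\<^sub>v (x - y) = A *\<^sub>v x - A *\<^sub>v y"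
    by (rule mult_minus_distrib_mat_vec[OF assms])
  show "A *\<^sub>v 0\<^sub>v n = 0\<^sub>v m" using assms by (intro eq_vecI) auto
  show "x \<in> carrier_vec n \<Longrightarrow> A *\<^sub>v x \<in> carrier_vec m" by (rule mult_mat_vec_carrier[OF assms])
qed

lemma mat_kernel_iff:
  "A \<in> carrier_mat m n \<Longrightarrow> z \<in> mat_kernel A \<longleftrightarrow> z \<in> carrier_vec n \<and> A *\<^sub>v z = 0\<^sub>v m"
  unfolding mat_kernel_def by auto

lemma vec_submodule_mat_kernel:
  assumes A: "A \<in> carrier_mat m n" shows "vec_submodule n (mat_kernel A)"
  by (rule vec_submoduleI) (auto simp: mat_kernel_iff[OF A] mult_mat_vec_add_smult[OF A])

lemma vec_submodule_mat_image:
  fixes A :: "'a::comm_ring_1 mat"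
  assumes A: "A \<in> carrier_mat m n" shows "vec_submodule m ((\<lambda>v. A *\<^sub>v v) ` carrier_vec n)"
proof (rule vec_submoduleI)
  note ar = mult_mat_vec_add_smult[OF A]
  show "x \<in> carrier_vec m" if "x \<in> (\<lambda>v. A *\<^sub>v v) ` carrier_vec n" for x using that ar(5) by auto
  show "0\<^sub>v m \<in> (\<lambda>v. A *\<^sub>v v) ` carrier_vec n" using ar(4) by (metis imageI zero_carrier_vec)
  show "x + y \<in> (\<lambda>v. A *\<^sub>v v) ` carrier_vec n"
    if xy: "x \<in> (\<lambda>v. A *\<^sub>v v) ` carrier_vec n" "y \<in> (\<lambda>v. A *\<^sub>v v) ` carrier_vec n" for x y
  proof -
    obtain v w where "x = A *\<^sub>v v" "v \<in> carrier_vec n" "y = A *\<^sub>v w" "w \<in> carrier_vec n"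
      using xy by auto
    then have "x + y = A *\<^sub>v (v + w)" "v + w \<in> carrier_vec n" using ar(1) by auto
    then show ?thesis by (metis imageI)
  qed
  show "r \<cdot>\<^sub>v x \<in> (\<lambda>v. A *\<^sub>v v) ` carrier_vec n" if x: "x \<in> (\<lambda>v. A *\<^sub>v v) ` carrier_vec n" for r x
  proof -
    obtain v where "x = A *\<^sub>v v" "v \<in> carrier_vec n" using x by auto
    then have "r \<cdot>\<^sub>v x = A *\<^sub>v (r \<cdot>\<^sub>v v)" "r \<cdot>\<^sub>v v \<in> carrier_vec n" using ar(2) by auto
    then show ?thesis by (metis imageI)
  qed
qed

text \<open>Independence of \<open>Ext\<^sup>1\<close> of the presentation: \<open>S\<close> and \<open>T\<close> lift the identity of the module
  presented by \<open>Z\<close> and by \<open>Y\<close>.\<close>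

lemma functionals_extend_transfer:
  fixes S T :: "'a::comm_ring_1 mat"
  assumes S: "S \<in> carrier_mat t s" and T: "T \<in> carrier_mat s t"
    and SZ: "\<And>x. x \<in> Z \<Longrightarrow> S *\<^sub>v x \<in> Y" and TY: "\<And>z. z \<in> Y \<Longrightarrow> T *\<^sub>v z \<in> Z"
    and id: "\<And>z. z \<in> carrier_vec t \<Longrightarrow> z - S *\<^sub>v (T *\<^sub>v z) \<in> Y"
    and Z: "vec_submodule s Z" and Y: "vec_submodule t Y" and ext: "functionals_extend s Z"
  shows "functionals_extend t Y"
  unfolding functionals_extend_def
proof (intro allI impI)
  fix g assume g: "linear_on Y g"
  note Sar = mult_mat_vec_add_smult[OF S] and Tar = mult_mat_vec_add_smult[OF T]
  have "linear_on Z (\<lambda>x. g (S *\<^sub>v x))"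
  proof (rule linear_onI)
    show "g (S *\<^sub>v (x + y)) = g (S *\<^sub>v x) + g (S *\<^sub>v y)" if "x \<in> Z" "y \<in> Z" for x y
      using Sar(1)[of x y] vec_submoduleD(1)[OF Z] that linear_onD(1)[OF g SZ SZ, of x y] by simp
    show "g (S *\<^sub>v (r \<cdot>\<^sub>v x)) = r * g (S *\<^sub>v x)" if "x \<in> Z" for r x
      using Sar(2)[of x r] vec_submoduleD(1)[OF Z] that linear_onD(2)[OF g SZ, of x r] by simp
  qed
  then obtain h where h: "h \<in> carrier_vec s" "\<And>x. x \<in> Z \<Longrightarrow> g (S *\<^sub>v x) = h \<bullet> x"
    by (rule functionals_extendE[OF ext]) (rule that)
  define u where "u z = z - S *\<^sub>v (T *\<^sub>v z)" for z
  have uadd: "u (x + y) = u x + u y" if x: "x \<in> carrier_vec t" and y: "y \<in> carrier_vec t" for x y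
  proof -
    have "S *\<^sub>v (T *\<^sub>v x) \<in> carrier_vec t" "S *\<^sub>v (T *\<^sub>v y) \<in> carrier_vec t" using x y Sar(5) Tar(5) by auto
    then show ?thesis unfolding u_def Tar(1)[OF x y] Sar(1)[OF Tar(5)[OF x] Tar(5)[OF y]]
      by (rule vec_add_diff_add[OF x y])
  qed
  have usmult: "u (r \<cdot>\<^sub>v x) = r \<cdot>\<^sub>v u x" if x: "x \<in> carrier_vec t" for r x
  proof -
    have "S *\<^sub>v (T *\<^sub>v x) \<in> carrier_vec t" using x Sar(5) Tar(5) by auto
    with x show ?thesis unfolding u_def Tar(2)[OF x] Sar(2)[OF Tar(5)[OF x]]
      by (rule vec_smult_diff)
  qed
  \<comment> \<open>Any \<open>z\<close> is S (T z) plus \<open>u z\<close>. The second summand is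
    in \<open>Y\<close>, where \<open>g\<close> is available; on the first one \<open>g\<close> is
    replaced by \<open>h\<close>. So \<open>G\<close> is defined on the whole free module and agrees
    with \<open>g\<close> on \<open>Y\<close>.\<close>
  define G where "G z = h \<bullet> (T *\<^sub>v z) + g (u z)" for z
  have "linear_on (carrier_vec t) G"
  proof (rule linear_onI)
    show "G (x + y) = G x + G y" if x: "x \<in> carrier_vec t" and y: "y \<in> carrier_vec t" for x y
      unfolding G_def Tar(1)[OF x y] uadd[OF x y] scalar_prod_add_distrib[OF h(1) Tar(5)[OF x] Tar(5)[OF y]]
      using linear_onD(1)[OF g id[OF x] id[OF y]] by (simp add: u_def)
    show "G (r \<cdot>\<^sub>v x) = r * G x" if x: "x \<in> carrier_vec t" for r x
      unfolding G_def Tar(2)[OF x] usmult[OF x] scalar_prod_smult_distrib[OF h(1) Tar(5)[OF x]]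
      using linear_onD(2)[OF g id[OF x]] by (simp add: u_def distrib_left)
  qed
  note rep = linear_functional_eq_scalar_prod[OF this]
  have gz: "g z = vec t (\<lambda>j. G (unit_vec t j)) \<bullet> z" if z: "z \<in> Y" for z
  proof -
    have zc: "z \<in> carrier_vec t" by (rule vec_submoduleD(1)[OF Y z])
    have w: "S *\<^sub>v (T *\<^sub>v z) \<in> Y" by (rule SZ[OF TY[OF z]])
    have "z = S *\<^sub>v (T *\<^sub>v z) + u z"
      unfolding u_def by (rule vec_add_diff_cancel[symmetric, OF vec_submoduleD(1)[OF Y w] zc])
    then have "g z = g (S *\<^sub>v (T *\<^sub>v z) + u z)" by simp
    also have "\<dots> = g (S *\<^sub>v (T *\<^sub>v z)) + g (u z)"
      by (rule linear_onD(1)[OF g w]) (unfold u_def, rule id[OF zc])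
    also have "\<dots> = G z" unfolding G_def h(2)[OF TY[OF z]] ..
    finally show ?thesis unfolding rep[OF zc] .
  qed
  show "\<exists>h\<in>carrier_vec t. \<forall>z\<in>Y. g z = h \<bullet> z"
    by (rule bexI[of _ "vec t (\<lambda>j. G (unit_vec t j))"], rule ballI, erule gz) simp
qed

text \<open>Freeness: a preimage under \<open>P\<close> is chosen for each column of
  \<open>Q\<close>.\<close>

lemma mat_factor_through_image:
  fixes P Q :: "'a::comm_ring_1 mat"
  assumes P: "P \<in> carrier_mat n t" and Q: "Q \<in> carrier_mat n s"
    and sub: "(\<lambda>v. Q *\<^sub>v v) ` carrier_vec s \<subseteq> (\<lambda>v. P *\<^sub>v v) ` carrier_vec t"
  obtains T where "T \<in> carrier_mat t s" "Q = P * T"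
proof -
  have "\<exists>v\<in>carrier_vec t. col Q j = P *\<^sub>v v" if "j < s" for j
  proof -
    have "Q *\<^sub>v unit_vec s j \<in> (\<lambda>v. P *\<^sub>v v) ` carrier_vec t" by (rule subsetD[OF sub]) simp
    then have "\<exists>v\<in>carrier_vec t. Q *\<^sub>v unit_vec s j = P *\<^sub>v v" by auto
    moreover have "Q *\<^sub>v unit_vec s j = col Q j" 
      by (rule eq_vecI) (use Q that in auto)
    ultimately show ?thesis by simp
  qed
  then have "\<exists>f. \<forall>j<s. f j \<in> carrier_vec t \<and> col Q j = P *\<^sub>v f j" by metis
  then obtain f where f: "\<And>j. j < s \<Longrightarrow> f j \<in> carrier_vec t" "\<And>j. j < s \<Longrightarrow> col Q j = P *\<^sub>v f j" by auto
  define T where "T = mat_of_cols t (map f [0..<s])"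
  have T: "T \<in> carrier_mat t s" unfolding T_def by (rule carrier_matI) simp_all
  have "Q = P * T"
  proof (rule mat_col_eqI)
    fix j assume "j < dim_col (P * T)"
    then have j: "j < s" using T by simp
    have "col T j = f j" unfolding T_def using j f(1) by (subst col_mat_of_cols) auto
    then show "col Q j = col (P * T) j" using col_mult2[OF P T j] f(2)[OF j] by simp
  qed (use P Q T in auto)
  then show ?thesis by (rule that[OF T])
qed

text \<open>Both matrices present the same image module, so the factors of one through the other
  lift its identity. This allows the generators of the dual module to be changed.\<close>

lemma functionals_extend_mat_kernel_transfer:
  fixes P Q :: "'a::comm_ring_1 mat"
  assumes P: "P \<in> carrier_mat n s" and Q: "Q \<in> carrier_mat n t"
    and im: "(\<lambda>v. P *\<^sub>v v) ` carrier_vec s = (\<lambda>v. Q *\<^sub>v v) ` carrier_vec t"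
    and ext: "functionals_extend s (mat_kernel P)"
  shows "functionals_extend t (mat_kernel Q)"
proof -
  obtain S where S: "S \<in> carrier_mat t s" "P = Q * S"
    by (rule mat_factor_through_image[OF Q P equalityD1[OF im]])
  obtain T where T: "T \<in> carrier_mat s t" "Q = P * T"
    by (rule mat_factor_through_image[OF P Q equalityD2[OF im]])
  note car = mult_mat_vec_carrier
  have QS: "Q *\<^sub>v (S *\<^sub>v x) = P *\<^sub>v x" if "x \<in> carrier_vec s" for x
    unfolding S(2) by (rule assoc_mult_mat_vec[symmetric, OF Q S(1) that])
  have PT: "P *\<^sub>v (T *\<^sub>v z) = Q *\<^sub>v z" if "z \<in> carrier_vec t" for z
  proof -
    have "P * T *\<^sub>v z = P *\<^sub>v (T *\<^sub>v z)" by (rule assoc_mult_mat_vec[OF P T(1) that])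
    then show ?thesis using T(2) by simp
  qed
  show ?thesis
  proof (rule functionals_extend_transfer[OF S(1) T(1) _ _ _ vec_submodule_mat_kernel[OF P]
        vec_submodule_mat_kernel[OF Q] ext])
    show "S *\<^sub>v x \<in> mat_kernel Q" if "x \<in> mat_kernel P" for x
      using that QS[of x] car[OF S(1), of x] unfolding mat_kernel_iff[OF P] mat_kernel_iff[OF Q] by simp
    show "T *\<^sub>v z \<in> mat_kernel P" if "z \<in> mat_kernel Q" for z
      using that PT[of z] car[OF T(1), of z] unfolding mat_kernel_iff[OF P] mat_kernel_iff[OF Q] by simp
    show "z - S *\<^sub>v (T *\<^sub>v z) \<in> mat_kernel Q" if z: "z \<in> carrier_vec t" for z
    proof -
      have c: "T *\<^sub>v z \<in> carrier_vec s" "S *\<^sub>v (T *\<^sub>v z) \<in> carrier_vec t"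
        by (rule car[OF T(1) z], rule car[OF S(1) car[OF T(1) z]])
      have "Q *\<^sub>v (z - S *\<^sub>v (T *\<^sub>v z)) = Q *\<^sub>v z - Q *\<^sub>v z"
        unfolding mult_mat_vec_add_smult(3)[OF Q z c(2)] QS[OF c(1)] PT[OF z] ..
      then show ?thesis unfolding mat_kernel_iff[OF Q] using z c car[OF Q z] by simp
    qed
  qed
qed

text \<open>\<open>\<eta>\<close> is the value given to \<open>\<zeta>\<close>, and the hypothesis
  on it is agreement with \<open>g\<close> on the intersection of \<open>Z\<close> with R
  \<open>\<zeta>\<close>.\<close>

lemma linear_on_extend_one:
  assumes Z: "vec_submodule n Z" and g: "linear_on Z g" and \<zeta>: "\<zeta> \<in> carrier_vec n"
    and \<eta>: "\<And>r. r \<cdot>\<^sub>v \<zeta> \<in> Z \<Longrightarrow> g (r \<cdot>\<^sub>v \<zeta>) = r * \<eta>"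
  obtains G where "linear_on {z + r \<cdot>\<^sub>v \<zeta> | z r. z \<in> Z} G" "\<And>z. z \<in> Z \<Longrightarrow> G z = g z"
proof -
  define Y where "Y = {z + r \<cdot>\<^sub>v \<zeta> | z r. z \<in> Z}"
  have Zc: "z \<in> carrier_vec n" if "z \<in> Z" for z by (rule vec_submoduleD(1)[OF Z that])
  have uniq: "g z + r * \<eta> = g z' + r' * \<eta>"
    if z: "z \<in> Z" "z' \<in> Z" and eq: "z + r \<cdot>\<^sub>v \<zeta> = z' + r' \<cdot>\<^sub>v \<zeta>" for z z' r r'
  proof -
    have "(r - r') \<cdot>\<^sub>v \<zeta> = z' - z"
    proof (rule eq_vecI)
      fix j assume "j < dim_vec (z' - z)"
      then have j: "j < n" using Zc[OF z(1)] by simp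
      have "(z + r \<cdot>\<^sub>v \<zeta>) $ j = (z' + r' \<cdot>\<^sub>v \<zeta>) $ j" using eq by simp
      then show "((r - r') \<cdot>\<^sub>v \<zeta>) $ j = (z' - z) $ j"
        using j Zc[OF z(1)] Zc[OF z(2)] \<zeta> by (simp add: algebra_simps)
    qed (use \<zeta> Zc[OF z(1)] in simp)
    then have d: "(r - r') \<cdot>\<^sub>v \<zeta> \<in> Z" "g ((r - r') \<cdot>\<^sub>v \<zeta>) = g (z' - z)"
      using vec_submodule_diff[OF Z z(2,1)] by simp_all
    have "z' = (z' - z) + z" using Zc[OF z(1)] Zc[OF z(2)] by (intro eq_vecI) auto
    then have "g z' = g ((z' - z) + z)" by simp
    also have "\<dots> = g (z' - z) + g z" by (rule linear_onD(1)[OF g vec_submodule_diff[OF Z z(2,1)] z(1)])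
    also have "g (z' - z) = (r - r') * \<eta>" using \<eta>[OF d(1)] d(2) by simp
    finally show ?thesis by (simp add: algebra_simps)
  qed
  have YE: "\<exists>z r. y = z + r \<cdot>\<^sub>v \<zeta> \<and> z \<in> Z" if "y \<in> Y" for y using that unfolding Y_def by auto
  define p where "p y = (SOME zr. y = fst zr + snd zr \<cdot>\<^sub>v \<zeta> \<and> fst zr \<in> Z)" for y
  have p: "y = fst (p y) + snd (p y) \<cdot>\<^sub>v \<zeta> \<and> fst (p y) \<in> Z" if y: "y \<in> Y" for y
  proof -
    obtain z r where "y = z + r \<cdot>\<^sub>v \<zeta> \<and> z \<in> Z" using YE[OF y] by auto
    then have "y = fst (z, r) + snd (z, r) \<cdot>\<^sub>v \<zeta> \<and> fst (z, r) \<in> Z" by simp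
    then show ?thesis unfolding p_def by (rule someI)
  qed
  define G where "G y = g (fst (p y)) + snd (p y) * \<eta>" for y
  have G: "G (z + r \<cdot>\<^sub>v \<zeta>) = g z + r * \<eta>" if z: "z \<in> Z" for z r
  proof -
    have "z + r \<cdot>\<^sub>v \<zeta> \<in> Y" unfolding Y_def using z by auto
    then have q: "z + r \<cdot>\<^sub>v \<zeta> = fst (p (z + r \<cdot>\<^sub>v \<zeta>)) + snd (p (z + r \<cdot>\<^sub>v \<zeta>)) \<cdot>\<^sub>v \<zeta>"
      "fst (p (z + r \<cdot>\<^sub>v \<zeta>)) \<in> Z"
      by (rule p[THEN conjunct1], rule p[THEN conjunct2])
    show ?thesis unfolding G_def by (rule uniq[OF q(2) z q(1)[symmetric]])
  qed
  have "linear_on Y G"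
  proof (rule linear_onI)
    fix x assume "x \<in> Y"
    obtain z r where x: "x = z + r \<cdot>\<^sub>v \<zeta>" "z \<in> Z" using YE[OF \<open>x \<in> Y\<close>] by (elim exE conjE)
    have Gx: "G x = g z + r * \<eta>" unfolding x(1) by (rule G[OF x(2)])
    show "G (x + y) = G x + G y" if "y \<in> Y" for y
    proof -
      obtain w s where y: "y = w + s \<cdot>\<^sub>v \<zeta>" "w \<in> Z" using YE[OF \<open>y \<in> Y\<close>] by (elim exE conjE)
      have Gy: "G y = g w + s * \<eta>" unfolding y(1) by (rule G[OF y(2)])
      have "x + y = (z + w) + (r + s) \<cdot>\<^sub>v \<zeta>"
        unfolding x(1) y(1) using Zc[OF x(2)] Zc[OF y(2)] \<zeta> by (intro eq_vecI) (auto simp: algebra_simps)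
      then have "G (x + y) = g (z + w) + (r + s) * \<eta>"
        using G[OF vec_submoduleD(3)[OF Z x(2) y(2)], of "r + s"] by (simp only:)
      also have "\<dots> = (g z + r * \<eta>) + (g w + s * \<eta>)"
        unfolding linear_onD(1)[OF g x(2) y(2)] by (simp add: algebra_simps)
      finally show ?thesis using Gx Gy by (simp only:)
    qed
    show "G (s \<cdot>\<^sub>v x) = s * G x" for s
    proof -
      have "s \<cdot>\<^sub>v x = s \<cdot>\<^sub>v z + (s * r) \<cdot>\<^sub>v \<zeta>"
        unfolding x(1) using Zc[OF x(2)] \<zeta> by (intro eq_vecI) (auto simp: algebra_simps)
      then have "G (s \<cdot>\<^sub>v x) = g (s \<cdot>\<^sub>v z) + (s * r) * \<eta>"
        using G[OF vec_submoduleD(4)[OF Z x(2)], of s "s * r"] by (simp only:)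
      then show ?thesis unfolding Gx linear_onD(2)[OF g x(2)] by (simp only: distrib_left mult.assoc)
    qed
  qed
  moreover have "G z = g z" if z: "z \<in> Z" for z
  proof -
    have "z + 0 \<cdot>\<^sub>v \<zeta> = z" using Zc[OF z] \<zeta> by (intro eq_vecI) auto
    then show ?thesis using G[OF z, of 0] by simp
  qed
  ultimately show ?thesis unfolding Y_def by (rule that)
qed

section \<open>Passing to the quotient by a copy of R/(a)\<close>

definition append_col :: "'a::comm_ring_1 mat \<Rightarrow> 'a vec \<Rightarrow> 'a mat" where
  "append_col P k = mat (dim_row P) (Suc (dim_col P))
     (\<lambda>(r, j). if j < dim_col P then P $$ (r, j) else k $ r)"

lemma append_col_carrier: "P \<in> carrier_mat n t \<Longrightarrow> append_col P k \<in> carrier_mat n (Suc t)"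
  unfolding append_col_def by (rule carrier_matI) (auto dest: carrier_matD)

lemma append_col_mult:
  assumes P: "P \<in> carrier_mat n t" and k: "k \<in> carrier_vec n" and z: "z \<in> carrier_vec (Suc t)"
  shows "append_col P k *\<^sub>v z = P *\<^sub>v vec_first z t + z $ t \<cdot>\<^sub>v k"
proof (rule eq_vecI)
  fix r assume "r < dim_vec (P *\<^sub>v vec_first z t + z $ t \<cdot>\<^sub>v k)"
  then have r: "r < n" using k by simp
  have "(append_col P k *\<^sub>v z) $ r = (\<Sum>j<Suc t. append_col P k $$ (r, j) * z $ j)"
    using P r z by (simp add: append_col_def scalar_prod_def lessThan_atLeast0)
  also have "\<dots> = (\<Sum>j<t. P $$ (r, j) * z $ j) + k $ r * z $ t"
    using P r by (simp add: append_col_def)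
  also have "(\<Sum>j<t. P $$ (r, j) * z $ j) = (P *\<^sub>v vec_first z t) $ r"
    using P r by (simp add: vec_first_def scalar_prod_def lessThan_atLeast0)
  finally show "(append_col P k *\<^sub>v z) $ r = (P *\<^sub>v vec_first z t + z $ t \<cdot>\<^sub>v k) $ r"
    using P r k by (simp add: mult.commute)
next
  show "dim_vec (append_col P k *\<^sub>v z) = dim_vec (P *\<^sub>v vec_first z t + z $ t \<cdot>\<^sub>v k)"
    using carrier_vecD[OF k] carrier_matD(1)[OF P] by (simp add: append_col_def)
qed

definition vec_annihilator :: "nat \<Rightarrow> 'a::comm_ring_1 vec set \<Rightarrow> 'a vec set" where
  "vec_annihilator n Z = {c \<in> carrier_vec n. \<forall>x\<in>Z. c \<bullet> x = 0}"

lemma vec_annihilatorI: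
  "c \<in> carrier_vec n \<Longrightarrow> (\<And>x. x \<in> Z \<Longrightarrow> c \<bullet> x = 0) \<Longrightarrow> c \<in> vec_annihilator n Z"
  unfolding vec_annihilator_def by auto

lemma vec_annihilatorD:
  assumes "c \<in> vec_annihilator n Z" shows "c \<in> carrier_vec n" "x \<in> Z \<Longrightarrow> c \<bullet> x = 0"
  using assms unfolding vec_annihilator_def by auto

text \<open>For \<open>M = R\<^sup>n/Z\<close>, with \<open>M\<^sup>*\<close> identified with the annihilator of \<open>Z\<close>: \<open>Ext\<^sup>1(M, R) = 0\<close>,
  \<open>M\<close> is torsionless, and \<open>Ext\<^sup>1(M\<^sup>*, R) = 0\<close>.\<close>

definition ext_torsionless :: "nat \<Rightarrow> 'a::comm_ring_1 vec set \<Rightarrow> bool" where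
  "ext_torsionless n Z \<longleftrightarrow> vec_submodule n Z \<and> functionals_extend n Z \<and>
     (\<forall>x\<in>carrier_vec n. (\<forall>c\<in>vec_annihilator n Z. c \<bullet> x = 0) \<longrightarrow> x \<in> Z) \<and>
     (\<exists>t P. P \<in> carrier_mat n t \<and> vec_annihilator n Z = (\<lambda>v. P *\<^sub>v v) ` carrier_vec t \<and>
        functionals_extend t (mat_kernel P))"

lemma scalar_prod_mult_mat_vec:
  fixes P :: "'a::comm_ring_1 mat"
  assumes P: "P \<in> carrier_mat n t" and v: "v \<in> carrier_vec t" and e: "e \<in> carrier_vec n"
  shows "(P *\<^sub>v v) \<bullet> e = (transpose_mat P *\<^sub>v e) \<bullet> v"
proof -
  have "(transpose_mat P *\<^sub>v e) \<bullet> v = e \<bullet> (P *\<^sub>v v)"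
    by (rule transpose_vec_mult_scalar[OF P v e])
  also have "\<dots> = (P *\<^sub>v v) \<bullet> e" by (rule comm_scalar_prod[OF e mult_mat_vec_carrier[OF P v]])
  finally show ?thesis ..
qed

lemma vec_first_linear:
  fixes y z :: "'a::comm_ring_1 vec"
  assumes "y \<in> carrier_vec (Suc t)" "z \<in> carrier_vec (Suc t)"
  shows "vec_first (y + z) t = vec_first y t + vec_first z t"
    "vec_first (r \<cdot>\<^sub>v z) t = r \<cdot>\<^sub>v vec_first z t"
  using assms by (auto simp: vec_first_def intro!: eq_vecI)

lemma vec_cancel:
  fixes p k :: "'a::comm_ring_1 vec"
  assumes "p \<in> carrier_vec n" "k \<in> carrier_vec n"
  shows "p + (- (a * r)) \<cdot>\<^sub>v k + r \<cdot>\<^sub>v (a \<cdot>\<^sub>v k) = p"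
    "p + (- r) \<cdot>\<^sub>v k + 0 \<cdot>\<^sub>v (a \<cdot>\<^sub>v k) + r \<cdot>\<^sub>v k = p"
  using assms by (auto intro!: eq_vecI simp: ac_simps)

text \<open>Modulo the column module of \<open>P\<close>, the vector \<open>\<kappa>\<close> spans a
  copy of R/(a): if r \<open>\<kappa>\<close> is in that module, pairing with \<open>e\<close> gives
  r y = 0 for \<open>y = \<kappa> \<bullet> e\<close>, so \<open>a\<close> divides r. Hence Ext^1 of
  the column module sits between Ext^1 of the enlarged module, which vanishes, and Ext^2(R/(a),R) =
  0. The proof carries this out on the relations.\<close>

lemma functionals_extend_drop_col:
  fixes P :: "'a::comm_ring_1 mat"
  assumes P: "P \<in> carrier_mat n t" and \<kappa>: "\<kappa> \<in> carrier_vec n" and e: "e \<in> carrier_vec n"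
    and ay: "exact_pair a (\<kappa> \<bullet> e)" and Pe: "\<And>v. v \<in> carrier_vec t \<Longrightarrow> (P *\<^sub>v v) \<bullet> e = 0"
    and v0: "v0 \<in> carrier_vec t" "P *\<^sub>v v0 = a \<cdot>\<^sub>v \<kappa>"
    and ext: "functionals_extend (Suc t) (mat_kernel (append_col P \<kappa>))"
  shows "functionals_extend t (mat_kernel P)"
  unfolding functionals_extend_def
proof (intro allI impI)
  fix g assume g: "linear_on (mat_kernel P) g"
  define y where "y = \<kappa> \<bullet> e"
  have ey: "exact_pair a y" using ay by (simp only: y_def)
  have ya: "y * a = 0" using exact_pair_mult[OF ey] by (simp add: mult.commute)
  note Q = append_col_carrier[OF P, of \<kappa>] and ar = mult_mat_vec_add_smult[OF P]
  \<comment> \<open>\<open>Z\<close> is the kernel of \<open>P\<close>, embedded with last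
    coordinate 0.\<close>
  define Z where "Z = {z \<in> carrier_vec (Suc t). z $ t = 0 \<and> vec_first z t \<in> mat_kernel P}"
  have ZI: "z \<in> Z" if "z \<in> carrier_vec (Suc t)" "z $ t = 0" "P *\<^sub>v vec_first z t = 0\<^sub>v n" for z
    unfolding Z_def mat_kernel_iff[OF P] using that by simp
  have ZD: "z \<in> carrier_vec (Suc t)" "z $ t = 0" "vec_first z t \<in> mat_kernel P" if "z \<in> Z" for z
    using that unfolding Z_def by simp_all
  note sk = vec_submodule_mat_kernel[OF P]
  have Z: "vec_submodule (Suc t) Z"
  proof (rule vec_submoduleI)
    have "vec_first (0\<^sub>v (Suc t)) t = (0\<^sub>v t :: 'a vec)" by (rule eq_vecI) (auto simp: vec_first_def)
    then show "0\<^sub>v (Suc t) \<in> Z" using ar(4) by (intro ZI) simp_all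
    show "x + z \<in> Z" if "x \<in> Z" "z \<in> Z" for x z
      unfolding Z_def mem_Collect_eq vec_first_linear(1)[OF ZD(1)[OF that(1)] ZD(1)[OF that(2)]]
      using ZD[OF that(1)] ZD[OF that(2)] vec_submoduleD(3)[OF sk] by simp
    show "r \<cdot>\<^sub>v z \<in> Z" if "z \<in> Z" for r z
      unfolding Z_def mem_Collect_eq vec_first_linear(2)[OF ZD(1)[OF that] ZD(1)[OF that]]
      using ZD[OF that] vec_submoduleD(4)[OF sk] by simp
  qed (rule ZD(1))
  define g1 where "g1 z = g (vec_first z t)" for z
  have g1: "linear_on Z g1"
  proof (rule linear_onI)
    show "g1 (x + z) = g1 x + g1 z" if "x \<in> Z" "z \<in> Z" for x z
      unfolding g1_def vec_first_linear(1)[OF ZD(1)[OF that(1)] ZD(1)[OF that(2)]]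
      by (rule linear_onD(1)[OF g ZD(3)[OF that(1)] ZD(3)[OF that(2)]])
    show "g1 (r \<cdot>\<^sub>v z) = r * g1 z" if "z \<in> Z" for r z
      unfolding g1_def vec_first_linear(2)[OF ZD(1)[OF that] ZD(1)[OF that]]
      by (rule linear_onD(2)[OF g ZD(3)[OF that]])
  qed
  \<comment> \<open>\<open>\<zeta>\<close> is the relation that expresses a \<open>\<kappa>\<close>
    by the columns of \<open>P\<close>. Up to its multiples, the relations of the enlarged matrix
    are those of \<open>P\<close>.\<close>
  define \<zeta> where "\<zeta> = vec (Suc t) (\<lambda>j. if j < t then - (v0 $ j) else a)"
  have \<zeta>: "\<zeta> \<in> carrier_vec (Suc t)" "\<zeta> $ t = a" by (simp_all add: \<zeta>_def)
  have "vec_first \<zeta> t = (- 1) \<cdot>\<^sub>v v0" using v0(1) by (intro eq_vecI) (auto simp: \<zeta>_def vec_first_def)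
  then have P\<zeta>: "P *\<^sub>v vec_first \<zeta> t = (- a) \<cdot>\<^sub>v \<kappa>"
    using ar(2)[OF v0(1), of "- 1"] v0(2) \<kappa> by (simp add: smult_smult_assoc)
  have y\<zeta>: "y \<cdot>\<^sub>v \<zeta> \<in> Z"
  proof (rule ZI)
    show "(y \<cdot>\<^sub>v \<zeta>) $ t = 0" using \<zeta> ya by simp
    have "P *\<^sub>v vec_first (y \<cdot>\<^sub>v \<zeta>) t = y \<cdot>\<^sub>v ((- a) \<cdot>\<^sub>v \<kappa>)"
      unfolding vec_first_linear(2)[OF \<zeta>(1) \<zeta>(1)] P\<zeta>[symmetric] by (rule ar(2)) simp
    also have "\<dots> = 0\<^sub>v n" using ya \<kappa> by (intro eq_vecI) (simp_all add: mult.assoc[symmetric])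
    finally show "P *\<^sub>v vec_first (y \<cdot>\<^sub>v \<zeta>) t = 0\<^sub>v n" .
  qed (use \<zeta> in simp)
  \<comment> \<open>The vector y \<open>\<zeta>\<close> is in \<open>Z\<close> and killed by
    \<open>a\<close>, so its value is y \<open>\<eta>\<close> for some \<open>\<eta>\<close>, which
    becomes the value at \<open>\<zeta>\<close>. This is the vanishing of Ext^2(R/(a),R).\<close>
  have "a * g1 (y \<cdot>\<^sub>v \<zeta>) = 0"
  proof -
    have "a \<cdot>\<^sub>v (y \<cdot>\<^sub>v \<zeta>) = 0\<^sub>v (Suc t)"
      using \<zeta>(1) exact_pair_mult[OF ey] by (intro eq_vecI) (simp_all add: mult.assoc[symmetric])
    then show ?thesis using linear_onD(2)[OF g1 y\<zeta>, of a] linear_on_zero[OF g1 Z] by simp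
  qed
  then obtain \<eta> where \<eta>: "g1 (y \<cdot>\<^sub>v \<zeta>) = y * \<eta>" by (rule exact_pairE[OF ey])
  have \<eta>': "g1 (r \<cdot>\<^sub>v \<zeta>) = r * \<eta>" if r: "r \<cdot>\<^sub>v \<zeta> \<in> Z" for r
  proof -
    have "a * r = 0" using ZD(2)[OF r] \<zeta> by (simp add: mult.commute)
    then obtain s where s: "r = y * s" by (rule exact_pairE[OF ey])
    have "r \<cdot>\<^sub>v \<zeta> = s \<cdot>\<^sub>v (y \<cdot>\<^sub>v \<zeta>)" unfolding s by (simp add: smult_smult_assoc mult.commute)
    then have "g1 (r \<cdot>\<^sub>v \<zeta>) = s * (y * \<eta>)" using linear_onD(2)[OF g1 y\<zeta>, of s] \<eta> by simp
    then show ?thesis unfolding s by (simp add: ac_simps)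
  qed
  obtain G where G: "linear_on {z + r \<cdot>\<^sub>v \<zeta> | z r. z \<in> Z} G" "\<And>z. z \<in> Z \<Longrightarrow> G z = g1 z"
    by (rule linear_on_extend_one[OF Z g1 \<zeta>(1)]) (erule \<eta>', rule that)
  have "mat_kernel (append_col P \<kappa>) \<subseteq> {z + r \<cdot>\<^sub>v \<zeta> | z r. z \<in> Z}"
  proof
    fix z assume "z \<in> mat_kernel (append_col P \<kappa>)"
    then have z: "z \<in> carrier_vec (Suc t)" and "append_col P \<kappa> *\<^sub>v z = 0\<^sub>v n"
      unfolding mat_kernel_iff[OF Q] by simp_all
    then have Pz: "P *\<^sub>v vec_first z t + z $ t \<cdot>\<^sub>v \<kappa> = 0\<^sub>v n" unfolding append_col_mult[OF P \<kappa> z] by simp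
    have fc: "vec_first z t \<in> carrier_vec t" by simp
    note Pc = ar(5)[OF fc]
    \<comment> \<open>Pairing the relation with \<open>e\<close> removes the part from
      \<open>P\<close> and leaves \<open>z $ t * y = 0\<close>, so the last coordinate is a multiple
      of \<open>a\<close>.\<close>
    have "(P *\<^sub>v vec_first z t + z $ t \<cdot>\<^sub>v \<kappa>) \<bullet> e = z $ t * y"
      using Pe[OF fc] e \<kappa> Pc by (simp add: add_scalar_prod_distrib[OF Pc _ e] y_def)
    then have "y * z $ t = 0" using Pz e by (simp add: mult.commute)
    then obtain \<mu> where \<mu>: "z $ t = a * \<mu>" by (rule exact_pairE[OF exact_pair_sym[OF ey]])
    have "z + (- \<mu>) \<cdot>\<^sub>v \<zeta> \<in> Z"
    proof (rule ZI)
      show "(z + (- \<mu>) \<cdot>\<^sub>v \<zeta>) $ t = 0" using \<mu> \<zeta> z by (simp add: mult.commute)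
      have m\<zeta>: "(- \<mu>) \<cdot>\<^sub>v \<zeta> \<in> carrier_vec (Suc t)" using \<zeta>(1) by simp
      have "P *\<^sub>v vec_first (z + (- \<mu>) \<cdot>\<^sub>v \<zeta>) t = P *\<^sub>v vec_first z t + P *\<^sub>v ((- \<mu>) \<cdot>\<^sub>v vec_first \<zeta> t)"
        unfolding vec_first_linear(1)[OF z m\<zeta>] vec_first_linear(2)[OF \<zeta>(1) \<zeta>(1)] by (rule ar(1)[OF fc]) simp
      also have "P *\<^sub>v ((- \<mu>) \<cdot>\<^sub>v vec_first \<zeta> t) = (- \<mu>) \<cdot>\<^sub>v ((- a) \<cdot>\<^sub>v \<kappa>)"
        unfolding P\<zeta>[symmetric] by (rule ar(2)) simp
      also have "\<dots> = z $ t \<cdot>\<^sub>v \<kappa>" unfolding \<mu> using \<kappa> by (intro eq_vecI) (simp_all add: ac_simps)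
      finally show "P *\<^sub>v vec_first (z + (- \<mu>) \<cdot>\<^sub>v \<zeta>) t = 0\<^sub>v n" unfolding Pz .
    qed (use z \<zeta> in simp)
    moreover have "z = (z + (- \<mu>) \<cdot>\<^sub>v \<zeta>) + \<mu> \<cdot>\<^sub>v \<zeta>" using z \<zeta>(1) by (intro eq_vecI) auto
    ultimately show "z \<in> {z + r \<cdot>\<^sub>v \<zeta> | z r. z \<in> Z}" by blast
  qed
  then have "linear_on (mat_kernel (append_col P \<kappa>)) G" by (rule linear_on_subset[OF G(1)])
  then obtain h where h: "h \<in> carrier_vec (Suc t)" "\<And>z. z \<in> mat_kernel (append_col P \<kappa>) \<Longrightarrow> G z = h \<bullet> z"
    by (rule functionals_extendE[OF ext]) (rule that)
  have gz: "g z = vec_first h t \<bullet> z" if z: "z \<in> mat_kernel P" for z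
  proof -
    have zc: "z \<in> carrier_vec t" and Pz: "P *\<^sub>v z = 0\<^sub>v n" using z unfolding mat_kernel_iff[OF P] by simp_all
    define z1 where "z1 = vec (Suc t) (\<lambda>j. if j < t then z $ j else 0)"
    have z1: "z1 \<in> carrier_vec (Suc t)" "z1 $ t = 0" by (simp_all add: z1_def)
    have f: "vec_first z1 t = z" using zc by (intro eq_vecI) (auto simp: z1_def vec_first_def)
    have "z1 \<in> Z" using z1 f Pz by (intro ZI) simp_all
    then have "G z1 = g z" using G(2) f by (simp add: g1_def)
    moreover have "z1 \<in> mat_kernel (append_col P \<kappa>)"
      unfolding mat_kernel_iff[OF Q] append_col_mult[OF P \<kappa> z1(1)] f Pz z1(2)
      using z1(1) \<kappa> by (intro conjI eq_vecI) auto
    then have "G z1 = h \<bullet> z1" by (rule h(2))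
    moreover have "h \<bullet> z1 = vec_first h t \<bullet> z"
      using zc by (simp add: scalar_prod_def z1_def vec_first_def)
    ultimately show ?thesis by simp
  qed
  show "\<exists>h\<in>carrier_vec t. \<forall>z\<in>mat_kernel P. g z = h \<bullet> z"
    by (rule bexI[of _ "vec_first h t"], rule ballI, erule gz) simp
qed

text \<open>In R^n/Z the class of \<open>e\<close> spans a copy of R/(a). Its functionals are
  multiples of \<open>\<kappa>\<close>, since they send \<open>e\<close> into the annihilator of
  \<open>a\<close>, which \<open>\<kappa> \<bullet> e\<close> generates. So the three properties are
  checked by correcting with multiples of \<open>\<kappa>\<close> on the dual side and of
  \<open>e\<close> on the other.\<close>

lemma ext_torsionless_extend_one:
  assumes H: "ext_torsionless n Z" and e: "e \<in> carrier_vec n" and \<kappa>: "\<kappa> \<in> vec_annihilator n Z"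
    and ay: "exact_pair a (\<kappa> \<bullet> e)" and ae: "a \<cdot>\<^sub>v e \<in> Z"
  shows "ext_torsionless n {x + r \<cdot>\<^sub>v e | x r. x \<in> Z}"
proof -
  define Y where "Y = {x + r \<cdot>\<^sub>v e | x r. x \<in> Z}"
  define y where "y = \<kappa> \<bullet> e"
  have ey: "exact_pair a y" using ay by (simp only: y_def)
  have Z: "vec_submodule n Z" and E1: "functionals_extend n Z"
    and T: "\<And>x. x \<in> carrier_vec n \<Longrightarrow> (\<And>c. c \<in> vec_annihilator n Z \<Longrightarrow> c \<bullet> x = 0) \<Longrightarrow> x \<in> Z"
    using H unfolding ext_torsionless_def by auto
  obtain t P where P: "P \<in> carrier_mat n t" and imP: "vec_annihilator n Z = (\<lambda>v. P *\<^sub>v v) ` carrier_vec t"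
    and E2: "functionals_extend t (mat_kernel P)"
    using H unfolding ext_torsionless_def by (elim conjE exE)
  note \<kappa>c = vec_annihilatorD(1)[OF \<kappa>] and Zc = vec_submoduleD(1)[OF Z]
  note K = vec_submodule_mat_image[OF P, folded imP] and ar = mult_mat_vec_add_smult[OF P]
  have YI: "x + r \<cdot>\<^sub>v e \<in> Y" if "x \<in> Z" for x r unfolding Y_def using that by blast
  have YE: "\<exists>x r. z = x + r \<cdot>\<^sub>v e \<and> x \<in> Z" if "z \<in> Y" for z using that unfolding Y_def by blast
  have ZY: "x \<in> Y" if "x \<in> Z" for x
  proof -
    have "x + 0 \<cdot>\<^sub>v e = x" using Zc[OF that] e by (intro eq_vecI) auto
    then show ?thesis using YI[OF that, of 0] by simp
  qed
  have eY: "e \<in> Y"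
  proof -
    have "0\<^sub>v n + 1 \<cdot>\<^sub>v e = e" using e by (intro eq_vecI) auto
    then show ?thesis using YI[OF vec_submoduleD(2)[OF Z], of 1] by simp
  qed
  have Y: "vec_submodule n Y"
  proof (rule vec_submoduleI)
    show "z \<in> carrier_vec n" if "z \<in> Y" for z using YE[OF that] Zc e by auto
    show "0\<^sub>v n \<in> Y" by (rule ZY[OF vec_submoduleD(2)[OF Z]])
    show "p + q \<in> Y" if p: "p \<in> Y" and q: "q \<in> Y" for p q
    proof -
      obtain x r where x: "p = x + r \<cdot>\<^sub>v e" "x \<in> Z" using YE[OF p] by (elim exE conjE)
      obtain w s where w: "q = w + s \<cdot>\<^sub>v e" "w \<in> Z" using YE[OF q] by (elim exE conjE)
      have "p + q = (x + w) + (r + s) \<cdot>\<^sub>v e"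
        unfolding x(1) w(1) using Zc[OF x(2)] Zc[OF w(2)] e by (intro eq_vecI) (auto simp: algebra_simps)
      then show ?thesis using YI[OF vec_submoduleD(3)[OF Z x(2) w(2)]] by simp
    qed
    show "s \<cdot>\<^sub>v p \<in> Y" if p: "p \<in> Y" for s p
    proof -
      obtain x r where x: "p = x + r \<cdot>\<^sub>v e" "x \<in> Z" using YE[OF p] by (elim exE conjE)
      have "s \<cdot>\<^sub>v p = s \<cdot>\<^sub>v x + (s * r) \<cdot>\<^sub>v e"
        unfolding x(1) using Zc[OF x(2)] e by (intro eq_vecI) (auto simp: algebra_simps)
      then show ?thesis using YI[OF vec_submoduleD(4)[OF Z x(2)]] by simp
    qed
  qed
  have annY: "c \<in> vec_annihilator n Y \<longleftrightarrow> c \<in> vec_annihilator n Z \<and> c \<bullet> e = 0" for c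
  proof
    assume c: "c \<in> vec_annihilator n Y"
    then show "c \<in> vec_annihilator n Z \<and> c \<bullet> e = 0"
      using vec_annihilatorD(2)[OF c ZY] vec_annihilatorD(2)[OF c eY]
      by (intro conjI vec_annihilatorI vec_annihilatorD(1)[OF c])
  next
    assume c: "c \<in> vec_annihilator n Z \<and> c \<bullet> e = 0"
    then have cZ: "c \<in> vec_annihilator n Z" ..
    note cc = vec_annihilatorD(1)[OF cZ]
    show "c \<in> vec_annihilator n Y"
    proof (rule vec_annihilatorI[OF cc])
      fix z assume "z \<in> Y"
      obtain x r where x: "z = x + r \<cdot>\<^sub>v e" "x \<in> Z" using YE[OF \<open>z \<in> Y\<close>] by (elim exE conjE)
      have re: "r \<cdot>\<^sub>v e \<in> carrier_vec n" using e by simp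
      show "c \<bullet> z = 0"
        unfolding x(1) scalar_prod_add_distrib[OF cc Zc[OF x(2)] re]
        using vec_annihilatorD(2)[OF cZ x(2)] c scalar_prod_smult_distrib[OF cc e] by simp
    qed
  qed
  have Ke: "y dvd c \<bullet> e" if c: "c \<in> vec_annihilator n Z" for c
  proof -
    have "a * (c \<bullet> e) = 0"
      using vec_annihilatorD(2)[OF c ae] scalar_prod_smult_distrib[OF vec_annihilatorD(1)[OF c] e] by simp
    then show ?thesis using exact_pair_mult_eq_0_iff[OF ey] by simp
  qed
  have E1Y: "functionals_extend n Y"
    unfolding functionals_extend_def
  proof (intro allI impI)
    fix g assume g: "linear_on Y g"
    have "Z \<subseteq> Y" using ZY by (rule subsetI)
    then obtain h where h: "h \<in> carrier_vec n" "\<And>x. x \<in> Z \<Longrightarrow> g x = h \<bullet> x"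
      by (rule functionals_extendE[OF E1 linear_on_subset[OF g]]) (rule that)
    \<comment> \<open>\<open>h\<close> is right on \<open>Z\<close> but perhaps not at
      \<open>e\<close>. The error there is killed by \<open>a\<close>, so it is y s, and s
      \<open>\<kappa>\<close> corrects it without changing anything on \<open>Z\<close>.\<close>
    have "a * (g e - h \<bullet> e) = g (a \<cdot>\<^sub>v e) - h \<bullet> (a \<cdot>\<^sub>v e)"
      using linear_onD(2)[OF g eY] scalar_prod_smult_distrib[OF h(1) e] by (simp add: right_diff_distrib)
    then have "a * (g e - h \<bullet> e) = 0" using h(2)[OF ae] by simp
    then obtain s where s: "g e - h \<bullet> e = y * s" by (rule exact_pairE[OF ey])
    have s\<kappa>: "s \<cdot>\<^sub>v \<kappa> \<in> carrier_vec n" using \<kappa>c by simp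
    have "g z = (h + s \<cdot>\<^sub>v \<kappa>) \<bullet> z" if z: "z \<in> Y" for z
    proof -
      obtain x r where x: "z = x + r \<cdot>\<^sub>v e" "x \<in> Z" using YE[OF z] by (elim exE conjE)
      note xc = Zc[OF x(2)]
      have re: "r \<cdot>\<^sub>v e \<in> carrier_vec n" "r \<cdot>\<^sub>v e \<in> Y" using e vec_submoduleD(4)[OF Y eY] by simp_all
      have "g z = h \<bullet> x + r * g e"
        unfolding x(1) linear_onD(1)[OF g ZY[OF x(2)] re(2)] linear_onD(2)[OF g eY] h(2)[OF x(2)] ..
      moreover have "g e = h \<bullet> e + s * y" using s by (simp add: algebra_simps)
      moreover have "\<kappa> \<bullet> z = r * y"
        unfolding x(1) scalar_prod_add_distrib[OF \<kappa>c xc re(1)] scalar_prod_smult_distrib[OF \<kappa>c e]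
          vec_annihilatorD(2)[OF \<kappa> x(2)] y_def by simp
      moreover have "h \<bullet> z = h \<bullet> x + r * (h \<bullet> e)"
        unfolding x(1) scalar_prod_add_distrib[OF h(1) xc re(1)] scalar_prod_smult_distrib[OF h(1) e] ..
      moreover have "(h + s \<cdot>\<^sub>v \<kappa>) \<bullet> z = h \<bullet> z + s * (\<kappa> \<bullet> z)"
        using vec_submoduleD(1)[OF Y z] h(1) \<kappa>c s\<kappa> by (simp add: add_scalar_prod_distrib[OF h(1) s\<kappa>])
      ultimately show ?thesis by (simp add: algebra_simps)
    qed
    then show "\<exists>h\<in>carrier_vec n. \<forall>z\<in>Y. g z = h \<bullet> z"
      using h(1) s\<kappa> by (intro bexI[of _ "h + s \<cdot>\<^sub>v \<kappa>"] ballI) simp_all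
  qed
  have TY: "x \<in> Y" if x: "x \<in> carrier_vec n" and ann: "\<And>c. c \<in> vec_annihilator n Y \<Longrightarrow> c \<bullet> x = 0" for x
  proof -
    \<comment> \<open>a \<open>\<kappa>\<close> vanishes at \<open>e\<close> too, so it also kills
      \<open>x\<close>. Thus \<open>\<kappa> \<bullet> x\<close> is y s, and subtracting s e from
      \<open>x\<close> makes \<open>\<kappa>\<close> vanish there. Every other functional is a
      multiple of \<open>\<kappa>\<close> plus one that kills \<open>e\<close>.\<close>
    have "a \<cdot>\<^sub>v \<kappa> \<in> vec_annihilator n Y"
      unfolding annY using vec_submoduleD(4)[OF K \<kappa>] \<kappa>c e exact_pair_mult[OF ey] by (simp add: y_def)
    then have "a * (\<kappa> \<bullet> x) = 0" using ann \<kappa>c x by (metis smult_scalar_prod_distrib)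
    then obtain s where s: "\<kappa> \<bullet> x = y * s" by (rule exact_pairE[OF ey])
    have se: "(- s) \<cdot>\<^sub>v e \<in> carrier_vec n" using e by simp
    have "x + (- s) \<cdot>\<^sub>v e \<in> Z"
    proof (rule T)
      show "x + (- s) \<cdot>\<^sub>v e \<in> carrier_vec n" using x e by simp
      fix c assume c: "c \<in> vec_annihilator n Z"
      note cc = vec_annihilatorD(1)[OF c]
      obtain r where r: "c \<bullet> e = y * r" using Ke[OF c] by (rule dvdE)
      have r\<kappa>: "(- r) \<cdot>\<^sub>v \<kappa> \<in> carrier_vec n" using \<kappa>c by simp
      have "c + (- r) \<cdot>\<^sub>v \<kappa> \<in> vec_annihilator n Y"
        unfolding annY
      proof
        show "c + (- r) \<cdot>\<^sub>v \<kappa> \<in> vec_annihilator n Z"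
          by (rule vec_submoduleD(3)[OF K c vec_submoduleD(4)[OF K \<kappa>]])
        show "(c + (- r) \<cdot>\<^sub>v \<kappa>) \<bullet> e = 0"
          unfolding add_scalar_prod_distrib[OF cc r\<kappa> e] smult_scalar_prod_distrib[OF \<kappa>c e] r y_def[symmetric]
          by (simp add: mult.commute)
      qed
      then have "(c + (- r) \<cdot>\<^sub>v \<kappa>) \<bullet> x = 0" by (rule ann)
      then have "c \<bullet> x = r * (y * s)"
        unfolding add_scalar_prod_distrib[OF cc r\<kappa> x] smult_scalar_prod_distrib[OF \<kappa>c x] s by simp
      then show "c \<bullet> (x + (- s) \<cdot>\<^sub>v e) = 0"
        unfolding scalar_prod_add_distrib[OF cc x se] scalar_prod_smult_distrib[OF cc e] r by (simp add: ac_simps)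
    qed
    from YI[OF this, of s] have "(x + (- s) \<cdot>\<^sub>v e) + s \<cdot>\<^sub>v e \<in> Y" .
    moreover have "(x + (- s) \<cdot>\<^sub>v e) + s \<cdot>\<^sub>v e = x" using x e by (intro eq_vecI) auto
    ultimately show ?thesis by simp
  qed
  have Ptc: "transpose_mat P *\<^sub>v e \<in> carrier_vec t" using P e by simp
  have "\<exists>s. (transpose_mat P *\<^sub>v e) $ j = y * s" if j: "j < t" for j
  proof -
    have u: "unit_vec t j \<in> carrier_vec t" by simp
    have "(P *\<^sub>v unit_vec t j) \<bullet> e = (transpose_mat P *\<^sub>v e) $ j"
      unfolding scalar_prod_mult_mat_vec[OF P u e] using Ptc j by simp
    moreover have "P *\<^sub>v unit_vec t j \<in> vec_annihilator n Z" unfolding imP by simp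
    ultimately show ?thesis using Ke by (metis dvdE)
  qed
  then obtain sf where sf: "\<And>j. j < t \<Longrightarrow> (transpose_mat P *\<^sub>v e) $ j = y * sf j" by metis
  define s where "s = vec t sf"
  have s: "s \<in> carrier_vec t" by (simp add: s_def)
  have "transpose_mat P *\<^sub>v e = y \<cdot>\<^sub>v s" using P sf by (intro eq_vecI) (simp_all add: s_def)
  then have Pve: "(P *\<^sub>v v) \<bullet> e = y * (s \<bullet> v)" if "v \<in> carrier_vec t" for v
    using scalar_prod_mult_mat_vec[OF P that e] that s by simp
  \<comment> \<open>Each generator of the annihilator of \<open>Z\<close> takes a multiple of
    \<open>y\<close> at \<open>e\<close>; \<open>P0\<close> subtracts the matching multiple of
    \<open>\<kappa>\<close>, so that all columns vanish at \<open>e\<close>.\<close>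
  define P0 where "P0 = mat n t (\<lambda>(r, j). P $$ (r, j) - s $ j * \<kappa> $ r)"
  have P0: "P0 \<in> carrier_mat n t" by (simp add: P0_def)
  have P0v: "P0 *\<^sub>v v = P *\<^sub>v v + (- (s \<bullet> v)) \<cdot>\<^sub>v \<kappa>" if v: "v \<in> carrier_vec t" for v
  proof (rule eq_vecI)
    fix r assume "r < dim_vec (P *\<^sub>v v + (- (s \<bullet> v)) \<cdot>\<^sub>v \<kappa>)"
    then have r: "r < n" using \<kappa>c by simp
    have "(P0 *\<^sub>v v) $ r = (\<Sum>j<t. (P $$ (r, j) - s $ j * \<kappa> $ r) * v $ j)"
      using r v by (simp add: P0_def scalar_prod_def lessThan_atLeast0)
    also have "\<dots> = (\<Sum>j<t. P $$ (r, j) * v $ j - (s $ j * v $ j) * \<kappa> $ r)"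
      by (intro sum.cong refl) (simp add: algebra_simps)
    also have "\<dots> = (\<Sum>j<t. P $$ (r, j) * v $ j) - (\<Sum>j<t. s $ j * v $ j) * \<kappa> $ r"
      by (simp only: sum_subtractf sum_distrib_right)
    finally show "(P0 *\<^sub>v v) $ r = (P *\<^sub>v v + (- (s \<bullet> v)) \<cdot>\<^sub>v \<kappa>) $ r"
      using r v P \<kappa>c by (simp add: scalar_prod_def lessThan_atLeast0)
  qed (use \<kappa>c in \<open>simp add: P0_def\<close>)
  have P0e: "(P0 *\<^sub>v v) \<bullet> e = 0" if v: "v \<in> carrier_vec t" for v
  proof -
    have "(- (s \<bullet> v)) \<cdot>\<^sub>v \<kappa> \<in> carrier_vec n" using \<kappa>c by simp
    then show ?thesis
      unfolding P0v[OF v] using Pve[OF v] ar(5)[OF v] e \<kappa>c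
      by (simp add: add_scalar_prod_distrib y_def mult.commute)
  qed
  have a\<kappa>: "a \<cdot>\<^sub>v \<kappa> \<in> carrier_vec n" using \<kappa>c by simp
  have a\<kappa>e: "(a \<cdot>\<^sub>v \<kappa>) \<bullet> e = 0" using \<kappa>c e exact_pair_mult[OF ey] by (simp add: y_def)
  \<comment> \<open>A combination of the old generators vanishes at \<open>e\<close> only if its
    \<open>\<kappa>\<close>-coefficient lies in (a), whence the single additional generator a
    \<open>\<kappa>\<close>.\<close>
  define P1 where "P1 = append_col P0 (a \<cdot>\<^sub>v \<kappa>)"
  have P1: "P1 \<in> carrier_mat n (Suc t)" unfolding P1_def by (rule append_col_carrier[OF P0])
  have P1v: "P1 *\<^sub>v v = P0 *\<^sub>v vec_first v t + v $ t \<cdot>\<^sub>v (a \<cdot>\<^sub>v \<kappa>)" if "v \<in> carrier_vec (Suc t)" for v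
    unfolding P1_def by (rule append_col_mult[OF P0 a\<kappa> that])
  have P1e: "(P1 *\<^sub>v v) \<bullet> e = 0" if v: "v \<in> carrier_vec (Suc t)" for v
  proof -
    have c: "P0 *\<^sub>v vec_first v t \<in> carrier_vec n" "v $ t \<cdot>\<^sub>v (a \<cdot>\<^sub>v \<kappa>) \<in> carrier_vec n"
      using mult_mat_vec_carrier[OF P0] a\<kappa> by simp_all
    have "vec_first v t \<in> carrier_vec t" by simp
    then show ?thesis
      unfolding P1v[OF v] add_scalar_prod_distrib[OF c e] smult_scalar_prod_distrib[OF a\<kappa> e] a\<kappa>e
      by (simp add: P0e)
  qed
  have P0K: "P0 *\<^sub>v v \<in> vec_annihilator n Z" if v: "v \<in> carrier_vec t" for v
  proof -
    have "P *\<^sub>v v \<in> vec_annihilator n Z" unfolding imP using v by simp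
    then show ?thesis unfolding P0v[OF v] by (rule vec_submoduleD(3)[OF K _ vec_submoduleD(4)[OF K \<kappa>]])
  qed
  have P1K: "P1 *\<^sub>v v \<in> vec_annihilator n Z" if v: "v \<in> carrier_vec (Suc t)" for v
    unfolding P1v[OF v]
    by (rule vec_submoduleD(3)[OF K P0K vec_submoduleD(4)[OF K vec_submoduleD(4)[OF K \<kappa>]]]) simp
  have imP1: "vec_annihilator n Y = (\<lambda>v. P1 *\<^sub>v v) ` carrier_vec (Suc t)"
  proof (intro equalityI subsetI)
    fix c assume "c \<in> vec_annihilator n Y"
    then have c: "c \<in> vec_annihilator n Z" "c \<bullet> e = 0" unfolding annY by simp_all
    obtain v where v: "v \<in> carrier_vec t" "c = P *\<^sub>v v" using c(1) unfolding imP by auto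
    have "y * (s \<bullet> v) = 0" using Pve[OF v(1)] c(2) v(2) by simp
    then obtain \<mu> where \<mu>: "s \<bullet> v = a * \<mu>" by (rule exact_pairE[OF exact_pair_sym[OF ey]])
    define v1 where "v1 = vec (Suc t) (\<lambda>j. if j < t then v $ j else \<mu>)"
    have v1: "v1 \<in> carrier_vec (Suc t)" "v1 $ t = \<mu>" "vec_first v1 t = v"
      using v(1) by (auto simp: v1_def vec_first_def intro!: eq_vecI)
    have "P1 *\<^sub>v v1 = c"
      unfolding P1v[OF v1(1)] v1(2,3) P0v[OF v(1)] v(2) \<mu> by (rule vec_cancel(1)[OF ar(5)[OF v(1)] \<kappa>c])
    then show "c \<in> (\<lambda>v. P1 *\<^sub>v v) ` carrier_vec (Suc t)" using v1(1) by (metis imageI)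
  next
    fix c assume "c \<in> (\<lambda>v. P1 *\<^sub>v v) ` carrier_vec (Suc t)"
    then show "c \<in> vec_annihilator n Y" unfolding annY using P1K P1e by auto
  qed
  \<comment> \<open>Adding \<open>\<kappa>\<close> back recovers the annihilator of
    \<open>Z\<close>, for which the Ext condition is known. It is transferred to these generators,
    and then \<open>\<kappa>\<close> is dropped.\<close>
  define Q where "Q = append_col P1 \<kappa>"
  have Q: "Q \<in> carrier_mat n (Suc (Suc t))" unfolding Q_def by (rule append_col_carrier[OF P1])
  have Qv: "Q *\<^sub>v v = P1 *\<^sub>v vec_first v (Suc t) + v $ Suc t \<cdot>\<^sub>v \<kappa>" if "v \<in> carrier_vec (Suc (Suc t))" for v
    unfolding Q_def by (rule append_col_mult[OF P1 \<kappa>c that])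
  have "(\<lambda>v. P *\<^sub>v v) ` carrier_vec t = (\<lambda>v. Q *\<^sub>v v) ` carrier_vec (Suc (Suc t))"
  proof (intro equalityI subsetI)
    fix c assume "c \<in> (\<lambda>v. P *\<^sub>v v) ` carrier_vec t"
    then obtain v where v: "v \<in> carrier_vec t" "c = P *\<^sub>v v" by auto
    define v1 where "v1 = vec (Suc t) (\<lambda>j. if j < t then v $ j else 0)"
    have v1: "v1 \<in> carrier_vec (Suc t)" "v1 $ t = 0" "vec_first v1 t = v"
      using v(1) by (auto simp: v1_def vec_first_def intro!: eq_vecI)
    define v2 where "v2 = vec (Suc (Suc t)) (\<lambda>j. if j < Suc t then v1 $ j else s \<bullet> v)"
    have v2: "v2 \<in> carrier_vec (Suc (Suc t))" "v2 $ Suc t = s \<bullet> v" "vec_first v2 (Suc t) = v1"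
      using v1(1) by (auto simp: v2_def vec_first_def intro!: eq_vecI)
    have "Q *\<^sub>v v2 = c"
      unfolding Qv[OF v2(1)] v2(2,3) P1v[OF v1(1)] v1(2,3) P0v[OF v(1)] v(2)
      by (rule vec_cancel(2)[OF ar(5)[OF v(1)] \<kappa>c])
    then show "c \<in> (\<lambda>v. Q *\<^sub>v v) ` carrier_vec (Suc (Suc t))" using v2(1) by (metis imageI)
  next
    fix c assume "c \<in> (\<lambda>v. Q *\<^sub>v v) ` carrier_vec (Suc (Suc t))"
    then obtain v where v: "v \<in> carrier_vec (Suc (Suc t))" "c = Q *\<^sub>v v" by auto
    have "c \<in> vec_annihilator n Z"
      unfolding v(2) Qv[OF v(1)] by (rule vec_submoduleD(3)[OF K P1K vec_submoduleD(4)[OF K \<kappa>]]) simp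
    then show "c \<in> (\<lambda>v. P *\<^sub>v v) ` carrier_vec t" unfolding imP .
  qed
  then have E2Q: "functionals_extend (Suc (Suc t)) (mat_kernel (append_col P1 \<kappa>))"
    using functionals_extend_mat_kernel_transfer[OF P Q _ E2] by (simp only: Q_def)
  have "functionals_extend (Suc t) (mat_kernel P1)"
  proof (rule functionals_extend_drop_col[OF P1 \<kappa>c e ay P1e _ _ E2Q])
    show "unit_vec (Suc t) t \<in> carrier_vec (Suc t)" by simp
    have "vec_first (unit_vec (Suc t) t) t = (0\<^sub>v t :: 'a vec)" by (rule eq_vecI) (auto simp: vec_first_def)
    then show "P1 *\<^sub>v unit_vec (Suc t) t = a \<cdot>\<^sub>v \<kappa>"
      using P1v[of "unit_vec (Suc t) t"] mult_mat_vec_add_smult(4)[OF P0] a\<kappa> by simp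
  qed
  then show ?thesis
    unfolding ext_torsionless_def Y_def[symmetric] using Y E1Y TY P1 imP1 by metis
qed

section \<open>Diagonal entries of a presentation of a totally reflexive module\<close>

context ezd_cube_zero_local_ring
begin

text \<open>One step of the converse; \<open>coord\<close> is what minimality of the presentation
  will provide. Extension from \<open>Z\<close> puts \<open>W\<close> inside (a). Torsionlessness
  and extension from \<open>Z\<close> give \<open>\<kappa>\<close> with \<open>\<kappa> $ i\<close>
  outside \<open>W\<close>. Extension from the kernel of \<open>P\<close> puts \<open>W\<close>
  inside y \<open>\<mm>\<close> for y = \<open>\<kappa> $ i\<close>.\<close>

lemma exact_pair_from_ext_torsionless:
  assumes H: "ext_torsionless n Z" and i: "i < n" and Zm: "\<And>x. x \<in> Z \<Longrightarrow> x $ i \<in> \<mm>"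
    and a: "a \<in> \<mm>" and ae: "a \<cdot>\<^sub>v unit_vec n i \<in> Z"
    and coord: "\<And>w. w \<in> W \<Longrightarrow> \<exists>f. linear_on Z f \<and> f (a \<cdot>\<^sub>v unit_vec n i) = w"
  obtains \<kappa> where "\<kappa> \<in> vec_annihilator n Z" "exact_pair a (\<kappa> $ i)"
proof -
  have Z: "vec_submodule n Z" and E1: "functionals_extend n Z"
    and T: "\<And>x. x \<in> carrier_vec n \<Longrightarrow> (\<And>c. c \<in> vec_annihilator n Z \<Longrightarrow> c \<bullet> x = 0) \<Longrightarrow> x \<in> Z"
    using H unfolding ext_torsionless_def by auto
  obtain t P where P: "P \<in> carrier_mat n t" and imP: "vec_annihilator n Z = (\<lambda>v. P *\<^sub>v v) ` carrier_vec t"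
    and E2: "functionals_extend t (mat_kernel P)"
    using H unfolding ext_torsionless_def by (elim conjE exE)
  note Zc = vec_submoduleD(1)[OF Z] and ar = mult_mat_vec_add_smult[OF P]
  define e where "e = (unit_vec n i :: 'a vec)"
  have e: "e \<in> carrier_vec n" by (simp add: e_def)
  have dot: "c \<bullet> (r \<cdot>\<^sub>v e) = r * c $ i" if "c \<in> carrier_vec n" for c r
    using that i by (simp add: e_def)
  have edot: "(r \<cdot>\<^sub>v e) \<bullet> x = r * x $ i" if "x \<in> carrier_vec n" for x r
    using that i by (simp add: e_def)
  have ae': "a \<cdot>\<^sub>v e \<in> Z" using ae by (simp only: e_def)
  obtain \<phi> where \<phi>: "\<And>x y. x \<in> \<mm> \<Longrightarrow> y \<in> \<mm> \<Longrightarrow> \<phi> (x + y) = \<phi> x + \<phi> y"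
    "\<And>r x. x \<in> \<mm> \<Longrightarrow> \<phi> (r * x) = r * \<phi> x"
    "\<And>c. \<exists>x\<in>\<mm>. \<phi> x \<noteq> c * x" by (rule nonscalar_functionalE) (rule that)
  \<comment> \<open>The functional with value \<open>w\<close> at a e is represented by a vector, so
    \<open>w\<close> is a multiple of \<open>a\<close>.\<close>
  have adv: "\<exists>s. w = a * s" if w: "w \<in> W" for w
  proof -
    obtain f where f: "linear_on Z f" "f (a \<cdot>\<^sub>v e) = w" using coord[OF w] unfolding e_def by (elim exE conjE)
    obtain h where h: "h \<in> carrier_vec n" "\<And>x. x \<in> Z \<Longrightarrow> f x = h \<bullet> x"
      by (rule functionals_extendE[OF E1 f(1)]) (rule that)
    have "w = a * h $ i" using f(2) h(2)[OF ae'] dot[OF h(1)] by simp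
    then show ?thesis ..
  qed
  have aW: "a \<notin> W"
  proof
    assume "a \<in> W"
    then obtain w where "w \<in> W" "\<not> a dvd w" using W_not_principal by metis
    then show False using adv by (metis dvd_triv_left)
  qed
  have aWm: "\<exists>x\<in>\<mm>. w = a * x" if w: "w \<in> W" for w
  proof -
    obtain s where s: "w = a * s" using adv[OF w] by (elim exE)
    have "s \<in> \<mm>" using unit_mult_in_W[of s a] w aW s by (metis mult.commute)
    then show ?thesis using s by metis
  qed
  obtain y0 where y0: "y0 \<in> \<mm>" "y0 \<notin> W" "a * y0 = 0"
    "\<And>x. x \<in> \<mm> \<Longrightarrow> a * x = 0 \<Longrightarrow> \<exists>t. x - t * y0 \<in> W"
    by (rule annihilator_of_surjective_multiplication[OF a aWm]) (assumption, rule that)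
  have nz: "a \<noteq> 0" using aW W_closed(1) by metis
  have annm: "x \<in> \<mm>" if "a * x = 0" for x
  proof (rule ccontr)
    assume "x \<notin> \<mm>"
    then obtain u where "u * x = 1" by (rule unitE)
    then have "a = u * (a * x)" by (metis mult.left_commute mult_1_right)
    then show False using that nz by simp
  qed
  have "\<exists>\<kappa>\<in>vec_annihilator n Z. \<kappa> $ i \<notin> W"
  proof (rule ccontr)
    assume no: "\<not> ?thesis"
    \<comment> \<open>If all annihilating vectors had coordinate \<open>i\<close> in
      \<open>W\<close>, the multiples of \<open>e\<close> by \<open>\<mm>\<close> would lie in
      \<open>Z\<close> by torsionlessness. Then \<open>\<phi>\<close> of coordinate \<open>i\<close>
      would extend to the free module, making \<open>\<phi>\<close> scalar.\<close>
    have xe: "x \<cdot>\<^sub>v e \<in> Z" if x: "x \<in> \<mm>" for x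
    proof (rule T)
      show "x \<cdot>\<^sub>v e \<in> carrier_vec n" using e by simp
      fix c assume c: "c \<in> vec_annihilator n Z"
      then have "c $ i \<in> W" using no by metis
      then show "c \<bullet> (x \<cdot>\<^sub>v e) = 0" using dot[OF vec_annihilatorD(1)[OF c]] m_mult_W[OF x] by simp
    qed
    have "linear_on Z (\<lambda>v. \<phi> (v $ i))"
    proof (rule linear_onI)
      show "\<phi> ((v + w) $ i) = \<phi> (v $ i) + \<phi> (w $ i)" if "v \<in> Z" "w \<in> Z" for v w
        using \<phi>(1)[OF Zm[OF that(1)] Zm[OF that(2)]] carrier_vecD[OF Zc[OF that(2)]] i by simp
      show "\<phi> ((r \<cdot>\<^sub>v v) $ i) = r * \<phi> (v $ i)" if "v \<in> Z" for r v
        using \<phi>(2)[OF Zm[OF that]] carrier_vecD[OF Zc[OF that]] i by simp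
    qed
    then obtain h where h: "h \<in> carrier_vec n" "\<And>v. v \<in> Z \<Longrightarrow> \<phi> (v $ i) = h \<bullet> v"
      by (rule functionals_extendE[OF E1]) (rule that)
    have "\<phi> x = h $ i * x" if x: "x \<in> \<mm>" for x
    proof -
      have "(x \<cdot>\<^sub>v e) $ i = x" using i by (simp add: e_def)
      then show ?thesis using h(2)[OF xe[OF x]] dot[OF h(1)] by (simp add: mult.commute)
    qed
    then show False using \<phi>(3) by metis
  qed
  then obtain \<kappa> where \<kappa>: "\<kappa> \<in> vec_annihilator n Z" "\<kappa> $ i \<notin> W" by (elim bexE)
  define y where "y = \<kappa> $ i"
  have Kann: "a * c $ i = 0" if c: "c \<in> vec_annihilator n Z" for c
    using vec_annihilatorD(2)[OF c ae'] dot[OF vec_annihilatorD(1)[OF c]] by simp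
  have ay: "a * y = 0" unfolding y_def by (rule Kann[OF \<kappa>(1)])
  have ym: "y \<in> \<mm>" by (rule annm[OF ay])
  \<comment> \<open>\<open>y\<close> can replace \<open>y0\<close>: as it is not in
    \<open>W\<close>, it also spans the annihilator of \<open>a\<close> modulo
    \<open>W\<close>.\<close>
  have gen: "\<exists>t. x - t * y \<in> W" if ax: "a * x = 0" for x
  proof -
    obtain t where t: "y - t * y0 \<in> W" using y0(4)[OF ym ay] by (elim exE)
    have "t \<notin> \<mm>"
    proof
      assume "t \<in> \<mm>"
      then have "(y - t * y0) + t * y0 \<in> W" by (intro W_closed(2) t mult_in_W y0(1))
      then show False using \<kappa>(2) by (simp add: y_def)
    qed
    then obtain u where u: "u * t = 1" by (rule unitE)
    obtain s where s: "x - s * y0 \<in> W" using y0(4)[OF annm[OF ax] ax] by (elim exE)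
    have "(x - s * y0) - (s * u) * (y - t * y0) = x - (s * u) * y + (s * (u * t) * y0 - s * y0)"
      by (simp add: algebra_simps)
    also have "\<dots> = x - (s * u) * y" unfolding u by simp
    finally have "x - (s * u) * y \<in> W" using W_closed(3)[OF s W_mult(1)[OF t, of "s * u"]] by (simp only:)
    then show ?thesis ..
  qed
  have yWm: "\<exists>x\<in>\<mm>. w = y * x" if w: "w \<in> W" for w
  proof (rule ccontr)
    assume no: "\<not> ?thesis"
    define S where "S = (\<lambda>x. y * x) ` \<mm>"
    \<comment> \<open>Every element of \<open>U\<close> is a multiple of \<open>y\<close> modulo
      \<open>W\<close>, and \<open>\<mm>\<close> kills \<open>W\<close>. So \<open>\<mm>\<close>
      maps \<open>U\<close> into \<open>S\<close>, and U/S is a vector space in which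
      \<open>w\<close> is nonzero.\<close>
    define U where "U = {x. a * x = 0}"
    have S: "ideal S (class_ring :: 'a ring)"
    proof (rule ideal_class_ringI)
      have "y * 0 \<in> S" unfolding S_def by (rule imageI) (rule m_closed(1))
      then show "0 \<in> S" by simp
      show "p + q \<in> S" if "p \<in> S" "q \<in> S" for p q
      proof -
        obtain x z where xz: "p = y * x" "x \<in> \<mm>" "q = y * z" "z \<in> \<mm>" using \<open>p \<in> S\<close> \<open>q \<in> S\<close> unfolding S_def by auto
        have "y * (x + z) \<in> S" unfolding S_def by (rule imageI) (rule m_closed(2)[OF xz(2,4)])
        then show ?thesis unfolding xz(1,3) by (simp only: distrib_left)
      qed
      show "r * p \<in> S" if "p \<in> S" for r p
      proof -
        obtain x where x: "p = y * x" "x \<in> \<mm>" using \<open>p \<in> S\<close> unfolding S_def by auto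
        have "y * (r * x) \<in> S" unfolding S_def by (rule imageI) (rule m_mult(1)[OF x(2)])
        then show ?thesis unfolding x(1) by (simp only: mult.left_commute)
      qed
    qed
    have U: "ideal U (class_ring :: 'a ring)"
    proof (rule ideal_class_ringI)
      show "r * x \<in> U" if "x \<in> U" for r x
        using that unfolding U_def mem_Collect_eq by (metis mult.left_commute mult_zero_right)
    qed (simp_all add: U_def distrib_left)
    have SU: "S \<subseteq> U"
    proof
      fix p assume "p \<in> S"
      then obtain x where "p = y * x" unfolding S_def by auto
      then have "a * p = (a * y) * x" by (simp add: mult.assoc)
      then show "p \<in> U" unfolding U_def using ay by simp
    qed
    have mU: "x * u \<in> S" if x: "x \<in> \<mm>" and u: "u \<in> U" for x u
    proof -
      have "a * u = 0" using u by (simp add: U_def)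
      then obtain t where t: "u - t * y \<in> W" using gen by metis
      have "x * u = y * (x * t) + x * (u - t * y)" by (simp add: algebra_simps)
      then have "x * u = y * (x * t)" using m_mult_W[OF x t] by simp
      moreover have "y * (x * t) \<in> S" unfolding S_def by (rule imageI) (rule m_mult(2)[OF x])
      ultimately show ?thesis by simp
    qed
    have wU: "w \<in> U" using m_mult_W[OF a w] by (simp add: U_def)
    have wS: "w \<notin> S" using no unfolding S_def by auto
    obtain H where H: "ideal H (class_ring :: 'a ring)" "S \<subseteq> H" "w \<notin> H"
      "\<And>x. x \<in> U \<Longrightarrow> \<exists>t. x - t * w \<in> H"
      by (rule hyperplane_ideal[OF S U SU mU wU wS]) (assumption | rule that)+
    have "\<exists>s. P $$ (i, j) - s * w \<in> H" if j: "j < t" for j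
    proof (rule H(4))
      have "P *\<^sub>v unit_vec t j \<in> vec_annihilator n Z" unfolding imP by simp
      from Kann[OF this] have "a * (P *\<^sub>v unit_vec t j) $ i = 0" .
      moreover have "(P *\<^sub>v unit_vec t j) $ i = P $$ (i, j)" using P i j by simp
      ultimately show "P $$ (i, j) \<in> U" by (simp add: U_def)
    qed
    then obtain \<theta> where \<theta>: "\<And>j. j < t \<Longrightarrow> P $$ (i, j) - \<theta> j * w \<in> H" by metis
    \<comment> \<open>\<open>\<Theta>\<close> is a linear form on coefficient vectors: it gives the
      \<open>w\<close>-component, modulo \<open>H\<close>, of coordinate \<open>i\<close> of the
      functional that \<open>P\<close> produces. On relations it takes values in
      \<open>\<mm>\<close>, so \<open>\<phi>\<close> can be applied to it.\<close>
    define \<Theta> where "\<Theta> = vec t \<theta>"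
    have \<Theta>: "\<Theta> \<in> carrier_vec t" by (simp add: \<Theta>_def)
    have Pi: "(P *\<^sub>v z) $ i - (\<Theta> \<bullet> z) * w \<in> H" if z: "z \<in> carrier_vec t" for z
    proof -
      have "(P *\<^sub>v z) $ i = (\<Sum>j<t. P $$ (i, j) * z $ j)"
        using P i z by (simp add: scalar_prod_def lessThan_atLeast0)
      moreover have "\<Theta> \<bullet> z = (\<Sum>j<t. \<theta> j * z $ j)"
        using z by (simp add: \<Theta>_def scalar_prod_def lessThan_atLeast0)
      ultimately have "(P *\<^sub>v z) $ i - (\<Theta> \<bullet> z) * w = (\<Sum>j<t. P $$ (i, j) * z $ j - \<theta> j * z $ j * w)"
        by (simp only: sum_subtractf sum_distrib_right)
      also have "\<dots> = (\<Sum>j<t. z $ j * (P $$ (i, j) - \<theta> j * w))"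
        by (intro sum.cong refl) (simp add: algebra_simps)
      also have "\<dots> \<in> H" by (rule ideal_sum[OF H(1)]) (rule ideal_mult[OF H(1) \<theta>], simp)
      finally show ?thesis .
    qed
    have wH: "r \<in> \<mm>" if "r * w \<in> H" for r
    proof (rule ccontr)
      assume "r \<notin> \<mm>"
      then obtain u where "u * r = 1" by (rule unitE)
      then have "w = u * (r * w)" by (simp add: mult.assoc[symmetric])
      then show False using ideal_mult[OF H(1) that, of u] H(3) by simp
    qed
    have \<Theta>m: "\<Theta> \<bullet> z \<in> \<mm>" if z: "z \<in> mat_kernel P" for z
    proof (rule wH)
      have zc: "z \<in> carrier_vec t" and Pz: "P *\<^sub>v z = 0\<^sub>v n" using z unfolding mat_kernel_iff[OF P] by simp_all
      have "- ((\<Theta> \<bullet> z) * w) \<in> H" using Pi[OF zc] Pz i by simp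
      from ideal_mult[OF H(1) this, of "- 1"] show "(\<Theta> \<bullet> z) * w \<in> H" by simp
    qed
    note sk = vec_submodule_mat_kernel[OF P]
    have "linear_on (mat_kernel P) (\<lambda>z. \<phi> (\<Theta> \<bullet> z))"
    proof (rule linear_onI)
      show "\<phi> (\<Theta> \<bullet> (x + z)) = \<phi> (\<Theta> \<bullet> x) + \<phi> (\<Theta> \<bullet> z)" if "x \<in> mat_kernel P" "z \<in> mat_kernel P" for x z
        unfolding scalar_prod_add_distrib[OF \<Theta> vec_submoduleD(1)[OF sk that(1)] vec_submoduleD(1)[OF sk that(2)]]
        by (rule \<phi>(1)[OF \<Theta>m[OF that(1)] \<Theta>m[OF that(2)]])
      show "\<phi> (\<Theta> \<bullet> (r \<cdot>\<^sub>v z)) = r * \<phi> (\<Theta> \<bullet> z)" if "z \<in> mat_kernel P" for r z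
        unfolding scalar_prod_smult_distrib[OF \<Theta> vec_submoduleD(1)[OF sk that]]
        by (rule \<phi>(2)[OF \<Theta>m[OF that]])
    qed
    then obtain h where h: "h \<in> carrier_vec t" "\<And>z. z \<in> mat_kernel P \<Longrightarrow> \<phi> (\<Theta> \<bullet> z) = h \<bullet> z"
      by (rule functionals_extendE[OF E2]) (rule that)
    \<comment> \<open>On a preimage \<open>z0\<close> of w e the form \<open>\<Theta>\<close> is 1
      modulo \<open>\<mm>\<close>, hence a unit \<open>u\<close>. For s in \<open>\<mm>\<close> the
      vector s z0 is a relation, and the extension gives
      \<open>\<phi> (s * u) = s * (h \<bullet> z0)\<close>, which makes \<open>\<phi>\<close>
      scalar.\<close>
    have "w \<cdot>\<^sub>v e \<in> vec_annihilator n Z"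
    proof (rule vec_annihilatorI)
      show "w \<cdot>\<^sub>v e \<in> carrier_vec n" using e by simp
      show "(w \<cdot>\<^sub>v e) \<bullet> x = 0" if x: "x \<in> Z" for x
        using edot[OF Zc[OF x]] m_mult_W[OF Zm[OF x] w] by (simp add: mult.commute)
    qed
    then obtain z0 where z0: "z0 \<in> carrier_vec t" "P *\<^sub>v z0 = w \<cdot>\<^sub>v e" unfolding imP by auto
    define u where "u = \<Theta> \<bullet> z0"
    have "(P *\<^sub>v z0) $ i = w" unfolding z0(2) using i by (simp add: e_def)
    then have wu: "w - u * w \<in> H" using Pi[OF z0(1)] by (simp add: u_def)
    have "u \<notin> \<mm>"
    proof
      assume "u \<in> \<mm>"
      then have "w \<in> H" using wu m_mult_W[OF _ w] by simp
      with H(3) show False ..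
    qed
    then obtain v where v: "v * u = 1" by (rule unitE)
    have sz: "\<phi> (s * u) = s * (h \<bullet> z0)" if s: "s \<in> \<mm>" for s
    proof -
      have "P *\<^sub>v (s \<cdot>\<^sub>v z0) = s \<cdot>\<^sub>v (w \<cdot>\<^sub>v e)" unfolding z0(2)[symmetric] by (rule ar(2)[OF z0(1)])
      also have "\<dots> = 0\<^sub>v n" using m_mult_W[OF s w] e by (intro eq_vecI) (simp_all add: mult.assoc[symmetric])
      finally have "s \<cdot>\<^sub>v z0 \<in> mat_kernel P" unfolding mat_kernel_iff[OF P] using z0(1) by simp
      from h(2)[OF this] show ?thesis
        unfolding scalar_prod_smult_distrib[OF \<Theta> z0(1)] scalar_prod_smult_distrib[OF h(1) z0(1)] u_def .
    qed
    have "\<phi> x = (v * (h \<bullet> z0)) * x" if x: "x \<in> \<mm>" for x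
    proof -
      have "x = (x * v) * u" using v by (simp add: mult.assoc)
      then have "\<phi> x = \<phi> ((x * v) * u)" by simp
      also have "\<dots> = (x * v) * (h \<bullet> z0)" by (rule sz[OF m_mult(2)[OF x]])
      finally show ?thesis by (simp add: ac_simps)
    qed
    then show False using \<phi>(3) by metis
  qed
  have "exact_pair a y" by (rule exact_pairI[OF a ym ay aWm yWm])
  then show ?thesis using that[OF \<kappa>(1)] by (simp only: y_def)
qed

lemma diagonal_exact_pair:
  assumes A: "A \<in> carrier_mat n n" and tri: "upper_triangular A"
    and Am: "\<And>i j. i < n \<Longrightarrow> j < n \<Longrightarrow> A $$ (i, j) \<in> \<mm>"
    and ker: "\<And>v j. v \<in> carrier_vec n \<Longrightarrow> A *\<^sub>v v = 0\<^sub>v n \<Longrightarrow> j < n \<Longrightarrow> v $ j \<in> \<mm>"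
    and H: "ext_torsionless n ((\<lambda>v. A *\<^sub>v v) ` carrier_vec n)"
    and i: "i < n"
  shows "\<exists>b. exact_pair (A $$ (i, i)) b"
proof -
  note ar = mult_mat_vec_add_smult[OF A]
  \<comment> \<open>Agreement with an image vector from coordinate \<open>k\<close> on is another
    form of im A + <e_0, ..., e_(k-1)>.\<close>
  define Z where "Z k = {x \<in> carrier_vec n. \<exists>v\<in>carrier_vec n. \<forall>l. k \<le> l \<longrightarrow> l < n \<longrightarrow> x $ l = (A *\<^sub>v v) $ l}" for k
  have ZI: "x \<in> Z k" if "x \<in> carrier_vec n" "v \<in> carrier_vec n" "\<And>l. k \<le> l \<Longrightarrow> l < n \<Longrightarrow> x $ l = (A *\<^sub>v v) $ l" for x v k
    unfolding Z_def using that by auto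
  have ZE: "\<exists>v. v \<in> carrier_vec n \<and> (\<forall>l. k \<le> l \<longrightarrow> l < n \<longrightarrow> x $ l = (A *\<^sub>v v) $ l)" if "x \<in> Z k" for x k
    using that unfolding Z_def by auto
  have Zc: "x \<in> carrier_vec n" if "x \<in> Z k" for x k using that unfolding Z_def by simp
  have Avl: "(A *\<^sub>v v) $ l \<in> \<mm>" if "v \<in> carrier_vec n" "l < n" for v l
  proof -
    have "(A *\<^sub>v v) $ l = (\<Sum>j<n. A $$ (l, j) * v $ j)"
      using A that by (simp add: scalar_prod_def lessThan_atLeast0)
    also have "\<dots> \<in> \<mm>" by (rule ideal_sum[OF ideal_m]) (rule m_mult(2)[OF Am], use that in simp_all)
    finally show ?thesis .
  qed
  have Acol: "(A *\<^sub>v unit_vec n j) $ l = A $$ (l, j)" if "j < n" "l < n" for j l using A that by simp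
  have Alow: "A $$ (l, j) = 0" if "j < l" "l < n" for l j using tri A that by (simp add: upper_triangular_def)
  \<comment> \<open>The kernel condition in the form passed along the induction: only rows from
    \<open>k\<close> on count. By triangularity the coordinates before \<open>k\<close> have no
    influence on those rows.\<close>
  define minimal where "minimal k \<longleftrightarrow> (\<forall>v\<in>carrier_vec n. (\<forall>l. k \<le> l \<longrightarrow> l < n \<longrightarrow> (A *\<^sub>v v) $ l = 0) \<longrightarrow>
      (\<forall>j. k \<le> j \<longrightarrow> j < n \<longrightarrow> v $ j \<in> \<mm>))" for k
  have minimalD: "v $ j \<in> \<mm>"
    if "minimal k" "v \<in> carrier_vec n" "\<And>l. k \<le> l \<Longrightarrow> l < n \<Longrightarrow> (A *\<^sub>v v) $ l = 0" "k \<le> j" "j < n" for k v j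
    using that unfolding minimal_def by metis
  have ZSuc: "Z (Suc k) = {x + r \<cdot>\<^sub>v unit_vec n k | x r. x \<in> Z k}" if k: "k < n" for k
  proof (intro equalityI subsetI)
    fix x assume x: "x \<in> Z (Suc k)"
    obtain v where v: "v \<in> carrier_vec n" "\<forall>l. Suc k \<le> l \<longrightarrow> l < n \<longrightarrow> x $ l = (A *\<^sub>v v) $ l"
      using ZE[OF x] by (elim exE conjE)
    define x' where "x' = vec n (\<lambda>l. if l = k then (A *\<^sub>v v) $ k else x $ l)"
    have "x' \<in> Z k"
    proof (rule ZI[OF _ v(1)])
      show "x' $ l = (A *\<^sub>v v) $ l" if "k \<le> l" "l < n" for l
        using v(2) that by (cases "l = k") (simp_all add: x'_def)
    qed (simp add: x'_def)
    moreover have "x = x' + (x $ k - (A *\<^sub>v v) $ k) \<cdot>\<^sub>v unit_vec n k"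
      using Zc[OF x] k by (intro eq_vecI) (auto simp: x'_def)
    ultimately show "x \<in> {x + r \<cdot>\<^sub>v unit_vec n k | x r. x \<in> Z k}" by blast
  next
    fix z assume "z \<in> {x + r \<cdot>\<^sub>v unit_vec n k | x r. x \<in> Z k}"
    then obtain x r where x: "z = x + r \<cdot>\<^sub>v unit_vec n k" "x \<in> Z k" by auto
    obtain v where v: "v \<in> carrier_vec n" "\<forall>l. k \<le> l \<longrightarrow> l < n \<longrightarrow> x $ l = (A *\<^sub>v v) $ l"
      using ZE[OF x(2)] by (elim exE conjE)
    show "z \<in> Z (Suc k)"
    proof (rule ZI[OF _ v(1)])
      show "z \<in> carrier_vec n" unfolding x(1) using Zc[OF x(2)] by simp
      show "z $ l = (A *\<^sub>v v) $ l" if "Suc k \<le> l" "l < n" for l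
        using v(2) that Zc[OF x(2)] k unfolding x(1) by simp
    qed
  qed
  have step: "\<exists>b. exact_pair (A $$ (k, k)) b \<and> ext_torsionless n (Z (Suc k)) \<and> minimal (Suc k)"
    if k: "k < n" and Hk: "ext_torsionless n (Z k)" and mink: "minimal k" for k
  proof -
    have Zk: "vec_submodule n (Z k)" using Hk unfolding ext_torsionless_def by simp
    define a where "a = A $$ (k, k)"
    have am: "a \<in> \<mm>" unfolding a_def by (rule Am[OF k k])
    have ae: "a \<cdot>\<^sub>v unit_vec n k \<in> Z k"
    proof (rule ZI[where v = "unit_vec n k"])
      show "(a \<cdot>\<^sub>v unit_vec n k) $ l = (A *\<^sub>v unit_vec n k) $ l" if l: "k \<le> l" "l < n" for l
        using l Alow[of k l] Acol[OF k l(2)] by (cases "l = k") (simp_all add: a_def)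
    qed simp_all
    \<comment> \<open>Coordinate \<open>k\<close> of a preimage is unique modulo
      \<open>\<mm>\<close> by \<open>minimal\<close>, so its product with \<open>w\<close> is well
      defined and linear. This is the functional with value \<open>w\<close> at a e_k.\<close>
    define pre where "pre x = (SOME v. v \<in> carrier_vec n \<and> (\<forall>l. k \<le> l \<longrightarrow> l < n \<longrightarrow> x $ l = (A *\<^sub>v v) $ l))" for x
    have pre: "pre x \<in> carrier_vec n \<and> (\<forall>l. k \<le> l \<longrightarrow> l < n \<longrightarrow> x $ l = (A *\<^sub>v pre x) $ l)" if "x \<in> Z k" for x
      unfolding pre_def by (rule someI_ex[OF ZE[OF that]])
    have pre_eq: "pre x $ k - v $ k \<in> \<mm>"
      if x: "x \<in> Z k" and v: "v \<in> carrier_vec n" "\<And>l. k \<le> l \<Longrightarrow> l < n \<Longrightarrow> x $ l = (A *\<^sub>v v) $ l" for x v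
    proof -
      have p: "pre x \<in> carrier_vec n" using pre[OF x] by simp
      have "(pre x - v) $ k \<in> \<mm>"
      proof (rule minimalD[OF mink])
        show "(A *\<^sub>v (pre x - v)) $ l = 0" if l: "k \<le> l" "l < n" for l
        proof -
          have "(A *\<^sub>v pre x) $ l = (A *\<^sub>v v) $ l" using pre[OF x] v(2)[OF l] l by simp
          then show ?thesis unfolding ar(3)[OF p v(1)] using l(2) carrier_vecD[OF ar(5)[OF v(1)]] by simp
        qed
      qed (use p v k in simp_all)
      then show ?thesis using k v(1) by simp
    qed
    have coord: "\<exists>f. linear_on (Z k) f \<and> f (a \<cdot>\<^sub>v unit_vec n k) = w" if w: "w \<in> W" for w
    proof -
      have f_eq: "pre x $ k * w = v $ k * w"
        if "x \<in> Z k" "v \<in> carrier_vec n" "\<And>l. k \<le> l \<Longrightarrow> l < n \<Longrightarrow> x $ l = (A *\<^sub>v v) $ l" for x v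
      proof -
        have "(pre x $ k - v $ k) * w = 0" by (rule m_mult_W[OF pre_eq[OF that] w])
        then show ?thesis by (simp add: left_diff_distrib)
      qed
      have "linear_on (Z k) (\<lambda>x. pre x $ k * w)"
      proof (rule linear_onI)
        fix x assume x: "x \<in> Z k"
        have px: "pre x \<in> carrier_vec n" using pre[OF x] by simp
        show "pre (x + z) $ k * w = pre x $ k * w + pre z $ k * w" if z: "z \<in> Z k" for z
        proof -
          have pz: "pre z \<in> carrier_vec n" using pre[OF z] by simp
          have "pre (x + z) $ k * w = (pre x + pre z) $ k * w"
          proof (rule f_eq[OF vec_submoduleD(3)[OF Zk x z]])
            show "(x + z) $ l = (A *\<^sub>v (pre x + pre z)) $ l" if l: "k \<le> l" "l < n" for l
              unfolding ar(1)[OF px pz]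
              using pre[OF x] pre[OF z] l carrier_vecD[OF Zc[OF z]] carrier_vecD[OF ar(5)[OF pz]] by simp
          qed (use px pz in simp)
          then show ?thesis using k carrier_vecD[OF pz] by (simp add: distrib_right)
        qed
        show "pre (r \<cdot>\<^sub>v x) $ k * w = r * (pre x $ k * w)" for r
        proof -
          have "pre (r \<cdot>\<^sub>v x) $ k * w = (r \<cdot>\<^sub>v pre x) $ k * w"
          proof (rule f_eq[OF vec_submoduleD(4)[OF Zk x]])
            show "(r \<cdot>\<^sub>v x) $ l = (A *\<^sub>v (r \<cdot>\<^sub>v pre x)) $ l" if l: "k \<le> l" "l < n" for l
              unfolding ar(2)[OF px]
              using pre[OF x] l carrier_vecD[OF Zc[OF x]] carrier_vecD[OF ar(5)[OF px]] by simp
          qed (use px in simp)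
          then show ?thesis using k carrier_vecD[OF px] by (simp add: mult.assoc)
        qed
      qed
      moreover have "pre (a \<cdot>\<^sub>v unit_vec n k) $ k * w = unit_vec n k $ k * w"
      proof (rule f_eq[OF ae])
        show "(a \<cdot>\<^sub>v unit_vec n k) $ l = (A *\<^sub>v unit_vec n k) $ l" if l: "k \<le> l" "l < n" for l
          using l Alow[of k l] Acol[OF k l(2)] by (cases "l = k") (simp_all add: a_def)
      qed simp
      then have "pre (a \<cdot>\<^sub>v unit_vec n k) $ k * w = w" using k by simp
      ultimately show ?thesis by (intro exI[of _ "\<lambda>x. pre x $ k * w"] conjI)
    qed
    have Zm: "x $ k \<in> \<mm>" if x: "x \<in> Z k" for x
    proof -
      obtain v where "v \<in> carrier_vec n" "\<forall>l. k \<le> l \<longrightarrow> l < n \<longrightarrow> x $ l = (A *\<^sub>v v) $ l"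
        using ZE[OF x] by (elim exE conjE)
      then show ?thesis using Avl[of v k] k by simp
    qed
    obtain \<kappa> where \<kappa>: "\<kappa> \<in> vec_annihilator n (Z k)" "exact_pair a (\<kappa> $ k)"
      by (rule exact_pair_from_ext_torsionless[OF Hk k Zm am ae coord]) (assumption | rule that)+
    note \<kappa>c = vec_annihilatorD(1)[OF \<kappa>(1)]
    have \<kappa>e: "\<kappa> \<bullet> unit_vec n k = \<kappa> $ k" using \<kappa>c k by simp
    have "ext_torsionless n (Z (Suc k))"
      unfolding ZSuc[OF k]
      by (rule ext_torsionless_extend_one[OF Hk _ \<kappa>(1) _ ae]) (simp_all add: \<kappa>e \<kappa>(2))
    moreover have "minimal (Suc k)"
      unfolding minimal_def
    proof (intro ballI impI allI)
      fix v j assume v: "v \<in> carrier_vec n" and v0: "\<forall>l. Suc k \<le> l \<longrightarrow> l < n \<longrightarrow> (A *\<^sub>v v) $ l = 0"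
        and j: "Suc k \<le> j" "j < n"
      \<comment> \<open>The only obstruction to \<open>minimal k\<close> is the entry
        \<open>r\<close> in row \<open>k\<close>. It is killed by \<open>\<kappa> $ k\<close>, hence
        is a multiple a t, and subtracting t e_k from \<open>v\<close> removes it.\<close>
      define r where "r = (A *\<^sub>v v) $ k"
      have "r \<cdot>\<^sub>v unit_vec n k \<in> Z k"
      proof (rule ZI[OF _ v])
        show "(r \<cdot>\<^sub>v unit_vec n k) $ l = (A *\<^sub>v v) $ l" if l: "k \<le> l" "l < n" for l
          using l v0 by (cases "l = k") (simp_all add: r_def)
      qed simp
      then have "\<kappa> \<bullet> (r \<cdot>\<^sub>v unit_vec n k) = 0" by (rule vec_annihilatorD(2)[OF \<kappa>(1)])
      then have "\<kappa> $ k * r = 0" using \<kappa>c k by (simp add: mult.commute)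
      then obtain t where t: "r = a * t" by (rule exact_pairE[OF exact_pair_sym[OF \<kappa>(2)]])
      have te: "t \<cdot>\<^sub>v unit_vec n k \<in> carrier_vec n" by simp
      have "(v - t \<cdot>\<^sub>v unit_vec n k) $ j \<in> \<mm>"
      proof (rule minimalD[OF mink])
        show "(A *\<^sub>v (v - t \<cdot>\<^sub>v unit_vec n k)) $ l = 0" if l: "k \<le> l" "l < n" for l
        proof -
          have "(A *\<^sub>v (v - t \<cdot>\<^sub>v unit_vec n k)) $ l = (A *\<^sub>v v) $ l - t * A $$ (l, k)"
            unfolding ar(3)[OF v te] ar(2)[OF unit_vec_carrier]
            using l(2) Acol[OF k l(2)] carrier_matD[OF A] by simp
          then show ?thesis
            using l v0 Alow[of k l] t by (cases "l = k") (simp_all add: r_def[symmetric] a_def[symmetric] mult.commute)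
        qed
      qed (use v j in simp_all)
      then show "v $ j \<in> \<mm>" using j v by simp
    qed
    ultimately show ?thesis using \<kappa>(2) unfolding a_def by (intro exI[of _ "\<kappa> $ k"] conjI)
  qed
  have "Z 0 = (\<lambda>v. A *\<^sub>v v) ` carrier_vec n"
  proof (intro equalityI subsetI)
    fix x assume x: "x \<in> Z 0"
    obtain v where v: "v \<in> carrier_vec n" "\<forall>l. 0 \<le> l \<longrightarrow> l < n \<longrightarrow> x $ l = (A *\<^sub>v v) $ l"
      using ZE[OF x] by (elim exE conjE)
    have "x = A *\<^sub>v v" using Zc[OF x] v(2) carrier_vecD[OF ar(5)[OF v(1)]] by (intro eq_vecI) simp_all
    then show "x \<in> (\<lambda>v. A *\<^sub>v v) ` carrier_vec n" using v(1) by (rule image_eqI)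
  next
    fix x assume "x \<in> (\<lambda>v. A *\<^sub>v v) ` carrier_vec n"
    then obtain v where "v \<in> carrier_vec n" "x = A *\<^sub>v v" by auto
    then show "x \<in> Z 0" using ar(5) by (intro ZI[of x v]) simp_all
  qed
  then have H0: "ext_torsionless n (Z 0)" using H by (simp only:)
  have "minimal 0"
    unfolding minimal_def
  proof (intro ballI impI allI)
    fix v j assume v: "v \<in> carrier_vec n" and v0: "\<forall>l. 0 \<le> l \<longrightarrow> l < n \<longrightarrow> (A *\<^sub>v v) $ l = 0" and j: "j < n"
    have "A *\<^sub>v v = 0\<^sub>v n" using v0 carrier_vecD[OF ar(5)[OF v]] by (intro eq_vecI) simp_all
    then show "v $ j \<in> \<mm>" by (rule ker[OF v _ j])
  qed
  with H0 have "k \<le> n \<Longrightarrow> ext_torsionless n (Z k) \<and> minimal k" for k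
  proof (induction k)
    case (Suc k)
    then have k: "k < n" and IH: "ext_torsionless n (Z k)" "minimal k" by simp_all
    show ?case using step[OF k IH] by (elim exE conjE) (intro conjI)
  qed simp
  then have "ext_torsionless n (Z i)" "minimal i" using i by simp_all
  from step[OF i this] show ?thesis by (elim exE conjE) (rule exI)
qed

end

section \<open>Upper triangular matrices with exact zero divisors on the diagonal\<close>

context ezd_cube_zero_local_ring
begin

definition ezd_triangular :: "nat \<Rightarrow> 'a mat \<Rightarrow> bool" where
  "ezd_triangular n A \<longleftrightarrow> A \<in> carrier_mat n n \<and> upper_triangular A \<and>
     (\<forall>i<n. \<forall>j<n. A $$ (i, j) \<in> \<mm>) \<and> (\<forall>i<n. \<exists>b. exact_pair (A $$ (i, i)) b)"

text \<open>A one-sided relation: complexes are built by iterating it, in general with a new matrix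
  at each place.\<close>

definition exact_partner :: "nat \<Rightarrow> 'a mat \<Rightarrow> 'a mat \<Rightarrow> bool" where
  "exact_partner n A B \<longleftrightarrow> ezd_triangular n A \<and> ezd_triangular n B \<and> A * B = 0\<^sub>m n n \<and>
     (\<forall>i<n. exact_pair (A $$ (i, i)) (B $$ (i, i)))"

lemma ezd_triangularD:
  assumes "ezd_triangular n A"
  shows "A \<in> carrier_mat n n" "i < n \<Longrightarrow> j < n \<Longrightarrow> A $$ (i, j) \<in> \<mm>"
    "j < i \<Longrightarrow> i < n \<Longrightarrow> A $$ (i, j) = 0" "i < n \<Longrightarrow> \<exists>b. exact_pair (A $$ (i, i)) b"
  using assms unfolding ezd_triangular_def by (auto simp: upper_triangular_def)

lemma mult_mat_vec_index:
  assumes "A \<in> carrier_mat n k" "v \<in> carrier_vec k" "i < n"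
  shows "(A *\<^sub>v v) $ i = (\<Sum>l<k. A $$ (i, l) * v $ l)"
  using assms by (simp add: scalar_prod_def lessThan_atLeast0)

text \<open>Back substitution upwards from the diagonal; \<open>d\<close> counts the rows above it
  that are already treated. The defect in the next row k is a sum of products of elements of
  \<open>\<mm>\<close>. So it lies in \<open>W\<close>, which is A_kk \<open>\<mm>\<close>, and is
  cancelled by a multiple of e_k with coefficient in \<open>\<mm>\<close>; the rows below are not
  disturbed.\<close>

lemma partner_column:
  assumes A: "ezd_triangular n A" and j: "j < n" and b: "exact_pair (A $$ (j, j)) b"
  shows "d \<le> j \<Longrightarrow> \<exists>\<beta>\<in>carrier_vec n. \<beta> $ j = b \<and> (\<forall>l<n. j < l \<longrightarrow> \<beta> $ l = 0) \<and>
    (\<forall>l<n. \<beta> $ l \<in> \<mm>) \<and> (\<forall>i<n. j - d \<le> i \<longrightarrow> (A *\<^sub>v \<beta>) $ i = 0)"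
proof (induction d)
  case 0
  note Ac = ezd_triangularD(1)[OF A]
  define \<beta> where "\<beta> = b \<cdot>\<^sub>v unit_vec n j"
  have \<beta>: "\<beta> \<in> carrier_vec n" by (simp add: \<beta>_def)
  have "(A *\<^sub>v \<beta>) $ i = 0" if i: "i < n" "j \<le> i" for i
  proof -
    have "(A *\<^sub>v \<beta>) $ i = b * A $$ (i, j)"
      unfolding \<beta>_def using mult_mat_vec_add_smult(2)[OF Ac, of "unit_vec n j" b] Ac i j by simp
    also have "\<dots> = 0"
      using ezd_triangularD(3)[OF A, of j i] i exact_pair_mult[OF b] by (cases "i = j") (simp_all add: mult.commute)
    finally show ?thesis .
  qed
  moreover have "\<beta> $ j = b" using j by (simp add: \<beta>_def)
  moreover have "\<forall>l<n. j < l \<longrightarrow> \<beta> $ l = 0" using j by (simp add: \<beta>_def)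
  moreover have "\<forall>l<n. \<beta> $ l \<in> \<mm>"
    using j exact_pair_in_m(2)[OF b] m_closed(1) by (simp add: \<beta>_def unit_vec_def)
  ultimately show ?case using \<beta> by (intro bexI[of _ \<beta>]) simp_all
next
  case (Suc d)
  note Ac = ezd_triangularD(1)[OF A]
  obtain \<beta> where \<beta>: "\<beta> \<in> carrier_vec n" "\<beta> $ j = b" "\<forall>l<n. j < l \<longrightarrow> \<beta> $ l = 0"
    "\<forall>l<n. \<beta> $ l \<in> \<mm>" "\<forall>i<n. j - d \<le> i \<longrightarrow> (A *\<^sub>v \<beta>) $ i = 0"
    using Suc.IH[OF Suc_leD[OF Suc.prems]] by (elim bexE conjE)
  define k where "k = j - Suc d"
  have k: "k < j" "k < n" "j - d = Suc k" using Suc.prems j by (simp_all add: k_def)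
  obtain c where c: "exact_pair (A $$ (k, k)) c" using ezd_triangularD(4)[OF A k(2)] by (elim exE)
  have "(A *\<^sub>v \<beta>) $ k \<in> W"
    unfolding mult_mat_vec_index[OF Ac \<beta>(1) k(2)]
  proof (rule ideal_sum[OF ideal_W])
    show "A $$ (k, l) * \<beta> $ l \<in> W" if "l \<in> {..<n}" for l
      by (rule mult_in_W) (use ezd_triangularD(2)[OF A k(2)] \<beta>(4) that in simp_all)
  qed
  then obtain s where s: "s \<in> \<mm>" "(A *\<^sub>v \<beta>) $ k = A $$ (k, k) * s" by (rule exact_pair_W_subset[OF c])
  define \<gamma> where "\<gamma> = (- s) \<cdot>\<^sub>v unit_vec n k"
  have \<gamma>: "\<gamma> \<in> carrier_vec n" by (simp add: \<gamma>_def)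
  have \<gamma>l: "\<gamma> $ l = (if l = k then - s else 0)" if "l < n" for l using that k(2) by (simp add: \<gamma>_def)
  have ms: "- s \<in> \<mm>" using m_closed(3)[OF m_closed(1) s(1)] by simp
  have "(A *\<^sub>v (\<beta> + \<gamma>)) $ i = 0" if i: "i < n" "j - Suc d \<le> i" for i
  proof -
    have "(A *\<^sub>v \<gamma>) $ i = - s * A $$ (i, k)"
      unfolding \<gamma>_def using mult_mat_vec_add_smult(2)[OF Ac, of "unit_vec n k" "- s"] Ac i k(2) by simp
    then have "(A *\<^sub>v (\<beta> + \<gamma>)) $ i = (A *\<^sub>v \<beta>) $ i - s * A $$ (i, k)"
      unfolding mult_mat_vec_add_smult(1)[OF Ac \<beta>(1) \<gamma>]
      using i carrier_vecD[OF mult_mat_vec_add_smult(5)[OF Ac \<gamma>]] by simp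
    also have "\<dots> = 0"
    proof (cases "i = k")
      case True then show ?thesis using s(2) by (simp add: mult.commute)
    next
      case False
      then have "k < i" using i(2) by (simp add: k_def)
      then show ?thesis using \<beta>(5) i(1) k(3) ezd_triangularD(3)[OF A \<open>k < i\<close> i(1)] by simp
    qed
    finally show ?thesis .
  qed
  moreover have "(\<beta> + \<gamma>) $ j = b" using \<beta>(2) \<gamma>l[OF j] \<gamma> j k(1) by simp
  moreover have "\<forall>l<n. j < l \<longrightarrow> (\<beta> + \<gamma>) $ l = 0" using \<beta>(3) \<gamma>l \<gamma> k(1) by simp
  moreover have "\<forall>l<n. (\<beta> + \<gamma>) $ l \<in> \<mm>"
    using \<beta>(4) \<gamma>l \<gamma> m_closed(2)[OF _ ms] by simp
  moreover have "\<beta> + \<gamma> \<in> carrier_vec n" using \<beta>(1) \<gamma> by simp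
  ultimately show ?case by (intro bexI[of _ "\<beta> + \<gamma>"]) simp_all
qed

lemma right_partner_exists:
  assumes A: "ezd_triangular n A" shows "\<exists>B. exact_partner n A B"
proof -
  note Ac = ezd_triangularD(1)[OF A]
  obtain b where b: "\<And>i. i < n \<Longrightarrow> exact_pair (A $$ (i, i)) (b i)" using ezd_triangularD(4)[OF A] by metis
  have "\<exists>\<beta>. \<beta> \<in> carrier_vec n \<and> \<beta> $ j = b j \<and> (\<forall>l<n. j < l \<longrightarrow> \<beta> $ l = 0) \<and>
      (\<forall>l<n. \<beta> $ l \<in> \<mm>) \<and> (\<forall>i<n. (A *\<^sub>v \<beta>) $ i = 0)" if j: "j < n" for j
    using partner_column[OF A j b[OF j], of j] by auto
  then have "\<exists>\<beta>. \<forall>j<n. \<beta> j \<in> carrier_vec n \<and> \<beta> j $ j = b j \<and> (\<forall>l<n. j < l \<longrightarrow> \<beta> j $ l = 0) \<and>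
      (\<forall>l<n. \<beta> j $ l \<in> \<mm>) \<and> (\<forall>i<n. (A *\<^sub>v \<beta> j) $ i = 0)" by metis
  then obtain \<beta> where \<beta>: "\<And>j. j < n \<Longrightarrow> \<beta> j \<in> carrier_vec n \<and> \<beta> j $ j = b j \<and> (\<forall>l<n. j < l \<longrightarrow> \<beta> j $ l = 0) \<and>
      (\<forall>l<n. \<beta> j $ l \<in> \<mm>) \<and> (\<forall>i<n. (A *\<^sub>v \<beta> j) $ i = 0)" by auto
  define B where "B = mat n n (\<lambda>(i, j). \<beta> j $ i)"
  have B: "B \<in> carrier_mat n n" by (simp add: B_def)
  have colB: "col B j = \<beta> j" if "j < n" for j 
    using that carrier_vecD[OF conjunct1[OF \<beta>[OF that]]] by (intro eq_vecI) (simp_all add: B_def)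
  have Bii: "B $$ (i, i) = b i" if "i < n" for i using \<beta>[OF that] that by (simp add: B_def)
  have "A * B = 0\<^sub>m n n"
  proof (rule eq_matI)
    fix i j assume "i < dim_row (0\<^sub>m n n :: 'a mat)" "j < dim_col (0\<^sub>m n n :: 'a mat)"
    then have ij: "i < n" "j < n" by simp_all
    have "(A * B) $$ (i, j) = (A *\<^sub>v \<beta> j) $ i" using Ac B ij colB[OF ij(2)] by simp
    then show "(A * B) $$ (i, j) = 0\<^sub>m n n $$ (i, j)" using \<beta>[OF ij(2)] ij by simp
  qed (use Ac B in simp_all)
  moreover have "ezd_triangular n B"
    unfolding ezd_triangular_def
  proof (intro conjI allI impI)
    show "upper_triangular B" unfolding upper_triangular_def using \<beta> by (simp add: B_def)
    show "B $$ (i, j) \<in> \<mm>" if "i < n" "j < n" for i j using \<beta> that by (simp add: B_def)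
    show "\<exists>c. exact_pair (B $$ (i, i)) c" if "i < n" for i
      using exact_pair_sym[OF b[OF that]] unfolding Bii[OF that] by (rule exI)
  qed (rule B)
  ultimately have "exact_partner n A B" unfolding exact_partner_def using A b Bii by simp
  then show ?thesis by (rule exI)
qed

text \<open>The reflection at the antidiagonal reverses products and preserves upper triangular matrices.\<close>

definition antitranspose :: "nat \<Rightarrow> 'a mat \<Rightarrow> 'a mat" where
  "antitranspose n A = mat n n (\<lambda>(i, j). A $$ (n - Suc j, n - Suc i))"

lemma antitranspose_mult:
  assumes "A \<in> carrier_mat n n" "B \<in> carrier_mat n n"
  shows "antitranspose n (A * B) = antitranspose n B * antitranspose n A"
proof (rule eq_matI)
  fix i j assume "i < dim_row (antitranspose n B * antitranspose n A)" "j < dim_col (antitranspose n B * antitranspose n A)"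
  then have ij: "i < n" "j < n" by (simp_all add: antitranspose_def)
  have "(antitranspose n B * antitranspose n A) $$ (i, j) =
      (\<Sum>k<n. B $$ (n - Suc k, n - Suc i) * A $$ (n - Suc j, n - Suc k))"
    using ij by (simp add: antitranspose_def scalar_prod_def lessThan_atLeast0)
  also have "\<dots> = (\<Sum>k<n. B $$ (k, n - Suc i) * A $$ (n - Suc j, k))"
    by (rule sum.nat_diff_reindex)
  also have "\<dots> = (\<Sum>k<n. A $$ (n - Suc j, k) * B $$ (k, n - Suc i))"
    by (simp only: mult.commute)
  also have "\<dots> = antitranspose n (A * B) $$ (i, j)"
    using ij assms by (simp add: antitranspose_def scalar_prod_def lessThan_atLeast0)
  finally show "antitranspose n (A * B) $$ (i, j) = (antitranspose n B * antitranspose n A) $$ (i, j)" ..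
qed (simp_all add: antitranspose_def)

lemma antitranspose_antitranspose: "A \<in> carrier_mat n n \<Longrightarrow> antitranspose n (antitranspose n A) = A"
  by (rule eq_matI) (auto simp: antitranspose_def)

lemma ezd_triangular_antitranspose:
  assumes A: "ezd_triangular n A" shows "ezd_triangular n (antitranspose n A)"
  unfolding ezd_triangular_def
proof (intro conjI allI impI)
  show "upper_triangular (antitranspose n A)"
    unfolding upper_triangular_def
  proof (intro allI impI)
    fix i j assume "i < dim_row (antitranspose n A)" "j < i"
    then show "antitranspose n A $$ (i, j) = 0"
      using ezd_triangularD(3)[OF A, of "n - Suc i" "n - Suc j"] by (simp add: antitranspose_def)
  qed
  show "antitranspose n A $$ (i, j) \<in> \<mm>" if "i < n" "j < n" for i j
    using ezd_triangularD(2)[OF A, of "n - Suc j" "n - Suc i"] that by (simp add: antitranspose_def)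
  show "\<exists>b. exact_pair (antitranspose n A $$ (i, i)) b" if "i < n" for i
    using ezd_triangularD(4)[OF A, of "n - Suc i"] that by (simp add: antitranspose_def)
qed (simp add: antitranspose_def)

text \<open>Reflection at the antidiagonal turns right partners into left partners.\<close>

lemma left_partner_exists:
  assumes A: "ezd_triangular n A" shows "\<exists>C. exact_partner n C A"
proof -
  obtain B where B: "exact_partner n (antitranspose n A) B"
    using right_partner_exists[OF ezd_triangular_antitranspose[OF A]] by (elim exE)
  then have B': "ezd_triangular n B" "antitranspose n A * B = 0\<^sub>m n n"
    "\<And>i. i < n \<Longrightarrow> exact_pair (antitranspose n A $$ (i, i)) (B $$ (i, i))"
    unfolding exact_partner_def by simp_all
  note Ac = ezd_triangularD(1)[OF A] and Bc = ezd_triangularD(1)[OF B'(1)]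
  have tAc: "antitranspose n A \<in> carrier_mat n n" by (simp add: antitranspose_def)
  have "antitranspose n B * A = antitranspose n (antitranspose n A * B)"
    using antitranspose_mult[OF tAc Bc] antitranspose_antitranspose[OF Ac] by simp
  also have "\<dots> = 0\<^sub>m n n" unfolding B'(2) by (rule eq_matI) (simp_all add: antitranspose_def)
  finally have prod: "antitranspose n B * A = 0\<^sub>m n n" .
  have "exact_pair (antitranspose n B $$ (i, i)) (A $$ (i, i))" if i: "i < n" for i
    using exact_pair_sym[OF B'(3)[of "n - Suc i"]] i by (simp add: antitranspose_def)
  then have "exact_partner n (antitranspose n B) A"
    unfolding exact_partner_def using A ezd_triangular_antitranspose[OF B'(1)] prod by simp
  then show ?thesis by (rule exI)
qed

lemma exact_partnerD:
  assumes "exact_partner n A B"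
  shows "A \<in> carrier_mat n n" "B \<in> carrier_mat n n" "A * B = 0\<^sub>m n n"
    "j < i \<Longrightarrow> i < n \<Longrightarrow> A $$ (i, j) = 0" "j < i \<Longrightarrow> i < n \<Longrightarrow> B $$ (i, j) = 0"
    "i < n \<Longrightarrow> exact_pair (A $$ (i, i)) (B $$ (i, i))" "ezd_triangular n A" "ezd_triangular n B"
  using assms unfolding exact_partner_def by (auto dest: ezd_triangularD(1,3))

text \<open>A kernel vector is reduced to zero from the bottom up, using the last nonzero entry.\<close>

lemma mat_kernel_exact_partner:
  assumes AB: "exact_partner n A B"
  shows "mat_kernel A = (\<lambda>v. B *\<^sub>v v) ` carrier_vec n"
proof -
  note A = exact_partnerD(1)[OF AB] and B = exact_partnerD(2)[OF AB]
  note im = vec_submodule_mat_image[OF B] and ker = vec_submodule_mat_kernel[OF A]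
  have sub: "B *\<^sub>v v \<in> mat_kernel A" if v: "v \<in> carrier_vec n" for v
  proof -
    have "A *\<^sub>v (B *\<^sub>v v) = (A * B) *\<^sub>v v" by (rule assoc_mult_mat_vec[symmetric, OF A B v])
    also have "\<dots> = 0\<^sub>v n" unfolding exact_partnerD(3)[OF AB] using v by (intro eq_vecI) auto
    finally show ?thesis unfolding mat_kernel_iff[OF A] using mult_mat_vec_carrier[OF B v] by simp
  qed
  have red: "v \<in> (\<lambda>v. B *\<^sub>v v) ` carrier_vec n"
    if "k \<le> n" "v \<in> mat_kernel A" "\<And>l. k \<le> l \<Longrightarrow> l < n \<Longrightarrow> v $ l = 0" for k v
    using that
  proof (induction k arbitrary: v)
    case 0
    have "v = 0\<^sub>v n" using 0 vec_submoduleD(1)[OF ker 0(2)] by (intro eq_vecI) simp_all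
    then show ?case using vec_submoduleD(2)[OF im] by simp
  next
    case (Suc k)
    have k: "k < n" using Suc.prems by simp
    have v: "v \<in> carrier_vec n" "A *\<^sub>v v = 0\<^sub>v n" using Suc.prems(2) unfolding mat_kernel_iff[OF A] by simp_all
    \<comment> \<open>In row \<open>k\<close> only the diagonal term survives: \<open>A\<close>
      vanishes to its left, \<open>v\<close> to its right. As \<open>B\<close> is upper triangular,
      a multiple of its column \<open>k\<close> clears \<open>v $ k\<close> and keeps the zeros
      after it.\<close>
    have "0 = (\<Sum>l<n. A $$ (k, l) * v $ l)" using mult_mat_vec_index[OF A v(1) k] v(2) k by simp
    also have "\<dots> = (\<Sum>l\<in>{k}. A $$ (k, l) * v $ l)"
    proof (rule sum.mono_neutral_right)
      show "\<forall>l\<in>{..<n} - {k}. A $$ (k, l) * v $ l = 0"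
      proof
        fix l assume l: "l \<in> {..<n} - {k}"
        show "A $$ (k, l) * v $ l = 0"
          using exact_partnerD(4)[OF AB, of l k] Suc.prems(3)[of l] l k by (cases "l < k") simp_all
      qed
    qed (use k in simp_all)
    finally have "A $$ (k, k) * v $ k = 0" by simp
    then obtain t where t: "v $ k = B $$ (k, k) * t" by (rule exact_pairE[OF exact_partnerD(6)[OF AB k]])
    have te: "t \<cdot>\<^sub>v unit_vec n k \<in> carrier_vec n" by simp
    define w where "w = B *\<^sub>v (t \<cdot>\<^sub>v unit_vec n k)"
    have w: "w \<in> carrier_vec n" unfolding w_def by (rule mult_mat_vec_carrier[OF B te])
    have wl: "w $ l = t * B $$ (l, k)" if "l < n" for l
      unfolding w_def using mult_mat_vec_add_smult(2)[OF B, of "unit_vec n k" t] B k that by simp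
    have "v - w \<in> (\<lambda>v. B *\<^sub>v v) ` carrier_vec n"
    proof (rule Suc.IH)
      show "v - w \<in> mat_kernel A" unfolding w_def by (rule vec_submodule_diff[OF ker Suc.prems(2) sub[OF te]])
      show "(v - w) $ l = 0" if l: "k \<le> l" "l < n" for l
      proof (cases "l = k")
        case True then show ?thesis using wl[OF k] t w k by (simp add: mult.commute)
      next
        case False
        then show ?thesis using wl[OF l(2)] w l Suc.prems(3)[of l] exact_partnerD(5)[OF AB, of k l] by simp
      qed
    qed (use k in simp)
    moreover have "w \<in> (\<lambda>v. B *\<^sub>v v) ` carrier_vec n" unfolding w_def using te by (rule imageI)
    ultimately have "(v - w) + w \<in> (\<lambda>v. B *\<^sub>v v) ` carrier_vec n" by (rule vec_submoduleD(3)[OF im])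
    moreover have "(v - w) + w = v" using v(1) w by (intro eq_vecI) simp_all
    ultimately show ?case by simp
  qed
  show ?thesis
  proof (intro equalityI subsetI)
    fix x assume x: "x \<in> mat_kernel A"
    show "x \<in> (\<lambda>v. B *\<^sub>v v) ` carrier_vec n" by (rule red[OF le_refl x]) simp
  qed (use sub in auto)
qed

text \<open>Transposes are lower triangular, but conjugation by the reversal matrix \<open>R\<close>
  turns them into antitransposes. To these the upper triangular case applies, with the order of the
  two matrices exchanged.\<close>

lemma mat_kernel_transpose_exact_partner:
  assumes AB: "exact_partner n A B"
  shows "mat_kernel (transpose_mat B) = (\<lambda>v. transpose_mat A *\<^sub>v v) ` carrier_vec n"
proof -
  define R where "R = mat n n (\<lambda>(i, j). if i + j = n - 1 then 1 else 0 :: 'a)"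
  have R: "R \<in> carrier_mat n n" by (simp add: R_def)
  have Rv: "R *\<^sub>v v = vec n (\<lambda>i. v $ (n - Suc i))" if v: "v \<in> carrier_vec n" for v
  proof (rule eq_vecI)
    fix i assume "i < dim_vec (vec n (\<lambda>i. v $ (n - Suc i)))"
    then have i: "i < n" by simp
    have "(R *\<^sub>v v) $ i = (\<Sum>l<n. if l = n - Suc i then v $ l else 0)"
      unfolding mult_mat_vec_index[OF R v i] using i by (intro sum.cong) (auto simp: R_def)
    also have "\<dots> = v $ (n - Suc i)" using i by simp
    finally show "(R *\<^sub>v v) $ i = vec n (\<lambda>i. v $ (n - Suc i)) $ i" using i by simp
  qed (simp add: R_def)
  have Rc: "R *\<^sub>v v \<in> carrier_vec n" if "v \<in> carrier_vec n" for v using mult_mat_vec_carrier[OF R that] .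
  have RR: "R *\<^sub>v (R *\<^sub>v v) = v" if v: "v \<in> carrier_vec n" for v
    unfolding Rv[OF Rc[OF v]] using v by (intro eq_vecI) (simp_all add: Rv[OF v])
  have tr: "antitranspose n X *\<^sub>v (R *\<^sub>v v) = R *\<^sub>v (transpose_mat X *\<^sub>v v)"
    if X: "X \<in> carrier_mat n n" and v: "v \<in> carrier_vec n" for X v
  proof -
    have Xt: "transpose_mat X \<in> carrier_mat n n" using X by simp
    have Xa: "antitranspose n X \<in> carrier_mat n n" by (simp add: antitranspose_def)
    note Xv = mult_mat_vec_carrier[OF Xt v]
    show ?thesis
    proof (rule eq_vecI)
      fix i assume "i < dim_vec (R *\<^sub>v (transpose_mat X *\<^sub>v v))"
      then have i: "i < n" using R by simp
      then have i': "n - Suc i < n" by simp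
      have "(antitranspose n X *\<^sub>v (R *\<^sub>v v)) $ i = (\<Sum>l<n. antitranspose n X $$ (i, l) * (R *\<^sub>v v) $ l)"
        by (rule mult_mat_vec_index[OF Xa Rc[OF v] i])
      also have "\<dots> = (\<Sum>l<n. X $$ (n - Suc l, n - Suc i) * v $ (n - Suc l))"
        using i by (intro sum.cong refl) (simp add: antitranspose_def Rv[OF v])
      also have "\<dots> = (\<Sum>l<n. X $$ (l, n - Suc i) * v $ l)" by (rule sum.nat_diff_reindex)
      also have "\<dots> = (transpose_mat X *\<^sub>v v) $ (n - Suc i)"
        unfolding mult_mat_vec_index[OF Xt v i'] using X i' by simp
      also have "\<dots> = (R *\<^sub>v (transpose_mat X *\<^sub>v v)) $ i" unfolding Rv[OF Xv] using i by simp
      finally show "(antitranspose n X *\<^sub>v (R *\<^sub>v v)) $ i = (R *\<^sub>v (transpose_mat X *\<^sub>v v)) $ i" .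
    qed (use R in \<open>simp add: antitranspose_def\<close>)
  qed
  note A = exact_partnerD(1)[OF AB] and B = exact_partnerD(2)[OF AB]
  have At: "transpose_mat A \<in> carrier_mat n n" and Bt: "transpose_mat B \<in> carrier_mat n n" using A B by simp_all
  have Ba: "antitranspose n B \<in> carrier_mat n n" by (simp add: antitranspose_def)
  have "antitranspose n B * antitranspose n A = antitranspose n (A * B)"
    by (rule antitranspose_mult[symmetric, OF A B])
  also have "\<dots> = 0\<^sub>m n n" unfolding exact_partnerD(3)[OF AB] by (rule eq_matI) (simp_all add: antitranspose_def)
  finally have p: "antitranspose n B * antitranspose n A = 0\<^sub>m n n" .
  have "exact_pair (antitranspose n B $$ (i, i)) (antitranspose n A $$ (i, i))" if i: "i < n" for i
    using exact_pair_sym[OF exact_partnerD(6)[OF AB, of "n - Suc i"]] i by (simp add: antitranspose_def)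
  then have "exact_partner n (antitranspose n B) (antitranspose n A)"
    unfolding exact_partner_def using p
      ezd_triangular_antitranspose[OF exact_partnerD(7)[OF AB]] ezd_triangular_antitranspose[OF exact_partnerD(8)[OF AB]]
    by simp
  note ker = mat_kernel_exact_partner[OF this]
  have R0: "R *\<^sub>v 0\<^sub>v n = 0\<^sub>v n" by (rule mult_mat_vec_add_smult(4)[OF R])
  have K: "x \<in> mat_kernel (transpose_mat B) \<longleftrightarrow> R *\<^sub>v x \<in> mat_kernel (antitranspose n B)" if x: "x \<in> carrier_vec n" for x
  proof -
    have "transpose_mat B *\<^sub>v x = 0\<^sub>v n \<longleftrightarrow> R *\<^sub>v (transpose_mat B *\<^sub>v x) = 0\<^sub>v n"
    proof
      assume "R *\<^sub>v (transpose_mat B *\<^sub>v x) = 0\<^sub>v n"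
      then show "transpose_mat B *\<^sub>v x = 0\<^sub>v n" using RR[OF mult_mat_vec_carrier[OF Bt x]] R0 by simp
    qed (simp add: R0)
    then show ?thesis unfolding mat_kernel_iff[OF Bt] mat_kernel_iff[OF Ba] tr[OF B x] using x Rc[OF x] by simp
  qed
  have I: "x \<in> (\<lambda>v. transpose_mat A *\<^sub>v v) ` carrier_vec n \<longleftrightarrow> R *\<^sub>v x \<in> (\<lambda>v. antitranspose n A *\<^sub>v v) ` carrier_vec n"
    if x: "x \<in> carrier_vec n" for x
  proof
    assume "x \<in> (\<lambda>v. transpose_mat A *\<^sub>v v) ` carrier_vec n"
    then obtain v where v: "v \<in> carrier_vec n" "x = transpose_mat A *\<^sub>v v" by auto
    show "R *\<^sub>v x \<in> (\<lambda>v. antitranspose n A *\<^sub>v v) ` carrier_vec n"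
      unfolding v(2) tr[OF A v(1), symmetric] using Rc[OF v(1)] by (rule imageI)
  next
    assume "R *\<^sub>v x \<in> (\<lambda>v. antitranspose n A *\<^sub>v v) ` carrier_vec n"
    then obtain v where v: "v \<in> carrier_vec n" "R *\<^sub>v x = antitranspose n A *\<^sub>v v" by auto
    have "R *\<^sub>v x = R *\<^sub>v (transpose_mat A *\<^sub>v (R *\<^sub>v v))"
      unfolding tr[OF A Rc[OF v(1)], symmetric] RR[OF v(1)] by (rule v(2))
    have "x = R *\<^sub>v (R *\<^sub>v x)" by (rule RR[OF x, symmetric])
    also have "\<dots> = R *\<^sub>v (R *\<^sub>v (transpose_mat A *\<^sub>v (R *\<^sub>v v)))"
      by (rule arg_cong[OF \<open>R *\<^sub>v x = R *\<^sub>v (transpose_mat A *\<^sub>v (R *\<^sub>v v))\<close>])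
    also have "\<dots> = transpose_mat A *\<^sub>v (R *\<^sub>v v)" by (rule RR[OF mult_mat_vec_carrier[OF At Rc[OF v(1)]]])
    finally have "x = transpose_mat A *\<^sub>v (R *\<^sub>v v)" .
    then show "x \<in> (\<lambda>v. transpose_mat A *\<^sub>v v) ` carrier_vec n" using Rc[OF v(1)] by (rule image_eqI)
  qed
  show ?thesis
  proof (intro equalityI subsetI)
    fix x assume x: "x \<in> mat_kernel (transpose_mat B)"
    then have xc: "x \<in> carrier_vec n" unfolding mat_kernel_iff[OF Bt] by simp
    show "x \<in> (\<lambda>v. transpose_mat A *\<^sub>v v) ` carrier_vec n" using x unfolding K[OF xc] I[OF xc] ker .
  next
    fix x assume x: "x \<in> (\<lambda>v. transpose_mat A *\<^sub>v v) ` carrier_vec n"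
    then have xc: "x \<in> carrier_vec n" using mult_mat_vec_carrier[OF At] by auto
    show "x \<in> mat_kernel (transpose_mat B)" using x unfolding K[OF xc] I[OF xc] ker .
  qed
qed

end

section \<open>Ext and duality in terms of matrices\<close>

text \<open>Restricted to the carrier because the cochain modules contain extensional functions
  only.\<close>

definition row_functional :: "nat \<Rightarrow> 'a::comm_ring_1 vec \<Rightarrow> 'a vec \<Rightarrow> 'a" where
  "row_functional k u = (\<lambda>v\<in>carrier_vec k. u \<bullet> v)"

lemma row_functional_inj:
  assumes u: "u \<in> carrier_vec k" and w: "w \<in> carrier_vec k" and eq: "row_functional k u = row_functional k w"
  shows "u = w"
proof (rule eq_vecI)
  fix i assume "i < dim_vec w"
  then have i: "i < k" using w by simp
  have "row_functional k u (unit_vec k i) = row_functional k w (unit_vec k i)" by (simp only: eq)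
  then show "u $ i = w $ i" using u w i by (simp add: row_functional_def)
qed (use u w in simp)

lemma mhom_module_vec_ring_iff:
  "f \<in> mhom (module_vec TYPE('a::comm_ring_1) k) (ring_module :: ('a, 'a) module) \<longleftrightarrow> linear_on (carrier_vec k) f"
proof
  assume f: "f \<in> mhom (module_vec TYPE('a) k) ring_module"
  show "linear_on (carrier_vec k) f"
  proof (rule linear_onI)
    show "f (x + y) = f x + f y" if "x \<in> carrier_vec k" "y \<in> carrier_vec k" for x y
      using mhomD(2)[OF f, of x y] that by (simp add: module_vec_simps ring_module_def)
    show "f (r \<cdot>\<^sub>v x) = r * f x" if "x \<in> carrier_vec k" for r x
      using mhomD(3)[OF f, of x r] that by (simp add: module_vec_simps ring_module_def)
  qed
next
  assume f: "linear_on (carrier_vec k) f"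
  show "f \<in> mhom (module_vec TYPE('a) k) ring_module"
    by (rule mhomI) (use linear_onD[OF f] in \<open>simp_all add: module_vec_simps ring_module_def\<close>)
qed

lemma linear_on_scalar_prod:
  fixes u :: "'a::comm_ring_1 vec"
  assumes u: "u \<in> carrier_vec k" and Z: "Z \<subseteq> carrier_vec k"
  shows "linear_on Z (\<lambda>v. u \<bullet> v)"
proof (rule linear_onI)
  show "u \<bullet> (x + y) = u \<bullet> x + u \<bullet> y" if "x \<in> Z" "y \<in> Z" for x y
    by (rule scalar_prod_add_distrib[OF u subsetD[OF Z that(1)] subsetD[OF Z that(2)]])
  show "u \<bullet> (r \<cdot>\<^sub>v x) = r * (u \<bullet> x)" if "x \<in> Z" for r x
    by (rule scalar_prod_smult_distrib[OF u subsetD[OF Z that]])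
qed

lemma carrier_ext_cochains:
  "carrier (ext_cochains r (ring_module :: ('a::comm_ring_1, 'a) module) i) = row_functional (r i) ` carrier_vec (r i)"
proof (intro equalityI subsetI)
  fix f assume "f \<in> carrier (ext_cochains r (ring_module :: ('a, 'a) module) i)"
  then have lin: "linear_on (carrier_vec (r i)) f" and ext: "f \<in> extensional (carrier_vec (r i))"
    unfolding ext_cochains_def hom_module_def mhom_module_vec_ring_iff[symmetric] by (simp_all add: module_vec_simps)
  let ?u = "vec (r i) (\<lambda>j. f (unit_vec (r i) j))"
  have "f = row_functional (r i) ?u"
  proof (rule extensionalityI[OF ext])
    show "row_functional (r i) ?u \<in> extensional (carrier_vec (r i))" by (simp add: row_functional_def)
    show "f v = row_functional (r i) ?u v" if "v \<in> carrier_vec (r i)" for v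
      using linear_functional_eq_scalar_prod[OF lin that] that by (simp add: row_functional_def)
  qed
  moreover have "?u \<in> carrier_vec (r i)" by simp
  ultimately show "f \<in> row_functional (r i) ` carrier_vec (r i)" by (rule image_eqI)
next
  fix f :: "'a vec \<Rightarrow> 'a" assume "f \<in> row_functional (r i) ` carrier_vec (r i)"
  then obtain u where u: "u \<in> carrier_vec (r i)" "f = row_functional (r i) u" by auto
  have "linear_on (carrier_vec (r i)) f"
  proof (rule linear_onI)
    note l = linear_onD[OF linear_on_scalar_prod[OF u(1) subset_refl]]
    show "f (x + y) = f x + f y" if "x \<in> carrier_vec (r i)" "y \<in> carrier_vec (r i)" for x y
      using l(1)[OF that] that unfolding u(2) row_functional_def by simp
    show "f (s \<cdot>\<^sub>v x) = s * f x" if "x \<in> carrier_vec (r i)" for s x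
      using l(2)[OF that] that unfolding u(2) row_functional_def by simp
  qed
  moreover have "f \<in> extensional (carrier_vec (r i))" by (simp add: u(2) row_functional_def)
  ultimately show "f \<in> carrier (ext_cochains r (ring_module :: ('a, 'a) module) i)"
    unfolding ext_cochains_def hom_module_def mhom_module_vec_ring_iff[symmetric] by (simp add: module_vec_simps)
qed

lemma ext_differential_row_functional:
  fixes D :: "nat \<Rightarrow> 'a::comm_ring_1 mat"
  assumes D: "D i \<in> carrier_mat (r i) (r (Suc i))" and u: "u \<in> carrier_vec (r i)"
  shows "ext_differential r D i (row_functional (r i) u) = row_functional (r (Suc i)) (transpose_mat (D i) *\<^sub>v u)"
proof (rule ext)
  fix v
  show "ext_differential r D i (row_functional (r i) u) v = row_functional (r (Suc i)) (transpose_mat (D i) *\<^sub>v u) v"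
  proof (cases "v \<in> carrier_vec (r (Suc i))")
    case True
    have "u \<bullet> (D i *\<^sub>v v) = (transpose_mat (D i) *\<^sub>v u) \<bullet> v"
      by (rule transpose_vec_mult_scalar[symmetric, OF D True u])
    then show ?thesis
      using True mult_mat_vec_carrier[OF D True] by (simp add: ext_differential_def row_functional_def)
  qed (simp add: ext_differential_def row_functional_def)
qed

lemma row_functional_zero:
  "\<zero>\<^bsub>ext_cochains r (ring_module :: ('a::comm_ring_1, 'a) module) i\<^esub> = row_functional (r i) (0\<^sub>v (r i))"
  by (rule ext) (simp add: ext_cochains_def hom_module_def row_functional_def module_vec_simps ring_module_def restrict_def)

lemma row_functional_add:
  assumes "u \<in> carrier_vec (r i)" "w \<in> carrier_vec (r i)"
  shows "row_functional (r i) u \<oplus>\<^bsub>ext_cochains r (ring_module :: ('a::comm_ring_1, 'a) module) i\<^esub> row_functional (r i) w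
    = row_functional (r i) (u + w)"
proof (rule ext)
  fix v
  show "(row_functional (r i) u \<oplus>\<^bsub>ext_cochains r (ring_module :: ('a, 'a) module) i\<^esub> row_functional (r i) w) v
    = row_functional (r i) (u + w) v"
    using assms add_scalar_prod_distrib[OF assms, of v]
    by (cases "v \<in> carrier_vec (r i)")
      (simp_all add: ext_cochains_def hom_module_def row_functional_def module_vec_simps ring_module_def)
qed

text \<open>Cochains of a free module are row vectors and differentials are transposed matrices; the
  quotient is trivial iff every cocycle is a coboundary. The degree is \<open>Suc i\<close> because
  coboundaries in degree 0 are defined separately.\<close>

lemma ext_group_trivial_iff:
  fixes D :: "nat \<Rightarrow> 'a::comm_ring_1 mat" and r :: "nat \<Rightarrow> nat" and i :: nat
  defines "G \<equiv> ext_group r D (ring_module :: ('a, 'a) module) (Suc i)"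
  assumes D: "D i \<in> carrier_mat (r i) (r (Suc i))" and D': "D (Suc i) \<in> carrier_mat (r (Suc i)) (r (Suc (Suc i)))"
  shows "carrier G = {\<one>\<^bsub>G\<^esub>} \<longleftrightarrow>
    mat_kernel (transpose_mat (D (Suc i))) \<subseteq> (\<lambda>u. transpose_mat (D i) *\<^sub>v u) ` carrier_vec (r i)"
proof -
  define k where "k = r (Suc i)"
  have D1: "transpose_mat (D i) \<in> carrier_mat k (r i)"
    and D2: "transpose_mat (D (Suc i)) \<in> carrier_mat (r (Suc (Suc i))) k" using D D' by (simp_all add: k_def)
  define I where "I = (\<lambda>u. transpose_mat (D i) *\<^sub>v u) ` carrier_vec (r i)"
  define K where "K = mat_kernel (transpose_mat (D (Suc i)))"
  have I: "vec_submodule k I" unfolding I_def by (rule vec_submodule_mat_image[OF D1])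
  have K: "vec_submodule k K" unfolding K_def by (rule vec_submodule_mat_kernel[OF D2])
  note Ic = vec_submoduleD(1)[OF I] and Kc = vec_submoduleD(1)[OF K]
  define C where "C = ext_cochains r (ring_module :: ('a, 'a) module) (Suc i)"
  have add: "row_functional k u \<oplus>\<^bsub>C\<^esub> row_functional k w = row_functional k (u + w)"
    if "u \<in> carrier_vec k" "w \<in> carrier_vec k" for u w
    using row_functional_add[of u r "Suc i" w] that by (simp add: C_def k_def)
  have cob: "ext_coboundaries r D (ring_module :: ('a, 'a) module) (Suc i) = row_functional k ` I"
  proof -
    have "ext_differential r D i ` row_functional (r i) ` carrier_vec (r i) = row_functional k ` I"
      unfolding I_def image_image k_def by (rule image_cong[OF refl]) (rule ext_differential_row_functional[of D i r, OF D])
    then show ?thesis unfolding ext_coboundaries_def by (simp add: carrier_ext_cochains)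
  qed
  have cyc: "ext_cocycles r D (ring_module :: ('a, 'a) module) (Suc i) = row_functional k ` K"
  proof (intro equalityI subsetI)
    fix f assume f: "f \<in> ext_cocycles r D (ring_module :: ('a, 'a) module) (Suc i)"
    then obtain u where u: "u \<in> carrier_vec k" "f = row_functional k u"
      unfolding ext_cocycles_def hom_kernel_def carrier_ext_cochains k_def by auto
    have "ext_differential r D (Suc i) f = row_functional (r (Suc (Suc i))) (0\<^sub>v (r (Suc (Suc i))))"
      using f unfolding ext_cocycles_def hom_kernel_def row_functional_zero by simp
    then have "row_functional (r (Suc (Suc i))) (transpose_mat (D (Suc i)) *\<^sub>v u)
        = row_functional (r (Suc (Suc i))) (0\<^sub>v (r (Suc (Suc i))))"
      using ext_differential_row_functional[of D "Suc i" r, OF D', of u] u by (simp add: k_def)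
    then have "transpose_mat (D (Suc i)) *\<^sub>v u = 0\<^sub>v (r (Suc (Suc i)))"
      by (rule row_functional_inj[rotated 2]) (simp_all add: mult_mat_vec_carrier[OF D2 u(1)])
    then have "u \<in> K" unfolding K_def mat_kernel_iff[OF D2] using u(1) by simp
    then show "f \<in> row_functional k ` K" unfolding u(2) by (rule imageI)
  next
    fix f assume "f \<in> row_functional k ` K"
    then obtain u where u: "u \<in> K" "f = row_functional k u" by auto
    have uc: "u \<in> carrier_vec k" and u0: "transpose_mat (D (Suc i)) *\<^sub>v u = 0\<^sub>v (r (Suc (Suc i)))"
      using u(1) unfolding K_def mat_kernel_iff[OF D2] by simp_all
    have "ext_differential r D (Suc i) f = row_functional (r (Suc (Suc i))) (0\<^sub>v (r (Suc (Suc i))))"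
      using ext_differential_row_functional[of D "Suc i" r, OF D', of u] uc unfolding u(2) u0 k_def by simp
    then show "f \<in> ext_cocycles r D (ring_module :: ('a, 'a) module) (Suc i)"
      unfolding ext_cocycles_def hom_kernel_def carrier_ext_cochains row_functional_zero
      using uc unfolding u(2) k_def by simp
  qed
  define H where "H = row_functional k ` I"
  define coset where "coset f = {h \<oplus>\<^bsub>C\<^esub> f | h. h \<in> H}" for f
  have carG: "carrier G = coset ` row_functional k ` K" and oneG: "\<one>\<^bsub>G\<^esub> = H"
    unfolding G_def ext_group_def cob cyc A_FactGroup_def FactGroup_def RCOSETS_def r_coset_def coset_def H_def C_def
    by auto
  have coset_row: "coset (row_functional k f) = row_functional k ` {h + f | h. h \<in> I}" if f: "f \<in> carrier_vec k" for f
  proof (intro equalityI subsetI)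
    fix z assume "z \<in> coset (row_functional k f)"
    then obtain h where h: "h \<in> I" "z = row_functional k h \<oplus>\<^bsub>C\<^esub> row_functional k f"
      unfolding coset_def H_def by auto
    have "z = row_functional k (h + f)" unfolding h(2) by (rule add[OF Ic[OF h(1)] f])
    then show "z \<in> row_functional k ` {h + f | h. h \<in> I}" using h(1) by auto
  next
    fix z assume "z \<in> row_functional k ` {h + f | h. h \<in> I}"
    then obtain h where h: "h \<in> I" "z = row_functional k (h + f)" by auto
    have "z = row_functional k h \<oplus>\<^bsub>C\<^esub> row_functional k f" unfolding h(2) by (rule add[OF Ic[OF h(1)] f, symmetric])
    then show "z \<in> coset (row_functional k f)" unfolding coset_def H_def using h(1) by auto
  qed
  show ?thesis unfolding I_def[symmetric] K_def[symmetric]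
  proof
    assume triv: "carrier G = {\<one>\<^bsub>G\<^esub>}"
    show "K \<subseteq> I"
    proof
      fix f assume f: "f \<in> K"
      have "coset (row_functional k f) \<in> carrier G" unfolding carG using f by auto
      then have "coset (row_functional k f) = H" unfolding triv oneG by simp
      moreover have "\<exists>h. f = h + f \<and> h \<in> I"
        using vec_submoduleD(2)[OF I] Kc[OF f] by (intro exI[of _ "0\<^sub>v k"]) simp
      then have "row_functional k f \<in> coset (row_functional k f)"
        unfolding coset_row[OF Kc[OF f]] by (intro imageI CollectI)
      ultimately obtain h where "h \<in> I" "row_functional k f = row_functional k h" unfolding H_def by auto
      then show "f \<in> I" using row_functional_inj[OF Kc[OF f] Ic, of h] by simp
    qed
  next
    assume KI: "K \<subseteq> I"
    have "coset (row_functional k f) = H" if f: "f \<in> K" for f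
    proof -
      have fI: "f \<in> I" by (rule subsetD[OF KI f])
      have "{h + f | h. h \<in> I} = I"
      proof (intro equalityI subsetI)
        fix z assume "z \<in> {h + f | h. h \<in> I}"
        then show "z \<in> I" using vec_submoduleD(3)[OF I _ fI] by auto
      next
        fix z assume z: "z \<in> I"
        have "z = (z - f) + f" using Ic[OF z] Ic[OF fI] by (intro eq_vecI) simp_all
        then show "z \<in> {h + f | h. h \<in> I}" using vec_submodule_diff[OF I z fI] by blast
      qed
      then show ?thesis unfolding coset_row[OF Kc[OF f]] H_def by simp
    qed
    then have "coset ` row_functional k ` K = {H}" using vec_submoduleD(2)[OF K] by auto
    then show "carrier G = {\<one>\<^bsub>G\<^esub>}" unfolding carG oneG .
  qed
qed

text \<open>Composing \<open>g\<close> with \<open>D 0\<close> gives a cocycle of degree 1. To write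
  it as the coboundary of \<open>h\<close> is to represent \<open>g\<close> by \<open>h\<close> on
  the image of \<open>D 0\<close>.\<close>

lemma functionals_extend_of_resolution:
  fixes D :: "nat \<Rightarrow> 'a::comm_ring_1 mat"
  assumes res: "free_resolution M r D p"
    and triv: "carrier (ext_group r D (ring_module :: ('a, 'a) module) (Suc 0))
      = {\<one>\<^bsub>ext_group r D (ring_module :: ('a, 'a) module) (Suc 0)\<^esub>}"
  shows "functionals_extend (r 0) ((\<lambda>v. D 0 *\<^sub>v v) ` carrier_vec (r (Suc 0)))"
  unfolding functionals_extend_def
proof (intro allI impI)
  let ?Z = "(\<lambda>v. D 0 *\<^sub>v v) ` carrier_vec (r (Suc 0))"
  have D: "D i \<in> carrier_mat (r i) (r (Suc i))" for i using res unfolding free_resolution_def by simp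
  have ex: "mat_kernel (D i) = (\<lambda>v. D (Suc i) *\<^sub>v v) ` carrier_vec (r (Suc (Suc i)))" for i
    using res unfolding free_resolution_def by simp
  note ar = mult_mat_vec_add_smult[OF D[of 0]]
  fix g assume g: "linear_on ?Z g"
  define f where "f = vec (r (Suc 0)) (\<lambda>j. g (D 0 *\<^sub>v unit_vec (r (Suc 0)) j))"
  have f: "f \<in> carrier_vec (r (Suc 0))" by (simp add: f_def)
  have "linear_on (carrier_vec (r (Suc 0))) (\<lambda>v. g (D 0 *\<^sub>v v))"
  proof (rule linear_onI)
    show "g (D 0 *\<^sub>v (x + y)) = g (D 0 *\<^sub>v x) + g (D 0 *\<^sub>v y)"
      if "x \<in> carrier_vec (r (Suc 0))" "y \<in> carrier_vec (r (Suc 0))" for x y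
      unfolding ar(1)[OF that] by (rule linear_onD(1)[OF g imageI[OF that(1)] imageI[OF that(2)]])
    show "g (D 0 *\<^sub>v (s \<cdot>\<^sub>v x)) = s * g (D 0 *\<^sub>v x)" if "x \<in> carrier_vec (r (Suc 0))" for s x
      unfolding ar(2)[OF that] by (rule linear_onD(2)[OF g imageI[OF that]])
  qed
  note fv = linear_functional_eq_scalar_prod[OF this, folded f_def]
  have "f \<in> mat_kernel (transpose_mat (D (Suc 0)))"
  proof -
    have Dt: "transpose_mat (D (Suc 0)) \<in> carrier_mat (r (Suc (Suc 0))) (r (Suc 0))" using D[of "Suc 0"] by simp
    have "transpose_mat (D (Suc 0)) *\<^sub>v f = 0\<^sub>v (r (Suc (Suc 0)))"
    proof (rule eq_vecI)
      fix j assume "j < dim_vec (0\<^sub>v (r (Suc (Suc 0))) :: 'a vec)"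
      then have j: "j < r (Suc (Suc 0))" by simp
      define w where "w = D (Suc 0) *\<^sub>v unit_vec (r (Suc (Suc 0))) j"
      have "w \<in> mat_kernel (D 0)" unfolding ex[of 0] w_def by (rule imageI) simp
      then have w: "w \<in> carrier_vec (r (Suc 0))" "D 0 *\<^sub>v w = 0\<^sub>v (r 0)" unfolding mat_kernel_iff[OF D] by simp_all
      have "(transpose_mat (D (Suc 0)) *\<^sub>v f) $ j = (transpose_mat (D (Suc 0)) *\<^sub>v f) \<bullet> unit_vec (r (Suc (Suc 0))) j"
        using mult_mat_vec_carrier[OF Dt f] j by simp
      also have "\<dots> = f \<bullet> w"
        unfolding w_def by (rule transpose_vec_mult_scalar[OF D unit_vec_carrier f])
      also have "\<dots> = g (0\<^sub>v (r 0))" using fv[OF w(1)] w(2) by simp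
      also have "\<dots> = 0" by (rule linear_on_zero[OF g vec_submodule_mat_image[OF D]])
      finally show "(transpose_mat (D (Suc 0)) *\<^sub>v f) $ j = 0\<^sub>v (r (Suc (Suc 0))) $ j" using j by simp
    qed (use D[of "Suc 0"] in simp)
    then show ?thesis unfolding mat_kernel_iff[OF Dt] using f by simp
  qed
  then have "f \<in> (\<lambda>u. transpose_mat (D 0) *\<^sub>v u) ` carrier_vec (r 0)"
    using triv unfolding ext_group_trivial_iff[of D 0 r, OF D D] by (rule subsetD[rotated])
  then obtain h where h: "h \<in> carrier_vec (r 0)" "f = transpose_mat (D 0) *\<^sub>v h" by auto
  have "g z = h \<bullet> z" if z: "z \<in> ?Z" for z
  proof -
    obtain v where v: "v \<in> carrier_vec (r (Suc 0))" "z = D 0 *\<^sub>v v" using z by auto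
    have "g z = f \<bullet> v" unfolding v(2) by (rule fv[OF v(1)])
    also have "\<dots> = h \<bullet> z" unfolding h(2) v(2) by (rule transpose_vec_mult_scalar[OF D v(1) h(1)])
    finally show ?thesis .
  qed
  then show "\<exists>h\<in>carrier_vec (r 0). \<forall>z\<in>?Z. g z = h \<bullet> z" by (intro bexI[OF _ h(1)] ballI)
qed

text \<open>The alternative \<open>v $ j = 0\<close> is for the minimality arguments, in which one
  column is omitted from the generators.\<close>

lemma mult_mat_vec_in_vec_submodule:
  fixes A :: "'a::comm_ring_1 mat"
  assumes N: "vec_submodule n N" and A: "A \<in> carrier_mat n c" and v: "v \<in> carrier_vec c"
    and cols: "\<And>j. j < c \<Longrightarrow> v $ j = 0 \<or> col A j \<in> N"
  shows "A *\<^sub>v v \<in> N"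
proof -
  note ar = mult_mat_vec_add_smult[OF A]
  have "A *\<^sub>v w \<in> N" if "k \<le> c" "w \<in> carrier_vec c" "\<And>j. j < c \<Longrightarrow> w $ j = 0 \<or> col A j \<in> N"
    "\<And>j. k \<le> j \<Longrightarrow> j < c \<Longrightarrow> w $ j = 0" for k w
    using that
  proof (induction k arbitrary: w)
    case 0
    have "w = 0\<^sub>v c" using 0 by (intro eq_vecI) auto
    then show ?case using ar(4) vec_submoduleD(2)[OF N] by simp
  next
    case (Suc k)
    have k: "k < c" using Suc.prems by simp
    define w' where "w' = vec c (\<lambda>j. if j = k then 0 else w $ j)"
    have w': "w' \<in> carrier_vec c" by (simp add: w'_def)
    have "A *\<^sub>v w' \<in> N"
    proof (rule Suc.IH[OF _ w'])
      show "w' $ j = 0 \<or> col A j \<in> N" if "j < c" for j using Suc.prems(3)[OF that] that by (simp add: w'_def)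
      show "w' $ j = 0" if "k \<le> j" "j < c" for j using Suc.prems(4)[of j] that by (cases "j = k") (simp_all add: w'_def)
    qed (use k in simp)
    moreover have "w $ k \<cdot>\<^sub>v col A k \<in> N"
    proof (cases "w $ k = 0")
      case True
      have "0 \<cdot>\<^sub>v col A k = 0\<^sub>v n" using A by (intro eq_vecI) auto
      then show ?thesis using vec_submoduleD(2)[OF N] True by simp
    next
      case False
      then show ?thesis using Suc.prems(3)[OF k] vec_submoduleD(4)[OF N] by simp
    qed
    ultimately have "A *\<^sub>v w' + w $ k \<cdot>\<^sub>v col A k \<in> N" by (rule vec_submoduleD(3)[OF N])
    moreover have "A *\<^sub>v w = A *\<^sub>v w' + w $ k \<cdot>\<^sub>v col A k"
    proof -
      have u: "w $ k \<cdot>\<^sub>v unit_vec c k \<in> carrier_vec c" by simp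
      have "w = w' + w $ k \<cdot>\<^sub>v unit_vec c k" using Suc.prems(2) k by (intro eq_vecI) (auto simp: w'_def)
      then have "A *\<^sub>v w = A *\<^sub>v (w' + w $ k \<cdot>\<^sub>v unit_vec c k)" by simp
      also have "\<dots> = A *\<^sub>v w' + w $ k \<cdot>\<^sub>v (A *\<^sub>v unit_vec c k)"
        unfolding ar(1)[OF w' u] ar(2)[OF unit_vec_carrier] ..
      also have "A *\<^sub>v unit_vec c k = col A k" using A k by (intro eq_vecI) auto
      finally show ?thesis .
    qed
    ultimately show ?case by simp
  qed
  from this[OF le_refl v cols] show ?thesis by simp
qed

lemma vec_submodule_eq_carrier:
  assumes N: "vec_submodule n N" and units: "\<And>i. i < n \<Longrightarrow> unit_vec n i \<in> N" and v: "v \<in> carrier_vec n"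
  shows "v \<in> N"
proof -
  have "1\<^sub>m n *\<^sub>v v \<in> N"
  proof (rule mult_mat_vec_in_vec_submodule[OF N one_carrier_mat v])
    show "v $ j = 0 \<or> col (1\<^sub>m n) j \<in> N" if "j < n" for j using units[OF that] that by simp
  qed
  then show ?thesis using v by simp
qed

section \<open>Presented modules and their duals\<close>

lemma vec_submodule_of_submodule:
  assumes "LinearCombinations.submodule (class_ring :: 'a::comm_ring_1 ring) N (module_vec TYPE('a) n)"
  shows "vec_submodule n N"
proof (rule vec_submoduleI)
  show "x \<in> carrier_vec n" if "x \<in> N" for x
    using LinearCombinations.submodule.subset[OF assms] that by (auto simp: module_vec_simps)
  show "0\<^sub>v n \<in> N" using LinearCombinations.submodule.zero_closed[OF assms] by (simp add: module_vec_simps)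
  show "x + y \<in> N" if "x \<in> N" "y \<in> N" for x y
    using LinearCombinations.submodule.m_closed[OF assms that] by (simp add: module_vec_simps)
  show "r \<cdot>\<^sub>v x \<in> N" if "x \<in> N" for r x
    using LinearCombinations.submodule.smult_closed[OF assms _ that, of r] by (simp add: module_vec_simps)
qed

lemma submodule_of_vec_submodule:
  assumes N: "vec_submodule n (N :: 'a::comm_ring_1 vec set)"
  shows "LinearCombinations.submodule class_ring N (module_vec TYPE('a) n)"
proof (rule LinearCombinations.submodule.intro)
  show "Module.module (class_ring :: 'a ring) (module_vec TYPE('a) n)" by (rule module_vec_module)
qed (use vec_submoduleD[OF N] in \<open>auto simp: module_vec_simps\<close>)

lemma carrier_dual_iff:
  "f \<in> carrier (dual N) \<longleftrightarrow> f \<in> extensional (carrier N) \<and>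
     (\<forall>x\<in>carrier N. \<forall>y\<in>carrier N. f (x \<oplus>\<^bsub>N\<^esub> y) = f x + f y) \<and> (\<forall>r. \<forall>x\<in>carrier N. f (r \<odot>\<^bsub>N\<^esub> x) = r * f x)"
  unfolding hom_module_def LinearCombinations.module_hom_def ring_module_def by auto

lemma dual_ops:
  "x \<in> carrier N \<Longrightarrow> (f \<oplus>\<^bsub>dual N\<^esub> g) x = f x + g x"
  "x \<in> carrier N \<Longrightarrow> (r \<odot>\<^bsub>dual N\<^esub> f) x = r * f x"
  "f \<oplus>\<^bsub>dual N\<^esub> g \<in> extensional (carrier N)" "r \<odot>\<^bsub>dual N\<^esub> f \<in> extensional (carrier N)"
  "\<zero>\<^bsub>dual N\<^esub> = (\<lambda>x\<in>carrier N. 0)"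
  by (simp_all add: hom_module_def ring_module_def)

text \<open>Exactness of the sequence \<open>R\<^sup>c\<close>, \<open>R\<^sup>n\<close>, M, 0.
  Minimality is kept apart and enters as conditions on the entries and the kernel of
  \<open>A\<close>.\<close>

locale presented_module =
  fixes M :: "('a::comm_ring_1, 'm) module" and n c :: nat and A :: "'a mat" and q :: "'a vec \<Rightarrow> 'm"
  assumes module_M: "Module.module (class_ring :: 'a ring) M"
    and A: "A \<in> carrier_mat n c"
    and q: "q \<in> mhom (module_vec TYPE('a) n) M"
    and q_surj: "q ` carrier_vec n = carrier M"
    and q_ker: "v \<in> carrier_vec n \<Longrightarrow> q v = \<zero>\<^bsub>M\<^esub> \<longleftrightarrow> v \<in> (\<lambda>v. A *\<^sub>v v) ` carrier_vec c"
begin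

lemmas M_arith = class_module_arith[OF module_M]

lemma q_closed: "v \<in> carrier_vec n \<Longrightarrow> q v \<in> carrier M"
  and q_add: "v \<in> carrier_vec n \<Longrightarrow> w \<in> carrier_vec n \<Longrightarrow> q (v + w) = q v \<oplus>\<^bsub>M\<^esub> q w"
  and q_smult: "v \<in> carrier_vec n \<Longrightarrow> q (r \<cdot>\<^sub>v v) = r \<odot>\<^bsub>M\<^esub> q v"
  using mhomD[OF q, of v] by (simp_all add: module_vec_simps)

lemma q_eq_iff:
  assumes v: "v \<in> carrier_vec n" and w: "w \<in> carrier_vec n"
  shows "q v = q w \<longleftrightarrow> v - w \<in> (\<lambda>v. A *\<^sub>v v) ` carrier_vec c"
proof -
  interpret M: Module.module "class_ring :: 'a ring" M by (rule module_M)
  have vw: "v - w \<in> carrier_vec n" using v w by simp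
  have "v = (v - w) + w" using v w by (intro eq_vecI) simp_all
  then have "q v = q (v - w) \<oplus>\<^bsub>M\<^esub> q w" using q_add[OF vw w] by simp
  then have "q v = q w \<longleftrightarrow> q (v - w) = \<zero>\<^bsub>M\<^esub>"
    using q_closed[OF vw] q_closed[OF w] by (metis M.M.add.r_cancel_one')
  then show ?thesis using q_ker[OF vw] by simp
qed

definition lift :: "'m \<Rightarrow> 'a vec" where
  "lift x = (SOME v. v \<in> carrier_vec n \<and> q v = x)"

lemma lift: "x \<in> carrier M \<Longrightarrow> lift x \<in> carrier_vec n" "x \<in> carrier M \<Longrightarrow> q (lift x) = x"
proof -
  assume "x \<in> carrier M"
  then have "\<exists>v. v \<in> carrier_vec n \<and> q v = x" unfolding q_surj[symmetric] by auto
  from someI_ex[OF this] show "lift x \<in> carrier_vec n" "q (lift x) = x" unfolding lift_def by simp_all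
qed

text \<open>The dual of \<open>M\<close> inside \<open>R\<^sup>n\<close>: \<open>u\<close> stands
  for the functional sending \<open>q v\<close> to \<open>u \<bullet> v\<close>.\<close>

abbreviation K :: "'a vec set" where "K \<equiv> mat_kernel (transpose_mat A)"

lemma K_iff: "u \<in> K \<longleftrightarrow> u \<in> carrier_vec n \<and> (\<forall>x\<in>(\<lambda>v. A *\<^sub>v v) ` carrier_vec c. u \<bullet> x = 0)"
proof -
  have At: "transpose_mat A \<in> carrier_mat c n" using A by simp
  show ?thesis unfolding mat_kernel_iff[OF At]
  proof (intro conj_cong refl iffI ballI)
    fix x assume u: "u \<in> carrier_vec n" and 0: "transpose_mat A *\<^sub>v u = 0\<^sub>v c"
      and "x \<in> (\<lambda>v. A *\<^sub>v v) ` carrier_vec c"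
    then obtain v where v: "v \<in> carrier_vec c" "x = A *\<^sub>v v" by auto
    show "u \<bullet> x = 0" using transpose_vec_mult_scalar[OF A v(1) u] v 0 by simp
  next
    assume u: "u \<in> carrier_vec n" and all: "\<forall>x\<in>(\<lambda>v. A *\<^sub>v v) ` carrier_vec c. u \<bullet> x = 0"
    note Au = mult_mat_vec_carrier[OF At u]
    show "transpose_mat A *\<^sub>v u = 0\<^sub>v c"
    proof (rule eq_vecI)
      fix j assume "j < dim_vec (0\<^sub>v c :: 'a vec)"
      then have j: "j < c" by simp
      have "(transpose_mat A *\<^sub>v u) $ j = (transpose_mat A *\<^sub>v u) \<bullet> unit_vec c j" using Au j by simp
      also have "\<dots> = u \<bullet> (A *\<^sub>v unit_vec c j)" by (rule transpose_vec_mult_scalar[OF A unit_vec_carrier u])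
      also have "\<dots> = 0" using all by simp
      finally show "(transpose_mat A *\<^sub>v u) $ j = 0\<^sub>v c $ j" using j by simp
    qed (use A in simp)
  qed
qed

lemma K_carrier: "u \<in> K \<Longrightarrow> u \<in> carrier_vec n"
  unfolding K_iff by simp

lemma vec_annihilator_image: "vec_annihilator n ((\<lambda>v. A *\<^sub>v v) ` carrier_vec c) = K"
  by (rule Set.set_eqI) (simp only: K_iff vec_annihilator_def mem_Collect_eq)

lemma dual_closed:
  assumes f: "f \<in> carrier (dual M)"
  shows "g \<in> carrier (dual M) \<Longrightarrow> f \<oplus>\<^bsub>dual M\<^esub> g \<in> carrier (dual M)" "r \<odot>\<^bsub>dual M\<^esub> f \<in> carrier (dual M)"
proof -
  note fD = f[unfolded carrier_dual_iff]
  show "f \<oplus>\<^bsub>dual M\<^esub> g \<in> carrier (dual M)" if "g \<in> carrier (dual M)"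
    using fD that[unfolded carrier_dual_iff] M_arith(1,9)
    unfolding carrier_dual_iff by (simp add: dual_ops algebra_simps)
  show "r \<odot>\<^bsub>dual M\<^esub> f \<in> carrier (dual M)"
    using fD M_arith(1,9) unfolding carrier_dual_iff by (simp add: dual_ops algebra_simps)
qed

definition row_of :: "('m \<Rightarrow> 'a) \<Rightarrow> 'a vec" where
  "row_of f = vec n (\<lambda>i. f (q (unit_vec n i)))"

lemma row_of_apply:
  assumes f: "f \<in> carrier (dual M)" and v: "v \<in> carrier_vec n"
  shows "f (q v) = row_of f \<bullet> v"
proof -
  note fD = f[unfolded carrier_dual_iff]
  have "linear_on (carrier_vec n) (\<lambda>v. f (q v))"
    by (rule linear_onI) (use fD q_closed in \<open>simp_all add: q_add q_smult\<close>)
  from linear_functional_eq_scalar_prod[OF this v] show ?thesis unfolding row_of_def .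
qed

lemma dual_zero_apply:
  assumes f: "f \<in> carrier (dual M)" shows "f \<zero>\<^bsub>M\<^esub> = 0"
proof -
  have "f (0 \<odot>\<^bsub>M\<^esub> \<zero>\<^bsub>M\<^esub>) = 0 * f \<zero>\<^bsub>M\<^esub>" using f M_arith(10) unfolding carrier_dual_iff by metis
  then show ?thesis unfolding M_arith(8) by simp
qed

lemma row_of_carrier: "row_of f \<in> carrier_vec n"
  by (simp add: row_of_def)

lemma row_of_in_K:
  assumes f: "f \<in> carrier (dual M)" shows "row_of f \<in> K"
  unfolding K_iff
proof (intro conjI ballI row_of_carrier)
  fix x assume x: "x \<in> (\<lambda>v. A *\<^sub>v v) ` carrier_vec c"
  then have xc: "x \<in> carrier_vec n" using mult_mat_vec_carrier[OF A] by auto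
  then have "q x = \<zero>\<^bsub>M\<^esub>" using q_ker x by simp
  then show "row_of f \<bullet> x = 0" using row_of_apply[OF f xc] dual_zero_apply[OF f] by simp
qed

text \<open>Evaluated on chosen preimages; for \<open>u\<close> in \<open>K\<close> the choice is
  immaterial.\<close>

definition functional_of :: "'a vec \<Rightarrow> 'm \<Rightarrow> 'a" where
  "functional_of u = (\<lambda>x\<in>carrier M. u \<bullet> lift x)"

lemma functional_of_apply:
  assumes u: "u \<in> K" and v: "v \<in> carrier_vec n"
  shows "functional_of u (q v) = u \<bullet> v"
proof -
  note uc = K_carrier[OF u]
  have l: "lift (q v) \<in> carrier_vec n" "q (lift (q v)) = q v" using lift[OF q_closed[OF v]] by simp_all
  then have "lift (q v) - v \<in> (\<lambda>v. A *\<^sub>v v) ` carrier_vec c" using q_eq_iff[OF l(1) v] by simp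
  then have "u \<bullet> (lift (q v) - v) = 0" by (rule bspec[OF conjunct2[OF u[unfolded K_iff]]])
  moreover have "u \<bullet> lift (q v) = u \<bullet> (lift (q v) - v) + u \<bullet> v"
  proof -
    have "lift (q v) = (lift (q v) - v) + v" using l(1) v by (intro eq_vecI) simp_all
    then have "u \<bullet> lift (q v) = u \<bullet> ((lift (q v) - v) + v)" by (rule arg_cong)
    also have "\<dots> = u \<bullet> (lift (q v) - v) + u \<bullet> v"
      by (rule scalar_prod_add_distrib[OF uc _ v]) (use l(1) v in simp)
    finally show ?thesis .
  qed
  ultimately show ?thesis using q_closed[OF v] by (simp add: functional_of_def)
qed

lemma carrierE:
  assumes "x \<in> carrier M" obtains v where "v \<in> carrier_vec n" "x = q v"
  using assms lift[of x] by metis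

lemma functional_of_dual:
  assumes u: "u \<in> K" shows "functional_of u \<in> carrier (dual M)"
  unfolding carrier_dual_iff
proof (intro conjI ballI allI)
  note uc = K_carrier[OF u]
  show "functional_of u \<in> extensional (carrier M)" by (simp add: functional_of_def)
  fix x assume "x \<in> carrier M"
  then obtain v where v: "v \<in> carrier_vec n" "x = q v" by (rule carrierE)
  show "functional_of u (x \<oplus>\<^bsub>M\<^esub> y) = functional_of u x + functional_of u y" if y: "y \<in> carrier M" for y
  proof -
    obtain w where w: "w \<in> carrier_vec n" "y = q w" using y by (rule carrierE)
    have vw: "v + w \<in> carrier_vec n" using v w by simp
    show ?thesis
      unfolding v(2) w(2) q_add[OF v(1) w(1), symmetric] functional_of_apply[OF u v(1)]
        functional_of_apply[OF u w(1)] functional_of_apply[OF u vw] by (rule scalar_prod_add_distrib[OF uc v(1) w(1)])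
  qed
  show "functional_of u (r \<odot>\<^bsub>M\<^esub> x) = r * functional_of u x" for r
  proof -
    have rv: "r \<cdot>\<^sub>v v \<in> carrier_vec n" using v by simp
    show ?thesis
      unfolding v(2) q_smult[OF v(1), symmetric] functional_of_apply[OF u v(1)] functional_of_apply[OF u rv]
      by (rule scalar_prod_smult_distrib[OF uc v(1)])
  qed
qed

lemma dual_eqI:
  assumes "f \<in> extensional (carrier M)" "g \<in> extensional (carrier M)"
    "\<And>v. v \<in> carrier_vec n \<Longrightarrow> f (q v) = g (q v)"
  shows "f = g"
proof (rule extensionalityI[OF assms(1,2)])
  fix x assume "x \<in> carrier M"
  then obtain v where "v \<in> carrier_vec n" "x = q v" by (rule carrierE)
  then show "f x = g x" using assms(3) by simp
qed

lemma functional_of_row_of: "f \<in> carrier (dual M) \<Longrightarrow> functional_of (row_of f) = f"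
proof -
  assume f: "f \<in> carrier (dual M)"
  show ?thesis
  proof (rule dual_eqI)
    show "f \<in> extensional (carrier M)" using f unfolding carrier_dual_iff by simp
    show "functional_of (row_of f) (q v) = f (q v)" if v: "v \<in> carrier_vec n" for v
      unfolding functional_of_apply[OF row_of_in_K[OF f] v] row_of_apply[OF f v] ..
  qed (simp add: functional_of_def)
qed

lemma row_of_functional_of:
  assumes u: "u \<in> K" shows "row_of (functional_of u) = u"
proof (rule eq_vecI)
  fix i assume "i < dim_vec u"
  then have i: "i < n" using K_carrier[OF u] by simp
  show "row_of (functional_of u) $ i = u $ i"
    using functional_of_apply[OF u unit_vec_carrier[of n i]] K_carrier[OF u] i by (simp add: row_of_def)
qed (use K_carrier[OF u] in \<open>simp add: row_of_def\<close>)

lemma vec_submodule_K: "vec_submodule n K"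
  by (rule vec_submodule_mat_kernel) (use A in simp)

lemma functional_of_ops:
  assumes u: "u \<in> K"
  shows "w \<in> K \<Longrightarrow> functional_of (u + w) = functional_of u \<oplus>\<^bsub>dual M\<^esub> functional_of w"
    "functional_of (r \<cdot>\<^sub>v u) = r \<odot>\<^bsub>dual M\<^esub> functional_of u"
proof -
  show "functional_of (u + w) = functional_of u \<oplus>\<^bsub>dual M\<^esub> functional_of w" if w: "w \<in> K"
  proof (rule dual_eqI)
    note uw = vec_submoduleD(3)[OF vec_submodule_K u w]
    show "functional_of (u + w) (q v) = (functional_of u \<oplus>\<^bsub>dual M\<^esub> functional_of w) (q v)"
      if v: "v \<in> carrier_vec n" for v
      unfolding dual_ops(1)[OF q_closed[OF v]] functional_of_apply[OF u v] functional_of_apply[OF w v]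
        functional_of_apply[OF uw v] by (rule add_scalar_prod_distrib[OF K_carrier[OF u] K_carrier[OF w] v])
  qed (simp_all add: functional_of_def dual_ops)
  show "functional_of (r \<cdot>\<^sub>v u) = r \<odot>\<^bsub>dual M\<^esub> functional_of u"
  proof (rule dual_eqI)
    note ru = vec_submoduleD(4)[OF vec_submodule_K u, of r]
    show "functional_of (r \<cdot>\<^sub>v u) (q v) = (r \<odot>\<^bsub>dual M\<^esub> functional_of u) (q v)" if v: "v \<in> carrier_vec n" for v
      unfolding dual_ops(2)[OF q_closed[OF v]] functional_of_apply[OF u v] functional_of_apply[OF ru v]
      by (rule smult_scalar_prod_distrib[OF K_carrier[OF u] v])
  qed (simp_all add: functional_of_def dual_ops)
qed

lemma functional_of_zero: "functional_of (0\<^sub>v n) = \<zero>\<^bsub>dual M\<^esub>"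
  by (rule ext) (simp add: functional_of_def dual_ops(5) lift restrict_def)

lemma row_of_zero: "row_of \<zero>\<^bsub>dual M\<^esub> = 0\<^sub>v n"
  using q_closed[OF unit_vec_carrier] by (intro eq_vecI) (simp_all add: row_of_def dual_ops(5))

text \<open>Ext^1 of \<open>M\<close>, injectivity of biduality and Ext^1 of the dual give the three
  parts. Vanishing is known for some resolution only, so it has to be carried over to the
  presentation by \<open>A\<close>; for the dual, the resolution itself supplies the generators
  \<open>P\<close>.\<close>

lemma ext_torsionless_of_totally_reflexive:
  assumes tr: "totally_reflexive M"
  shows "ext_torsionless n ((\<lambda>v. A *\<^sub>v v) ` carrier_vec c)"
  unfolding ext_torsionless_def vec_annihilator_image
proof (intro conjI ballI impI)
  let ?Z = "(\<lambda>v. A *\<^sub>v v) ` carrier_vec c"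
  show Z: "vec_submodule n ?Z" by (rule vec_submodule_mat_image[OF A])
  have bij: "bij_betw (biduality M) (carrier M) (carrier (dual (dual M)))"
    and ev: "ext_vanishes (Suc 0) M (ring_module :: ('a, 'a) module)"
    "ext_vanishes (Suc 0) (dual M) (ring_module :: ('a, 'a) module)"
    using tr unfolding totally_reflexive_def by simp_all
  show "functionals_extend n ?Z"
  proof -
    obtain r D p where res: "free_resolution M r D p"
      and triv: "carrier (ext_group r D (ring_module :: ('a, 'a) module) (Suc 0))
        = {\<one>\<^bsub>ext_group r D (ring_module :: ('a, 'a) module) (Suc 0)\<^esub>}"
      using ev(1) unfolding ext_vanishes_def by (elim exE conjE)
    have D: "D 0 \<in> carrier_mat (r 0) (r (Suc 0))" and p: "p \<in> mhom (module_vec TYPE('a) (r 0)) M"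
      and ps: "p ` carrier_vec (r 0) = carrier M"
      and pk: "hom_kernel (module_vec TYPE('a) (r 0)) M p = (\<lambda>v. D 0 *\<^sub>v v) ` carrier_vec (r (Suc 0))"
      using res unfolding free_resolution_def by simp_all
    let ?Y = "(\<lambda>v. D 0 *\<^sub>v v) ` carrier_vec (r (Suc 0))"
    have pY: "v \<in> ?Y \<longleftrightarrow> v \<in> carrier_vec (r 0) \<and> p v = \<zero>\<^bsub>M\<^esub>" for v
      unfolding pk[symmetric] by (simp add: hom_kernel_def module_vec_simps)
    have pc: "p v \<in> carrier M" and padd: "w \<in> carrier_vec (r 0) \<Longrightarrow> p (v + w) = p v \<oplus>\<^bsub>M\<^esub> p w"
      and psm: "p (s \<cdot>\<^sub>v v) = s \<odot>\<^bsub>M\<^esub> p v" if "v \<in> carrier_vec (r 0)" for v w s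
      using mhomD[OF p, of v] that by (simp_all add: module_vec_simps)
    \<comment> \<open>Projectivity of a free module, with the lift written as a matrix.\<close>
    have lift_matrix: "\<exists>S. S \<in> carrier_mat b k \<and> (\<forall>x\<in>carrier_vec k. f (S *\<^sub>v x) = g x)"
      if f: "f \<in> mhom (module_vec TYPE('a) b) M" "f ` carrier_vec b = carrier M"
        and g: "g \<in> mhom (module_vec TYPE('a) k) M"
      for b k and f g :: "'a vec \<Rightarrow> 'm"
    proof -
      have fl: "f v \<in> carrier M" "w \<in> carrier_vec b \<Longrightarrow> f (v + w) = f v \<oplus>\<^bsub>M\<^esub> f w" "f (s \<cdot>\<^sub>v v) = s \<odot>\<^bsub>M\<^esub> f v"
        if "v \<in> carrier_vec b" for v w s using mhomD[OF f(1), of v] that by (simp_all add: module_vec_simps)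
      have gl: "g v \<in> carrier M" "w \<in> carrier_vec k \<Longrightarrow> g (v + w) = g v \<oplus>\<^bsub>M\<^esub> g w" "g (s \<cdot>\<^sub>v v) = s \<odot>\<^bsub>M\<^esub> g v"
        if "v \<in> carrier_vec k" for v w s using mhomD[OF g, of v] that by (simp_all add: module_vec_simps)
      have "\<exists>v\<in>carrier_vec b. f v = g (unit_vec k j)" for j
        using gl(1)[OF unit_vec_carrier[of k j]] unfolding f(2)[symmetric] by auto
      then obtain h where h: "\<And>j. h j \<in> carrier_vec b" "\<And>j. f (h j) = g (unit_vec k j)" by metis
      define S where "S = mat b k (\<lambda>(i, j). h j $ i)"
      have S: "S \<in> carrier_mat b k" by (simp add: S_def)
      note Sar = mult_mat_vec_add_smult[OF S]
      have f0: "f (0\<^sub>v b) = \<zero>\<^bsub>M\<^esub>"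
      proof -
        have "0 \<cdot>\<^sub>v 0\<^sub>v b = (0\<^sub>v b :: 'a vec)" by (intro eq_vecI) simp_all
        then show ?thesis using fl(3)[OF zero_carrier_vec, of 0] M_arith(6)[OF fl(1)[OF zero_carrier_vec]] by simp
      qed
      have g0: "g (0\<^sub>v k) = \<zero>\<^bsub>M\<^esub>"
      proof -
        have "0 \<cdot>\<^sub>v 0\<^sub>v k = (0\<^sub>v k :: 'a vec)" by (intro eq_vecI) simp_all
        then show ?thesis using gl(3)[OF zero_carrier_vec, of 0] M_arith(6)[OF gl(1)[OF zero_carrier_vec]] by simp
      qed
      define N where "N = {x \<in> carrier_vec k. f (S *\<^sub>v x) = g x}"
      have N: "vec_submodule k N"
      proof (rule vec_submoduleI)
        show "0\<^sub>v k \<in> N" unfolding N_def using f0 g0 Sar(4) by simp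
        show "x + y \<in> N" if "x \<in> N" "y \<in> N" for x y
          using that fl(2)[OF Sar(5)[of x] Sar(5)[of y]] gl(2)[of x y] Sar(1)[of x y] unfolding N_def by simp
        show "s \<cdot>\<^sub>v x \<in> N" if "x \<in> N" for s x
          using that fl(3)[OF Sar(5)[of x], of s] gl(3)[of x s] Sar(2)[of x s] unfolding N_def by simp
      qed (simp add: N_def)
      have un: "unit_vec k j \<in> N" if j: "j < k" for j
      proof -
        have "S *\<^sub>v unit_vec k j = h j"
          using j carrier_vecD[OF h(1)[of j]] by (intro eq_vecI) (simp_all add: S_def)
        then show ?thesis unfolding N_def using h(2) by simp
      qed
      have "\<forall>x\<in>carrier_vec k. x \<in> N" by (rule ballI, rule vec_submodule_eq_carrier[OF N un])
      then show ?thesis using S unfolding N_def by auto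
    qed
    obtain S where S: "S \<in> carrier_mat n (r 0)" and qS: "\<forall>x\<in>carrier_vec (r 0). q (S *\<^sub>v x) = p x"
      using lift_matrix[OF q q_surj p] by (elim exE conjE)
    obtain T where T: "T \<in> carrier_mat (r 0) n" and pT: "\<forall>x\<in>carrier_vec n. p (T *\<^sub>v x) = q x"
      using lift_matrix[OF p ps q] by (elim exE conjE)
    show ?thesis
    proof (rule functionals_extend_transfer[OF S T _ _ _ vec_submodule_mat_image[OF D] Z
          functionals_extend_of_resolution[OF res triv]])
      show "S *\<^sub>v x \<in> ?Z" if x: "x \<in> ?Y" for x
        using x qS q_ker[of "S *\<^sub>v x"] mult_mat_vec_carrier[OF S, of x] unfolding pY by simp
      show "T *\<^sub>v z \<in> ?Y" if z: "z \<in> ?Z" for z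
      proof -
        have zc: "z \<in> carrier_vec n" by (rule vec_submoduleD(1)[OF Z z])
        show ?thesis unfolding pY using mult_mat_vec_carrier[OF T zc] pT zc q_ker[OF zc] z by simp
      qed
      show "z - S *\<^sub>v (T *\<^sub>v z) \<in> ?Z" if z: "z \<in> carrier_vec n" for z
      proof -
        have Tz: "T *\<^sub>v z \<in> carrier_vec (r 0)" by (rule mult_mat_vec_carrier[OF T z])
        have "q z = q (S *\<^sub>v (T *\<^sub>v z))" using qS pT z Tz by simp
        then show ?thesis using q_eq_iff[OF z mult_mat_vec_carrier[OF S Tz]] by simp
      qed
    qed
  qed
  show "x \<in> ?Z" if x: "x \<in> carrier_vec n" and K0: "\<forall>u\<in>K. u \<bullet> x = 0" for x
  proof -
    \<comment> \<open>If every vector of \<open>K\<close> pairs to 0 with \<open>x\<close>, all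
      functionals vanish at \<open>q x\<close>, and injective biduality makes \<open>q x\<close>
      zero.\<close>
    have "f (q x) = f \<zero>\<^bsub>M\<^esub>" if f: "f \<in> carrier (dual M)" for f
      using row_of_apply[OF f x] row_of_in_K[OF f] K0 dual_zero_apply[OF f] by simp
    then have "biduality M (q x) = biduality M \<zero>\<^bsub>M\<^esub>" unfolding biduality_def by (intro restrict_ext)
    then have "q x = \<zero>\<^bsub>M\<^esub>"
      using inj_onD[OF bij_betw_imp_inj_on[OF bij]] q_closed[OF x] M_arith(10) by metis
    then show ?thesis using q_ker[OF x] by simp
  qed
  show "\<exists>t P. P \<in> carrier_mat n t \<and> K = (\<lambda>v. P *\<^sub>v v) ` carrier_vec t \<and> functionals_extend t (mat_kernel P)"
  proof -
    obtain r D p where res: "free_resolution (dual M) r D p"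
      and triv: "carrier (ext_group r D (ring_module :: ('a, 'a) module) (Suc 0))
        = {\<one>\<^bsub>ext_group r D (ring_module :: ('a, 'a) module) (Suc 0)\<^esub>}"
      using ev(2) unfolding ext_vanishes_def by (elim exE conjE)
    have p: "p \<in> mhom (module_vec TYPE('a) (r 0)) (dual M)" and ps: "p ` carrier_vec (r 0) = carrier (dual M)"
      and pk: "hom_kernel (module_vec TYPE('a) (r 0)) (dual M) p = (\<lambda>v. D 0 *\<^sub>v v) ` carrier_vec (r (Suc 0))"
      using res unfolding free_resolution_def by simp_all
    let ?Y = "(\<lambda>v. D 0 *\<^sub>v v) ` carrier_vec (r (Suc 0))"
    have pY: "v \<in> ?Y \<longleftrightarrow> v \<in> carrier_vec (r 0) \<and> p v = \<zero>\<^bsub>dual M\<^esub>" for v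
      unfolding pk[symmetric] by (simp add: hom_kernel_def module_vec_simps)
    have pc: "p v \<in> carrier (dual M)" and padd: "w \<in> carrier_vec (r 0) \<Longrightarrow> p (v + w) = p v \<oplus>\<^bsub>dual M\<^esub> p w"
      and psm: "p (s \<cdot>\<^sub>v v) = s \<odot>\<^bsub>dual M\<^esub> p v" if "v \<in> carrier_vec (r 0)" for v w s
      using mhomD[OF p, of v] that by (simp_all add: module_vec_simps)
    \<comment> \<open>Column j is the row vector of the j-th generator of the dual. As
      \<open>row_of\<close> is injective on the dual, the kernel of \<open>P\<close> is that of the
      augmentation.\<close>
    define P where "P = mat n (r 0) (\<lambda>(i, j). p (unit_vec (r 0) j) (q (unit_vec n i)))"
    have P: "P \<in> carrier_mat n (r 0)" by (simp add: P_def)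
    have Pz: "row_of (p z) = P *\<^sub>v z" if z: "z \<in> carrier_vec (r 0)" for z
    proof (rule eq_vecI)
      fix i assume "i < dim_vec (P *\<^sub>v z)"
      then have i: "i < n" using P by simp
      note qi = q_closed[OF unit_vec_carrier[of n i]]
      have "linear_on (carrier_vec (r 0)) (\<lambda>z. p z (q (unit_vec n i)))"
        by (rule linear_onI) (simp_all add: padd psm dual_ops qi)
      from linear_functional_eq_scalar_prod[OF this z]
      have "p z (q (unit_vec n i)) = vec (r 0) (\<lambda>j. p (unit_vec (r 0) j) (q (unit_vec n i))) \<bullet> z" .
      also have "\<dots> = (P *\<^sub>v z) $ i" using i by (simp add: P_def)
      finally show "row_of (p z) $ i = (P *\<^sub>v z) $ i" using i by (simp add: row_of_def)
    qed (simp add: row_of_def P_def)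
    have "K = (\<lambda>v. P *\<^sub>v v) ` carrier_vec (r 0)"
    proof (intro equalityI subsetI)
      fix u assume u: "u \<in> K"
      have "functional_of u \<in> p ` carrier_vec (r 0)" unfolding ps by (rule functional_of_dual[OF u])
      then obtain z where z: "functional_of u = p z" "z \<in> carrier_vec (r 0)" by auto
      have "u = P *\<^sub>v z" using row_of_functional_of[OF u] Pz[OF z(2)] z(1) by simp
      then show "u \<in> (\<lambda>v. P *\<^sub>v v) ` carrier_vec (r 0)" using z(2) by (rule image_eqI)
    next
      fix u assume "u \<in> (\<lambda>v. P *\<^sub>v v) ` carrier_vec (r 0)"
      then obtain z where z: "z \<in> carrier_vec (r 0)" "u = P *\<^sub>v z" by auto
      show "u \<in> K" using row_of_in_K[OF pc[OF z(1)]] unfolding Pz[OF z(1)] z(2) .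
    qed
    moreover have "mat_kernel P = ?Y"
    proof (intro equalityI subsetI)
      fix z assume "z \<in> mat_kernel P"
      then have z: "z \<in> carrier_vec (r 0)" "P *\<^sub>v z = 0\<^sub>v n" unfolding mat_kernel_iff[OF P] by simp_all
      have "p z = functional_of (row_of (p z))" by (rule functional_of_row_of[symmetric, OF pc[OF z(1)]])
      also have "\<dots> = \<zero>\<^bsub>dual M\<^esub>" unfolding Pz[OF z(1)] z(2) by (rule functional_of_zero)
      finally show "z \<in> ?Y" unfolding pY using z(1) by simp
    next
      fix z assume "z \<in> ?Y"
      then have z: "z \<in> carrier_vec (r 0)" "p z = \<zero>\<^bsub>dual M\<^esub>" unfolding pY by simp_all
      then show "z \<in> mat_kernel P" unfolding mat_kernel_iff[OF P] using Pz[OF z(1)] row_of_zero by simp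
    qed
    then have "functionals_extend (r 0) (mat_kernel P)"
      using functionals_extend_of_resolution[OF res triv] by simp
    ultimately show ?thesis using P by (intro exI[of _ "r 0"] exI[of _ P] conjI)
  qed
qed

end

section \<open>Total reflexivity from an exact complex of triangular matrices\<close>

context ezd_cube_zero_local_ring
begin

text \<open>Iterated partners on both sides of \<open>A\<close> give a complex ..., F 2, F 1, A, C
  1, C 2, ... that is exact also after transposition. The half ending with \<open>A\<close> resolves
  \<open>M\<close>, and the transposes of the other half resolve its dual. Dualizing either
  resolution gives an exact complex again, so all higher Ext groups vanish.\<close>

lemma totally_reflexive_of_ezd_triangular:
  fixes M :: "('a, 'm) module"
  assumes pm: "presented_module M n n A q" and A: "ezd_triangular n A" and fg: "finitely_generated M"
  shows "totally_reflexive M"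
proof -
  interpret P: presented_module M n n A q by (rule pm)
  obtain nx where nx: "\<And>B. ezd_triangular n B \<Longrightarrow> exact_partner n B (nx B)"
    using right_partner_exists by metis
  obtain pv where pv: "\<And>B. ezd_triangular n B \<Longrightarrow> exact_partner n (pv B) B"
    using left_partner_exists by metis
  define F where "F k = (nx ^^ k) A" for k
  define C where "C k = (pv ^^ k) A" for k
  have F0: "F 0 = A" and C0: "C 0 = A" by (simp_all add: F_def C_def)
  have Ft: "ezd_triangular n (F k)" for k
  proof (induction k)
    case (Suc k)
    then show ?case using exact_partnerD(8)[OF nx[OF Suc]] by (simp add: F_def)
  qed (simp add: F_def A)
  have Ct: "ezd_triangular n (C k)" for k
  proof (induction k)
    case (Suc k)
    then show ?case using exact_partnerD(7)[OF pv[OF Suc]] by (simp add: C_def)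
  qed (simp add: C_def A)
  have F: "exact_partner n (F k) (F (Suc k))" for k using nx[OF Ft[of k]] by (simp add: F_def)
  have C: "exact_partner n (C (Suc k)) (C k)" for k using pv[OF Ct[of k]] by (simp add: C_def)
  have Fc: "F k \<in> carrier_mat n n" for k by (rule ezd_triangularD(1)[OF Ft])
  have Cc: "C k \<in> carrier_mat n n" for k by (rule ezd_triangularD(1)[OF Ct])
  have Ctc: "transpose_mat (C k) \<in> carrier_mat n n" for k using Cc[of k] by simp
  define C1 where "C1 = C (Suc 0)"
  have C1: "C1 \<in> carrier_mat n n" and C1t: "transpose_mat C1 \<in> carrier_mat n n" using Cc Ctc by (simp_all add: C1_def)
  have K: "P.K = (\<lambda>v. transpose_mat C1 *\<^sub>v v) ` carrier_vec n"
    using mat_kernel_transpose_exact_partner[OF C[of 0]] by (simp only: C0 C1_def)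
  have CK: "transpose_mat C1 *\<^sub>v u \<in> P.K" if "u \<in> carrier_vec n" for u unfolding K using that by (rule imageI)
  note C1ar = mult_mat_vec_add_smult[OF C1t]
  have extM: "ext_vanishes (Suc i) M (ring_module :: ('a, 'a) module)" for i
  proof -
    have "free_resolution M (\<lambda>_. n) F q"
      unfolding free_resolution_def
    proof (intro conjI allI)
      show "hom_kernel (module_vec TYPE('a) n) M q = (\<lambda>v. F 0 *\<^sub>v v) ` carrier_vec n"
      proof (intro equalityI subsetI)
        fix v assume "v \<in> hom_kernel (module_vec TYPE('a) n) M q"
        then show "v \<in> (\<lambda>v. F 0 *\<^sub>v v) ` carrier_vec n"
          using P.q_ker[of v] by (simp add: hom_kernel_def module_vec_simps F0)
      next
        fix v assume v: "v \<in> (\<lambda>v. F 0 *\<^sub>v v) ` carrier_vec n"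
        then have "v \<in> carrier_vec n" using mult_mat_vec_carrier[OF Fc] by auto
        then show "v \<in> hom_kernel (module_vec TYPE('a) n) M q"
          using P.q_ker[of v] v by (simp add: hom_kernel_def module_vec_simps F0)
      qed
      show "mat_kernel (F k) = (\<lambda>v. F (Suc k) *\<^sub>v v) ` carrier_vec n" for k
        by (rule mat_kernel_exact_partner[OF F])
    qed (rule Fc P.q P.q_surj)+
    moreover have "carrier (ext_group (\<lambda>_. n) F (ring_module :: ('a, 'a) module) (Suc i))
        = {\<one>\<^bsub>ext_group (\<lambda>_. n) F (ring_module :: ('a, 'a) module) (Suc i)\<^esub>}"
      unfolding ext_group_trivial_iff[of F i "\<lambda>_. n", OF Fc Fc] mat_kernel_transpose_exact_partner[OF F] by simp
    ultimately show ?thesis unfolding ext_vanishes_def by (intro exI conjI)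
  qed
  \<comment> \<open>The dual is the image of the transpose of \<open>C1\<close>, so \<open>u\<close>
    parametrizes the functional sending \<open>q v\<close> to
    \<open>u \<bullet> (C1 *\<^sub>v v)\<close>.\<close>
  define p where "p u = P.functional_of (transpose_mat C1 *\<^sub>v u)" for u
  have p: "p \<in> mhom (module_vec TYPE('a) n) (dual M)"
  proof (rule mhomI)
    show "p x \<in> carrier (dual M)" if "x \<in> carrier (module_vec TYPE('a) n)" for x
      unfolding p_def using P.functional_of_dual[OF CK] that by (simp add: module_vec_simps)
    show "p (x \<oplus>\<^bsub>module_vec TYPE('a) n\<^esub> y) = p x \<oplus>\<^bsub>dual M\<^esub> p y"
      if "x \<in> carrier (module_vec TYPE('a) n)" "y \<in> carrier (module_vec TYPE('a) n)" for x y
      using P.functional_of_ops(1)[OF CK CK, of x y] C1ar(1)[of x y] that by (simp add: module_vec_simps p_def)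
    show "p (r \<odot>\<^bsub>module_vec TYPE('a) n\<^esub> x) = r \<odot>\<^bsub>dual M\<^esub> p x"
      if "x \<in> carrier (module_vec TYPE('a) n)" for r x
      using P.functional_of_ops(2)[OF CK, of x r] C1ar(2)[of x r] that by (simp add: module_vec_simps p_def)
  qed
  have dualE: "\<exists>u\<in>carrier_vec n. f = p u" if f: "f \<in> carrier (dual M)" for f
  proof -
    obtain u where "u \<in> carrier_vec n" "P.row_of f = transpose_mat C1 *\<^sub>v u"
      using P.row_of_in_K[OF f] unfolding K by auto
    then show ?thesis using P.functional_of_row_of[OF f] by (intro bexI[of _ u]) (simp_all add: p_def)
  qed
  have p_dual: "p u \<in> carrier (dual M)" if "u \<in> carrier_vec n" for u
    unfolding p_def by (rule P.functional_of_dual[OF CK[OF that]])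
  have ps: "p ` carrier_vec n = carrier (dual M)"
    using dualE p_dual by (intro equalityI subsetI) auto
  have p0: "p u = \<zero>\<^bsub>dual M\<^esub> \<longleftrightarrow> u \<in> mat_kernel (transpose_mat C1)" if u: "u \<in> carrier_vec n" for u
  proof
    assume "p u = \<zero>\<^bsub>dual M\<^esub>"
    then have "transpose_mat C1 *\<^sub>v u = 0\<^sub>v n"
      using P.row_of_functional_of[OF CK[OF u]] P.row_of_zero by (simp add: p_def)
    then show "u \<in> mat_kernel (transpose_mat C1)" unfolding mat_kernel_iff[OF C1t] using u by simp
  next
    assume "u \<in> mat_kernel (transpose_mat C1)"
    then show "p u = \<zero>\<^bsub>dual M\<^esub>" unfolding mat_kernel_iff[OF C1t] p_def by (simp add: P.functional_of_zero)
  qed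
  \<comment> \<open>The index is shifted by two: \<open>C 0\<close> is \<open>A\<close>, and the
    transpose of \<open>C 1\<close> is already used in the augmentation \<open>p\<close>.\<close>
  define E where "E k = transpose_mat (C (Suc (Suc k)))" for k
  have Ec: "E k \<in> carrier_mat n n" for k unfolding E_def by (rule Ctc)
  have kerC1: "mat_kernel (transpose_mat C1) = (\<lambda>v. E 0 *\<^sub>v v) ` carrier_vec n"
    unfolding E_def C1_def by (rule mat_kernel_transpose_exact_partner[OF C])
  have extD: "ext_vanishes (Suc i) (dual M) (ring_module :: ('a, 'a) module)" for i
  proof -
    have "free_resolution (dual M) (\<lambda>_. n) E p"
      unfolding free_resolution_def
    proof (intro conjI allI)
      show "hom_kernel (module_vec TYPE('a) n) (dual M) p = (\<lambda>v. E 0 *\<^sub>v v) ` carrier_vec n"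
        unfolding kerC1[symmetric]
      proof (intro equalityI subsetI)
        fix v assume "v \<in> hom_kernel (module_vec TYPE('a) n) (dual M) p"
        then show "v \<in> mat_kernel (transpose_mat C1)" using p0[of v] by (simp add: hom_kernel_def module_vec_simps)
      next
        fix v assume v: "v \<in> mat_kernel (transpose_mat C1)"
        then have "v \<in> carrier_vec n" unfolding mat_kernel_iff[OF C1t] by simp
        then show "v \<in> hom_kernel (module_vec TYPE('a) n) (dual M) p"
          using p0[of v] v by (simp add: hom_kernel_def module_vec_simps)
      qed
      show "mat_kernel (E k) = (\<lambda>v. E (Suc k) *\<^sub>v v) ` carrier_vec n" for k
        unfolding E_def by (rule mat_kernel_transpose_exact_partner[OF C])
    qed (rule Ec p ps)+
    moreover have "carrier (ext_group (\<lambda>_. n) E (ring_module :: ('a, 'a) module) (Suc i))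
        = {\<one>\<^bsub>ext_group (\<lambda>_. n) E (ring_module :: ('a, 'a) module) (Suc i)\<^esub>}"
      unfolding ext_group_trivial_iff[of E i "\<lambda>_. n", OF Ec Ec]
      by (simp add: E_def mat_kernel_exact_partner[OF C])
    ultimately show ?thesis unfolding ext_vanishes_def by (intro exI conjI)
  qed
  note carrier_bidual = carrier_dual_iff[of _ "dual M"]
  have bid: "biduality M x \<in> carrier (dual (dual M))" if x: "x \<in> carrier M" for x
    unfolding carrier_bidual biduality_def using x P.dual_closed by (simp add: dual_ops)
  have bid_hom: "biduality M \<in> mhom M (dual (dual M))"
  proof (rule mhomI)
    show "biduality M (x \<oplus>\<^bsub>M\<^esub> y) = biduality M x \<oplus>\<^bsub>dual (dual M)\<^esub> biduality M y"
      if "x \<in> carrier M" "y \<in> carrier M" for x y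
    proof (rule ext)
      fix f show "biduality M (x \<oplus>\<^bsub>M\<^esub> y) f = (biduality M x \<oplus>\<^bsub>dual (dual M)\<^esub> biduality M y) f"
      proof (cases "f \<in> carrier (dual M)")
        case True
        have "f (x \<oplus>\<^bsub>M\<^esub> y) = f x + f y" using True that unfolding carrier_dual_iff by simp
        then show ?thesis unfolding dual_ops(1)[OF True] using True by (simp add: biduality_def)
      next
        case False
        then show ?thesis using extensional_arb[OF dual_ops(3) False] by (simp add: biduality_def)
      qed
    qed
    show "biduality M (r \<odot>\<^bsub>M\<^esub> x) = r \<odot>\<^bsub>dual (dual M)\<^esub> biduality M x" if "x \<in> carrier M" for r x
    proof (rule ext)
      fix f show "biduality M (r \<odot>\<^bsub>M\<^esub> x) f = (r \<odot>\<^bsub>dual (dual M)\<^esub> biduality M x) f"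
      proof (cases "f \<in> carrier (dual M)")
        case True
        have "f (r \<odot>\<^bsub>M\<^esub> x) = r * f x" using True that unfolding carrier_dual_iff by simp
        then show ?thesis unfolding dual_ops(2)[OF True] using True by (simp add: biduality_def)
      next
        case False
        then show ?thesis using extensional_arb[OF dual_ops(4) False] by (simp add: biduality_def)
      qed
    qed
  qed (rule bid)
  have p_apply: "p u (q v) = u \<bullet> (C1 *\<^sub>v v)" if u: "u \<in> carrier_vec n" and v: "v \<in> carrier_vec n" for u v
    unfolding p_def P.functional_of_apply[OF CK[OF u] v] by (rule transpose_vec_mult_scalar[OF C1 v u])
  have kerC1': "mat_kernel C1 = (\<lambda>v. A *\<^sub>v v) ` carrier_vec n"
    using mat_kernel_exact_partner[OF C[of 0]] by (simp only: C0 C1_def)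
  \<comment> \<open>Evaluating at \<open>p (unit_vec n i)\<close> reads off the entries of C1 v, and
    the kernel of \<open>C1\<close> is the image of \<open>A\<close>.\<close>
  have inj: "inj_on (biduality M) (carrier M)"
  proof (rule inj_onI)
    fix x y assume "x \<in> carrier M" "y \<in> carrier M" and eq: "biduality M x = biduality M y"
    obtain v where v: "v \<in> carrier_vec n" "x = q v" using \<open>x \<in> carrier M\<close> by (rule P.carrierE)
    obtain w where w: "w \<in> carrier_vec n" "y = q w" using \<open>y \<in> carrier M\<close> by (rule P.carrierE)
    note Cv = mult_mat_vec_carrier[OF C1 v(1)] and Cw = mult_mat_vec_carrier[OF C1 w(1)]
    have "C1 *\<^sub>v v = C1 *\<^sub>v w"
    proof (rule eq_vecI)
      fix i assume "i < dim_vec (C1 *\<^sub>v w)"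
      then have i: "i < n" using C1 by simp
      have "biduality M x (p (unit_vec n i)) = biduality M y (p (unit_vec n i))" by (simp only: eq)
      then have "p (unit_vec n i) (q v) = p (unit_vec n i) (q w)"
        using p_dual[OF unit_vec_carrier] v(2) w(2) by (simp add: biduality_def)
      then show "(C1 *\<^sub>v v) $ i = (C1 *\<^sub>v w) $ i"
        unfolding p_apply[OF unit_vec_carrier v(1)] p_apply[OF unit_vec_carrier w(1)] using Cv Cw i by simp
    qed (use C1 in simp)
    then have "C1 *\<^sub>v (v - w) = 0\<^sub>v n"
      unfolding mult_mat_vec_add_smult(3)[OF C1 v(1) w(1)] using Cw by simp
    then have "v - w \<in> mat_kernel C1" unfolding mat_kernel_iff[OF C1] using v w by simp
    then show "x = y" unfolding v(2) w(2) P.q_eq_iff[OF v(1) w(1)] kerC1' .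
  qed
  have surj: "\<Phi> \<in> biduality M ` carrier M" if \<Phi>: "\<Phi> \<in> carrier (dual (dual M))" for \<Phi>
  proof -
    note \<Phi>D = \<Phi>[unfolded carrier_bidual]
    have pl: "p (u + w) = p u \<oplus>\<^bsub>dual M\<^esub> p w" "p (r \<cdot>\<^sub>v u) = r \<odot>\<^bsub>dual M\<^esub> p u"
      if "u \<in> carrier_vec n" "w \<in> carrier_vec n" for u w r
      using mhomD(2,3)[OF p, of u] that by (simp_all add: module_vec_simps)
    have lin: "linear_on (carrier_vec n) (\<lambda>u. \<Phi> (p u))"
    proof (rule linear_onI)
      show "\<Phi> (p (u + w)) = \<Phi> (p u) + \<Phi> (p w)" if "u \<in> carrier_vec n" "w \<in> carrier_vec n" for u w
        using \<Phi>D p_dual[OF that(1)] p_dual[OF that(2)] pl(1)[OF that] by simp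
      show "\<Phi> (p (r \<cdot>\<^sub>v u)) = r * \<Phi> (p u)" if "u \<in> carrier_vec n" for r u
        using \<Phi>D p_dual[OF that] pl(2)[OF that that] by simp
    qed
    \<comment> \<open>\<open>f\<close> represents \<open>\<Phi>\<close> after \<open>p\<close>. It
      is orthogonal to the kernel of the transposed \<open>C1\<close>, which is the image of the
      transposed \<open>C2\<close>; so it lies in the kernel of \<open>C2\<close>, which is the
      image of \<open>C1\<close>. A preimage \<open>x\<close> gives the element sought.\<close>
    define f where "f = vec n (\<lambda>j. \<Phi> (p (unit_vec n j)))"
    have f: "f \<in> carrier_vec n" by (simp add: f_def)
    note fu = linear_functional_eq_scalar_prod[OF lin, folded f_def]
    define C2 where "C2 = C (Suc (Suc 0))"
    have C2: "C2 \<in> carrier_mat n n" and C2t: "transpose_mat C2 \<in> carrier_mat n n" using Cc Ctc by (simp_all add: C2_def)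
    note C2f = mult_mat_vec_carrier[OF C2 f]
    have "C2 *\<^sub>v f = 0\<^sub>v n"
    proof (rule eq_vecI)
      fix i assume "i < dim_vec (0\<^sub>v n :: 'a vec)"
      then have i: "i < n" by simp
      define u where "u = transpose_mat C2 *\<^sub>v unit_vec n i"
      have uc: "u \<in> carrier_vec n" unfolding u_def by (rule mult_mat_vec_carrier[OF C2t unit_vec_carrier])
      have "u \<in> mat_kernel (transpose_mat C1)" unfolding kerC1 E_def u_def C2_def by (rule imageI) simp
      then have "p u = p (0\<^sub>v n)"
        using p0[OF uc] p0[OF zero_carrier_vec] C1ar(4) unfolding mat_kernel_iff[OF C1t] by simp
      then have "f \<bullet> u = f \<bullet> 0\<^sub>v n" using fu[OF uc] fu[OF zero_carrier_vec] by simp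
      moreover have "(C2 *\<^sub>v f) $ i = unit_vec n i \<bullet> (C2 *\<^sub>v f)" using C2f i by simp
      moreover have "unit_vec n i \<bullet> (C2 *\<^sub>v f) = u \<bullet> f"
        unfolding u_def by (rule transpose_vec_mult_scalar[symmetric, OF C2 f unit_vec_carrier])
      moreover have "u \<bullet> f = f \<bullet> u" by (rule comm_scalar_prod[OF uc f])
      ultimately show "(C2 *\<^sub>v f) $ i = 0\<^sub>v n $ i" using f i by simp
    qed (use C2 in simp)
    then have "f \<in> mat_kernel C2" unfolding mat_kernel_iff[OF C2] using f by simp
    then have "f \<in> (\<lambda>v. C1 *\<^sub>v v) ` carrier_vec n"
      unfolding C2_def C1_def mat_kernel_exact_partner[OF C] .
    then obtain x where x: "x \<in> carrier_vec n" "f = C1 *\<^sub>v x" by auto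
    have "\<Phi> = biduality M (q x)"
    proof (rule extensionalityI)
      show "\<Phi> \<in> extensional (carrier (dual M))" using \<Phi>D by simp
      show "biduality M (q x) \<in> extensional (carrier (dual M))" by (simp add: biduality_def)
      fix g assume g: "g \<in> carrier (dual M)"
      obtain u where u: "u \<in> carrier_vec n" "g = p u" using dualE[OF g] by (elim bexE)
      have "\<Phi> g = f \<bullet> u" unfolding u(2) by (rule fu[OF u(1)])
      also have "\<dots> = u \<bullet> f" by (rule comm_scalar_prod[OF f u(1)])
      also have "\<dots> = p u (q x)" unfolding p_apply[OF u(1) x(1)] x(2) ..
      finally show "\<Phi> g = biduality M (q x) g" using g u(2) by (simp add: biduality_def)
    qed
    then show ?thesis using P.q_closed[OF x(1)] by (rule image_eqI)
  qed
  have "bij_betw (biduality M) (carrier M) (carrier (dual (dual M)))"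
    unfolding bij_betw_def using inj surj bid by (intro conjI equalityI subsetI) auto
  moreover have "ext_vanishes i M (ring_module :: ('a, 'a) module) \<and> ext_vanishes i (dual M) (ring_module :: ('a, 'a) module)"
    if "i > 0" for i using extM[of "i - 1"] extD[of "i - 1"] that by simp
  ultimately show ?thesis
    unfolding totally_reflexive_def using P.module_M fg bid_hom by simp
qed

end

section \<open>Minimal presentations\<close>

lemma fspan_facts:
  fixes M :: "('a::comm_ring_1, 'm) module"
  assumes M: "Module.module (class_ring :: 'a ring) M" and S: "S \<subseteq> carrier M"
  shows "LinearCombinations.submodule class_ring (fspan M S) M" "S \<subseteq> fspan M S"
    "LinearCombinations.submodule class_ring N M \<Longrightarrow> S \<subseteq> N \<Longrightarrow> fspan M S \<subseteq> N"
proof -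
  interpret M: Module.module "class_ring :: 'a ring" M by (rule M)
  show "LinearCombinations.submodule class_ring (fspan M S) M" by (rule M.span_is_submodule[OF S])
  show "S \<subseteq> fspan M S" by (rule M.in_own_span[OF S])
  show "fspan M S \<subseteq> N" if "LinearCombinations.submodule class_ring N M" "S \<subseteq> N"
    by (rule M.span_is_subset[OF that(2,1)])
qed

context cube_zero_local_ring
begin

text \<open>A unit entry would express one generator of \<open>M\<close> by the others, against the
  minimal number of generators. A unit coordinate of a kernel vector would do the same for a column,
  against minimality of the relations.\<close>

lemma presentation_matrixE:
  fixes M :: "('a, 'm) module"
  assumes M: "Module.module (class_ring :: 'a ring) M" and pres: "presentation_matrix M A" and A: "A \<in> carrier_mat n c"
  obtains q where "presented_module M n c A q" "\<And>i j. i < n \<Longrightarrow> j < c \<Longrightarrow> A $$ (i, j) \<in> \<mm>"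
    "\<And>v j. v \<in> carrier_vec c \<Longrightarrow> A *\<^sub>v v = 0\<^sub>v n \<Longrightarrow> j < c \<Longrightarrow> v $ j \<in> \<mm>"
proof -
  have dims: "dim_row A = n" "dim_col A = c" using A by simp_all
  define V where "V = module_vec TYPE('a) n"
  have V: "Module.module (class_ring :: 'a ring) V" unfolding V_def by (rule module_vec_module)
  have Vc: "carrier V = carrier_vec n" by (simp add: V_def module_vec_simps)
  obtain q where q: "q \<in> mhom V M" and qs: "q ` carrier V = carrier M"
    and span: "fspan V (col A ` {..<c}) = hom_kernel V M q"
    and minimal: "\<And>J. J \<subset> {..<c} \<Longrightarrow> fspan V (col A ` J) \<noteq> hom_kernel V M q"
    and nmin: "n = min_number_of_generators M"
    using pres unfolding presentation_matrix_def Let_def dims V_def by auto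
  note ar = mult_mat_vec_add_smult[OF A]
  have colV: "col A ` J \<subseteq> carrier V" for J unfolding Vc using A by auto
  have colI: "A *\<^sub>v unit_vec c j = col A j" if "j < c" for j using A that by (intro eq_vecI) auto
  have span_im: "fspan V (col A ` {..<c}) = (\<lambda>v. A *\<^sub>v v) ` carrier_vec c"
  proof (rule equalityI)
    show "fspan V (col A ` {..<c}) \<subseteq> (\<lambda>v. A *\<^sub>v v) ` carrier_vec c"
    proof (rule fspan_facts(3)[OF V colV])
      show "LinearCombinations.submodule class_ring ((\<lambda>v. A *\<^sub>v v) ` carrier_vec c) V"
        unfolding V_def by (rule submodule_of_vec_submodule[OF vec_submodule_mat_image[OF A]])
      show "col A ` {..<c} \<subseteq> (\<lambda>v. A *\<^sub>v v) ` carrier_vec c"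
      proof
        fix x assume "x \<in> col A ` {..<c}"
        then obtain j where j: "j < c" "x = col A j" by auto
        show "x \<in> (\<lambda>v. A *\<^sub>v v) ` carrier_vec c" unfolding j(2) colI[OF j(1), symmetric] by (rule imageI) simp
      qed
    qed
    note N = vec_submodule_of_submodule[OF fspan_facts(1)[OF V colV, unfolded V_def], folded V_def]
    show "(\<lambda>v. A *\<^sub>v v) ` carrier_vec c \<subseteq> fspan V (col A ` {..<c})"
    proof
      fix x assume "x \<in> (\<lambda>v. A *\<^sub>v v) ` carrier_vec c"
      then obtain v where v: "v \<in> carrier_vec c" "x = A *\<^sub>v v" by auto
      show "x \<in> fspan V (col A ` {..<c})" unfolding v(2)
        by (rule mult_mat_vec_in_vec_submodule[OF N A v(1)])
          (use fspan_facts(2)[OF V colV, of "{..<c}"] in auto)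
    qed
  qed
  have pm: "presented_module M n c A q"
  proof (rule presented_module.intro)
    show "Module.module (class_ring :: 'a ring) M" by (rule M)
    show "A \<in> carrier_mat n c" by (rule A)
    show "q \<in> mhom (module_vec TYPE('a) n) M" using q by (simp only: V_def)
    show "q ` carrier_vec n = carrier M" using qs by (simp only: Vc)
    show "q v = \<zero>\<^bsub>M\<^esub> \<longleftrightarrow> v \<in> (\<lambda>v. A *\<^sub>v v) ` carrier_vec c" if "v \<in> carrier_vec n" for v
      unfolding span_im[symmetric] span using that by (simp add: hom_kernel_def Vc)
  qed
  interpret P: presented_module M n c A q by (rule pm)
  have entries: "A $$ (i, j) \<in> \<mm>" if i: "i < n" and j: "j < c" for i j
  proof (rule ccontr)
    assume "A $$ (i, j) \<notin> \<mm>"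
    then obtain u where u: "u * A $$ (i, j) = 1" by (rule unitE)
    define S where "S = (\<lambda>k. q (unit_vec n k)) ` ({..<n} - {i})"
    have S: "S \<subseteq> carrier M" unfolding S_def using P.q_closed[OF unit_vec_carrier] by auto
    define N where "N = {v \<in> carrier_vec n. q v \<in> fspan M S}"
    note sp = fspan_facts(1)[OF M S]
    have q0: "q (0\<^sub>v n) = \<zero>\<^bsub>M\<^esub>"
      using P.q_ker[OF zero_carrier_vec] vec_submoduleD(2)[OF vec_submodule_mat_image[OF A]] by simp
    have N: "vec_submodule n N"
    proof (rule vec_submoduleI)
      show "0\<^sub>v n \<in> N" unfolding N_def using q0 LinearCombinations.submodule.zero_closed[OF sp] by simp
      show "x + y \<in> N" if "x \<in> N" "y \<in> N" for x y
        using that LinearCombinations.submodule.m_closed[OF sp] P.q_add unfolding N_def by simp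
      show "r \<cdot>\<^sub>v x \<in> N" if "x \<in> N" for r x
        using that LinearCombinations.submodule.smult_closed[OF sp, of r] P.q_smult unfolding N_def by simp
    qed (simp add: N_def)
    have unit: "unit_vec n k \<in> N" if k: "k < n" "k \<noteq> i" for k
    proof -
      have "q (unit_vec n k) \<in> S" unfolding S_def using k by auto
      then show ?thesis unfolding N_def using fspan_facts(2)[OF M S] by auto
    qed
    have cj: "col A j \<in> carrier_vec n" using A j by auto
    have "col A j \<in> (\<lambda>v. A *\<^sub>v v) ` carrier_vec c" unfolding colI[OF j, symmetric] by (rule imageI) simp
    then have "q (col A j) = \<zero>\<^bsub>M\<^esub>" using P.q_ker[OF cj] by simp
    then have colN: "col A j \<in> N" unfolding N_def using cj LinearCombinations.submodule.zero_closed[OF sp] by simp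
    \<comment> \<open>\<open>u\<close> inverts the entry at (i, j), so coordinate \<open>i\<close>
      of \<open>w\<close> is 0 and \<open>w\<close> involves the remaining unit vectors
      only.\<close>
    define w where "w = unit_vec n i + (- u) \<cdot>\<^sub>v col A j"
    have w: "w \<in> carrier_vec n" unfolding w_def using cj by simp
    have wi: "w $ i = 0" unfolding w_def using cj A i j u by simp
    have "1\<^sub>m n *\<^sub>v w \<in> N"
    proof (rule mult_mat_vec_in_vec_submodule[OF N one_carrier_mat w])
      show "w $ k = 0 \<or> col (1\<^sub>m n) k \<in> N" if "k < n" for k
        using wi unit[OF that] that by (cases "k = i") simp_all
    qed
    then have "w + u \<cdot>\<^sub>v col A j \<in> N" using vec_submoduleD(3)[OF N _ vec_submoduleD(4)[OF N colN]] w by simp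
    moreover have "w + u \<cdot>\<^sub>v col A j = unit_vec n i" 
      unfolding w_def using carrier_vecD[OF cj] by (intro eq_vecI) (simp_all del: dim_col)
    ultimately have uN: "unit_vec n k \<in> N" if "k < n" for k using unit[OF that] by (cases "k = i") simp_all
    have "fspan M S = carrier M"
    proof (rule equalityI)
      show "fspan M S \<subseteq> carrier M" by (rule LinearCombinations.submodule.subset[OF sp])
      show "carrier M \<subseteq> fspan M S"
      proof
        fix x assume "x \<in> carrier M"
        then obtain v where v: "v \<in> carrier_vec n" "x = q v" by (rule P.carrierE)
        have "v \<in> N" by (rule vec_submodule_eq_carrier[OF N uN v(1)])
        then show "x \<in> fspan M S" unfolding v(2) N_def by simp
      qed
    qed
    then have "min_number_of_generators M \<le> card S"
      unfolding min_number_of_generators_def using S by (intro Least_le exI[of _ S] conjI) (simp_all add: S_def)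
    also have "card S \<le> card ({..<n} - {i})" unfolding S_def by (rule card_image_le) simp
    also have "\<dots> < n" using i by simp
    finally show False using nmin by simp
  qed
  have kernel: "v $ j \<in> \<mm>" if v: "v \<in> carrier_vec c" "A *\<^sub>v v = 0\<^sub>v n" and j: "j < c" for v j
  proof (rule ccontr)
    assume "v $ j \<notin> \<mm>"
    then obtain u where u: "u * v $ j = 1" by (rule unitE)
    define J where "J = {..<c} - {j}"
    have JC: "J \<subset> {..<c}" unfolding J_def using j by auto
    note sJ = fspan_facts[OF V colV[of J]]
    note N = vec_submodule_of_submodule[OF sJ(1)[unfolded V_def], folded V_def]
    \<comment> \<open>\<open>w\<close> has the same image as unit vector \<open>j\<close>, namely
      column \<open>j\<close>, but its own coordinate \<open>j\<close> is 0.\<close>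
    define w where "w = unit_vec c j + (- u) \<cdot>\<^sub>v v"
    have uv: "(- u) \<cdot>\<^sub>v v \<in> carrier_vec c" using v by simp
    have w: "w \<in> carrier_vec c" unfolding w_def using v by simp
    have wj: "w $ j = 0" unfolding w_def using v j u by simp
    have "A *\<^sub>v w \<in> fspan V (col A ` J)"
    proof (rule mult_mat_vec_in_vec_submodule[OF N A w])
      show "w $ k = 0 \<or> col A k \<in> fspan V (col A ` J)" if "k < c" for k
        using wj that subsetD[OF sJ(2)] by (cases "k = j") (auto simp: J_def)
    qed
    moreover have "A *\<^sub>v w = col A j"
      unfolding w_def ar(1)[OF unit_vec_carrier uv] ar(2)[OF v(1)] v(2) colI[OF j] using A j
      by (intro eq_vecI) auto
    ultimately have cj: "col A j \<in> fspan V (col A ` J)" by simp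
    have sub: "col A ` {..<c} \<subseteq> fspan V (col A ` J)"
    proof
      fix x assume "x \<in> col A ` {..<c}"
      then obtain k where "k < c" "x = col A k" by auto
      then show "x \<in> fspan V (col A ` J)" using cj subsetD[OF sJ(2)] by (cases "k = j") (auto simp: J_def)
    qed
    have "fspan V (col A ` J) = fspan V (col A ` {..<c})"
    proof (rule equalityI)
      show "fspan V (col A ` {..<c}) \<subseteq> fspan V (col A ` J)" by (rule fspan_facts(3)[OF V colV sJ(1) sub])
      have "col A ` J \<subseteq> fspan V (col A ` {..<c})" using fspan_facts(2)[OF V colV, of "{..<c}"] by (auto simp: J_def)
      then show "fspan V (col A ` J) \<subseteq> fspan V (col A ` {..<c})" by (rule sJ(3)[OF fspan_facts(1)[OF V colV]])
    qed
    then show False using minimal[OF JC] span by simp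
  qed
  show ?thesis by (rule that[OF pm entries kernel])
qed

end

text \<open>A unit of \<open>R/\<mm>\<close> lifts to a unit of \<open>R\<close> since \<open>\<mm>\<close> is nilpotent.\<close>

lemma cube_zero_local_ringI:
  fixes \<mm> :: "'a::comm_ring_1 set"
  assumes max: "maximalideal \<mm> class_ring"
    and cube: "\<mm> \<cdot>\<^bsub>class_ring\<^esub> \<mm> \<cdot>\<^bsub>class_ring\<^esub> \<mm> = {0}"
  shows "cube_zero_local_ring \<mm> (\<mm> \<cdot>\<^bsub>class_ring\<^esub> \<mm>)"
proof (rule cube_zero_local_ring.intro)
  show I: "ideal \<mm> class_ring" by (rule maximalideal.axioms(1)[OF max])
  show "ideal (\<mm> \<cdot>\<^bsub>class_ring\<^esub> \<mm>) class_ring" by (rule ring.ideal_prod_is_ideal[OF class_ring.ring_axioms I I])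
  show W: "x * y \<in> \<mm> \<cdot>\<^bsub>class_ring\<^esub> \<mm>" if "x \<in> \<mm>" "y \<in> \<mm>" for x y
    using ideal_prod.prod[OF that, of class_ring] by simp
  show "\<mm> \<cdot>\<^bsub>class_ring\<^esub> \<mm> \<subseteq> \<mm>" using ring.ideal_prod_inter[OF class_ring.ring_axioms I I] by simp
  show mW: "x * w = 0" if "x \<in> \<mm>" "w \<in> \<mm> \<cdot>\<^bsub>class_ring\<^esub> \<mm>" for x w
    using ideal_prod.prod[OF that(2,1), of class_ring] unfolding cube by (simp add: mult.commute)
  show "x \<in> \<mm> \<longleftrightarrow> \<not> x dvd 1" for x
  proof
    assume x: "x \<in> \<mm>"
    show "\<not> x dvd 1"
    proof
      assume "x dvd 1"
      then obtain u where "1 = x * u" by (rule dvdE)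
      then have "1 \<in> \<mm>" using ideal_mult[OF I x, of u] by (simp add: mult.commute)
      then have "r \<in> \<mm>" for r using ideal_mult[OF I, of 1 r] by simp
      then show False using maximalideal.I_notcarr[OF max] by auto
    qed
  next
    assume nx: "\<not> x dvd 1"
    \<comment> \<open>\<open>J\<close> is \<open>\<mm>\<close> + R x; by maximality it equals
      \<open>\<mm>\<close> unless it contains 1.\<close>
    define J where "J = {z. \<exists>r. z - r * x \<in> \<mm>}"
    have J_iff: "z \<in> J \<longleftrightarrow> (\<exists>r. z - r * x \<in> \<mm>)" for z by (simp only: J_def mem_Collect_eq)
    have mJ: "\<mm> \<subseteq> J"
    proof
      fix z assume "z \<in> \<mm>"
      then have "z - 0 * x \<in> \<mm>" by simp
      then show "z \<in> J" unfolding J_iff by (rule exI)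
    qed
    have xJ: "x \<in> J"
    proof -
      have "x - 1 * x \<in> \<mm>" using ideal_zero[OF I] by simp
      then show ?thesis unfolding J_iff by (rule exI)
    qed
    have J: "ideal J class_ring"
    proof (rule ideal_class_ringI)
      show "0 \<in> J" by (rule subsetD[OF mJ ideal_zero[OF I]])
    next
      fix p q assume "p \<in> J" "q \<in> J"
      then obtain r r' where "p - r * x \<in> \<mm>" "q - r' * x \<in> \<mm>" unfolding J_iff by (elim exE)
      then have "(p - r * x) + (q - r' * x) \<in> \<mm>" by (rule ideal_add[OF I])
      also have "(p - r * x) + (q - r' * x) = (p + q) - (r + r') * x" by (simp add: algebra_simps)
      finally show "p + q \<in> J" unfolding J_iff by (rule exI)
    next
      fix s p assume "p \<in> J"
      then obtain r where "p - r * x \<in> \<mm>" unfolding J_iff by (elim exE)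
      then have "s * (p - r * x) \<in> \<mm>" by (rule ideal_mult[OF I])
      also have "s * (p - r * x) = s * p - (s * r) * x" by (simp add: algebra_simps)
      finally show "s * p \<in> J" unfolding J_iff by (rule exI)
    qed
    have "1 \<notin> J"
    proof
      assume "1 \<in> J"
      then obtain r where s: "1 - r * x \<in> \<mm>" unfolding J_iff by (elim exE)
      define s where "s = 1 - r * x"
      \<comment> \<open>Nilpotency of \<open>s\<close> inverts 1 - s = r x by a finite geometric
        series.\<close>
      have "s * (s * s) = 0" unfolding s_def by (rule mW[OF s W[OF s s]])
      then have "(1 - s) * (1 + s + s * s) = 1" by (simp add: algebra_simps)
      then have "1 = x * (r * (1 + s + s * s))" unfolding s_def by (simp add: ac_simps)
      then have "x dvd 1" by (rule dvdI)
      with nx show False ..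
    qed
    then have "J \<noteq> carrier class_ring" by auto
    then have "J = \<mm>" using maximalideal.I_maximal[OF max J mJ] by auto
    then show "x \<in> \<mm>" using xJ by simp
  qed
qed

theorem corollary14:
  fixes \<mm> :: "'a::comm_ring_1 set"
    and M :: "('a, 'm) module"
    and A :: "'a mat"
  assumes noetherian: "noetherian_ring (class_ring :: 'a ring)"
    and local: "maximalideal \<mm> class_ring" "\<And>J. maximalideal J class_ring \<Longrightarrow> J = \<mm>"
    and not_gorenstein: "\<not> gorenstein TYPE('a)"
    and cube_zero: "\<mm> \<cdot>\<^bsub>class_ring\<^esub> \<mm> \<cdot>\<^bsub>class_ring\<^esub> \<mm> = {0}"
    and square_nonzero: "\<mm> \<cdot>\<^bsub>class_ring\<^esub> \<mm> \<noteq> {0}"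
    and ezd: "\<exists>a::'a. a \<noteq> 0 \<and> exact_zero_divisor a"
    and M: "Module.module class_ring M"
    and presentation: "presentation_matrix M A"
    and triangular: "square_mat A" "upper_triangular A"
  shows "(\<forall>i < dim_row A. A $$ (i, i) \<noteq> 0 \<and> exact_zero_divisor (A $$ (i, i)))
           \<longleftrightarrow> totally_reflexive M"
proof -
  interpret cube_zero_local_ring \<mm> "\<mm> \<cdot>\<^bsub>class_ring\<^esub> \<mm>" by (rule cube_zero_local_ringI[OF local(1) cube_zero])
  \<comment> \<open>\<open>gorensteinI\<close> belongs to the smaller locale, interpreted just
    before, and supplies \<open>nonscalar\<close> here.\<close>
  interpret ezd_cube_zero_local_ring \<mm> "\<mm> \<cdot>\<^bsub>class_ring\<^esub> \<mm>"
  proof (rule ezd_cube_zero_local_ring.intro[OF cube_zero_local_ring_axioms ezd_cube_zero_local_ring_axioms.intro])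
    show "\<exists>a b::'a. exact_pair a b" using ezd unfolding exact_zero_divisor_iff .
    show "\<not> functionals_scalar" using gorensteinI not_gorenstein by (rule contrapos_nn[rotated])
  qed (rule square_nonzero noetherian)+
  define n where "n = dim_row A"
  have A: "A \<in> carrier_mat n n" using triangular(1) by (intro carrier_matI) (simp_all add: n_def)
  obtain q where pm: "presented_module M n n A q" and entries: "\<And>i j. i < n \<Longrightarrow> j < n \<Longrightarrow> A $$ (i, j) \<in> \<mm>"
    and kernel: "\<And>v j. v \<in> carrier_vec n \<Longrightarrow> A *\<^sub>v v = 0\<^sub>v n \<Longrightarrow> j < n \<Longrightarrow> v $ j \<in> \<mm>"
    by (rule presentation_matrixE[OF M presentation A]) (rule that)
  interpret presented_module M n n A q by (rule pm)
  show ?thesis unfolding exact_zero_divisor_iff n_def[symmetric]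
  proof
    assume "\<forall>i<n. \<exists>b. exact_pair (A $$ (i, i)) b"
    then have "ezd_triangular n A" unfolding ezd_triangular_def using A triangular(2) entries by simp
    moreover have "finitely_generated M" using presentation by (simp add: presentation_matrix_def Let_def)
    ultimately show "totally_reflexive M" by (rule totally_reflexive_of_ezd_triangular[OF pm])
  next
    assume "totally_reflexive M"
    then have H: "ext_torsionless n ((\<lambda>v. A *\<^sub>v v) ` carrier_vec n)" by (rule ext_torsionless_of_totally_reflexive)
    show "\<forall>i<n. \<exists>b. exact_pair (A $$ (i, i)) b"
      by (intro allI impI) (rule diagonal_exact_pair[OF A triangular(2) entries kernel H])
  qed
qed

end
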